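(* Let the operators $\mathcal A(t)$, $t\ge 0$, satisfy the standing assumptions listed in the context, and let $G(t,s)$, $t\ge s\ge 0$, be the associated evolution operator. Let $s\ge 0$, $p\in[1,+\infty)$, and let $\{\mu_t: t\ge 0\}$ be a tight evolution system of measures for $G(t,s)$. Write $m_s(f)=\int_{\mathbb R^d} f\,d\mu_s$. Then: (i) $\|G(t,s)f-m_s(f)\|_{L^p(\mathbb R^d,\mu_t)}\to 0$ as $t\to+\infty$ for each $f\in L^p(\mathbb R^d,\mu_s)$. (ii) For each $f\in C_b(\mathbb R^d)$, $G(t,s)f$ tends to $m_s(f)$ locally uniformly in $\mathbb R^d$ as $t\to+\infty$.
   Context: Notation: $\mathbb R_+=[0,+\infty)$; $B_R$ is the open ball in $\mathbb R^d$ centered at $0$ with radius $R$; $C_b$ denotes bounded continuous functions. Standing assumptions. For smooth $\varphi:\mathbb R^d\to\mathbb R$ and $t\ge 0$ let $$\mathcal A(t)\varphi=\sum_{i,j=1}^d q_{ij}(t,\cdot)D_{ij}\varphi+\sum_{i=1}^d b_i(t,\cdot)D_i\varphi,$$ with $Q=(q_{ij})$, $b=(b_1,\dots,b_d)$, such that: (i) For some $\alpha\in(0,1)$ all $q_{ij},b_i$ belong to $C^{\alpha/2,1+\alpha}_{\rm loc}(\mathbb R_+\times\mathbb R^d)$ (i.e. they and their first-order spatial derivatives are locally Hölder continuous with exponent $\alpha/2$ in $t$ and $\alpha$ in $x$). Moreover $q_{ij}\in C_b(\mathbb R_+\times B_R)$ and $D_kq_{ij},b_j\in C_b(\mathbb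 R_+;L^{p_0}(B_R))$ for all $i,j,k\in\{1,\dots,d\}$, all $R>0$ and some $p_0>d+2$. (ii) $Q(t,x)$ is symmetric and $\langle Q(t,x)\xi,\xi\rangle\ge\eta(t,x)|\xi|^2$ for all $t\ge 0$, $x,\xi\in\mathbb R^d$ and a function $\eta:\mathbb R_+\times\mathbb R^d\to\mathbb R$ with $\eta_0:=\inf\eta>0$. (iii) There exist a function $0<V\in C^2(\mathbb R^d)$ and constants $a\ge 0$, $\kappa>0$ such that $V(x)\to+\infty$ as $|x|\to+\infty$ and $(\mathcal A(t)V)(x)\le a-\kappa V(x)$ for all $(t,x)\in\mathbb R_+\times\mathbb R^d$. (iv) There exist $c_0\ge 0$ and $r_0\in\mathbb R$ such that $|\nabla_xQ(t,x)|\le c_0\eta(t,x)$ and $\langle\nabla_xb(t,x)\xi,\xi\rangle\le r_0|\xi|^2$ for all $t\ge 0$, $x,\xi\in\mathbb R^d$. (v) There exists $c>0$ such that either $|Q(t,x)|\le c(1+|x|)V(x)$ and $\langle b(t,x),x\rangle\le c(1+|x|^2)V(x)$ for all $(t,x)\in\mathbb R_+\times\mathbb R^d$, or $|Q(t,x)|\le c$ for all $(t,x)\in\mathbb R_+\times\mathbb R^d$. Evolution operator. For $f\in C_b(\mathbb R^d)$ and $s\ge 0$, $G(\cdot,s)f$ is the unique solution $u\in C_b([s,+\infty)\times\mathbb R^d)\cap C^{1,2}((s,+\infty)\times\mathbb R^d)$ of $D_tu=\mathcal A(t)u$ on $(s,+\infty)\times\mathbb R^d$ with $u(s,\cdot)=f$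 (known to exist under these assumptions). Evolution system of measures: a family of Borel probability measures $\{\mu_t:t\ge 0\}$ on $\mathbb R^d$ with $\int_{\mathbb R^d}G(t,s)f\,d\mu_t=\int_{\mathbb R^d}f\,d\mu_s$ for all $f\in C_b(\mathbb R^d)$, $t\ge s\ge 0$. It is tight if for every $\varepsilon>0$ there is $R>0$ with $\mu_t(B_R)\ge 1-\varepsilon$ for all $t\ge 0$. Given an evolution system of measures, $G(t,s)$ satisfies $\|G(t,s)f\|_{L^p(\mathbb R^d,\mu_t)}\le\|f\|_{L^p(\mathbb R^d,\mu_s)}$ for $f\in C_b(\mathbb R^d)$ and $p\in[1,+\infty)$, and is extended by density to a contraction $L^p(\mathbb R^d,\mu_s)\to L^p(\mathbb R^d,\mu_t)$, still denoted $G(t,s)$. *)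

theory Defs
  imports "HOL-Probability.Probability"
begin

text \<open>Spatial partial derivatives are taken through the Frechet derivative. In the classes below,
  Frechet differentiability together with continuity of the \<open>D i\<close> is the same as existence and
  continuity of the partial derivatives.\<close>
definition D :: "'n::finite \<Rightarrow> (real^'n \<Rightarrow> real) \<Rightarrow> real^'n \<Rightarrow> real" where
  "D i \<phi> x = frechet_derivative \<phi> (at x) (axis i 1)"

definition opA :: "(real \<Rightarrow> real^'n \<Rightarrow> real^'n^'n) \<Rightarrow> (real \<Rightarrow> real^'n \<Rightarrow> real^'n)
    \<Rightarrow> real \<Rightarrow> (real^'n::finite \<Rightarrow> real) \<Rightarrow> real^'n \<Rightarrow> real" where
  "opA Q b t \<phi> x = (\<Sum>i\<in>UNIV. \<Sum>j\<in>UNIV. Q t x $ i $ j * D i (D j \<phi>) x)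
                  + (\<Sum>i\<in>UNIV. b t x $ i * D i \<phi> x)"

definition C2 :: "(real^'n::finite \<Rightarrow> real) \<Rightarrow> bool" where
  "C2 \<phi> \<longleftrightarrow> (\<forall>x. \<phi> differentiable (at x)) \<and> (\<forall>i x. D i \<phi> differentiable (at x))
     \<and> (\<forall>i j. continuous_on UNIV (D i (D j \<phi>)))"

definition Lp_fun :: "real \<Rightarrow> 'a measure \<Rightarrow> ('a \<Rightarrow> real) \<Rightarrow> bool" where
  "Lp_fun p M f \<longleftrightarrow> f \<in> borel_measurable M \<and> integrable M (\<lambda>x. \<bar>f x\<bar> powr p)"

text \<open>Only meaningful for functions satisfying \<^const>\<open>Lp_fun\<close>: the Bochner integral of a
  non-integrable function is 0.\<close>
definition Lp_norm :: "real \<Rightarrow> 'a measure \<Rightarrow> ('a \<Rightarrow> real) \<Rightarrow> real" where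
  "Lp_norm p M f = (integral\<^sup>L M (\<lambda>x. \<bar>f x\<bar> powr p)) powr (1 / p)"

text \<open>\<open>C\<^sub>b(\<real>\<^sub>+; L\<^sup>p(A))\<close>, with respect to Lebesgue measure on \<open>A\<close>.\<close>
definition Cb_Lp :: "real \<Rightarrow> (real^'n::finite) set \<Rightarrow> (real \<Rightarrow> real^'n \<Rightarrow> real) \<Rightarrow> bool" where
  "Cb_Lp p A g \<longleftrightarrow>
     (let M = restrict_space lborel A in
       (\<forall>t\<ge>0. Lp_fun p M (g t))
     \<and> (\<exists>C. \<forall>t\<ge>0. Lp_norm p M (g t) \<le> C)
     \<and> (\<forall>t\<^sub>0\<ge>0. ((\<lambda>t. Lp_norm p M (\<lambda>x. g t x - g t\<^sub>0 x)) \<longlongrightarrow> 0) (at t\<^sub>0 within {0..})))"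

text \<open>Extension by density: for an operator \<open>T\<close> on bounded continuous functions that is
  contractive from \<open>L\<^sup>p(M)\<close> to \<open>L\<^sup>p(N)\<close>, the value of its extension at \<open>f \<in> L\<^sup>p(M)\<close> is the
  \<open>L\<^sup>p(N)\<close>-limit of \<open>T (\<phi> n)\<close> along any bounded continuous \<open>\<phi> n\<close> converging to \<open>f\<close> in \<open>L\<^sup>p(M)\<close>.
  As an element of \<open>L\<^sup>p(N)\<close> it is determined only up to null sets; some representative is
  chosen.\<close>
definition Lp_extension :: "real \<Rightarrow> 'a::topological_space measure \<Rightarrow> 'b measure
    \<Rightarrow> (('a \<Rightarrow> real) \<Rightarrow> ('b \<Rightarrow> real)) \<Rightarrow> ('a \<Rightarrow> real) \<Rightarrow> ('b \<Rightarrow> real)" where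
  "Lp_extension p M N T f = (SOME g. Lp_fun p N g \<and>
     (\<forall>\<phi>. (\<forall>n::nat. \<phi> n \<in> bcontfun) \<and> (\<lambda>n. Lp_norm p M (\<lambda>x. \<phi> n x - f x)) \<longlonglongrightarrow> 0
        \<longrightarrow> (\<lambda>n. Lp_norm p N (\<lambda>x. T (\<phi> n) x - g x)) \<longlonglongrightarrow> 0))"

definition loc_Hoelder :: "real \<Rightarrow> (real \<Rightarrow> real^'n::finite \<Rightarrow> real) \<Rightarrow> bool" where
  "loc_Hoelder \<alpha> g \<longleftrightarrow> (\<forall>T>0. \<forall>R>0. \<exists>C. \<forall>t\<in>{0..T}. \<forall>t'\<in>{0..T}. \<forall>x\<in>ball 0 R. \<forall>y\<in>ball 0 R.
     \<bar>g t x - g t' y\<bar> \<le> C * (\<bar>t - t'\<bar> powr (\<alpha> / 2) + norm (x - y) powr \<alpha>))"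

text \<open>\<open>C\<^sub>l\<^sub>o\<^sub>c\<close> with parabolic exponents \<open>(\<alpha>/2, 1+\<alpha>)\<close> on \<open>\<real>\<^sub>+ \<times> \<real>\<^sup>d\<close>.\<close>
definition C1_loc_Hoelder :: "real \<Rightarrow> (real \<Rightarrow> real^'n::finite \<Rightarrow> real) \<Rightarrow> bool" where
  "C1_loc_Hoelder \<alpha> g \<longleftrightarrow> (\<forall>t\<ge>0. \<forall>x. g t differentiable (at x)) \<and> loc_Hoelder \<alpha> g
     \<and> (\<forall>k. loc_Hoelder \<alpha> (\<lambda>t. D k (g t)))"

definition regular_coeffs ::
  "(real \<Rightarrow> real^'n::finite \<Rightarrow> real^'n^'n) \<Rightarrow> (real \<Rightarrow> real^'n \<Rightarrow> real^'n) \<Rightarrow> bool" where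
  "regular_coeffs Q b \<longleftrightarrow>
     (\<exists>\<alpha>. 0 < \<alpha> \<and> \<alpha> < 1 \<and> (\<forall>i j. C1_loc_Hoelder \<alpha> (\<lambda>t x. Q t x $ i $ j))
                       \<and> (\<forall>j. C1_loc_Hoelder \<alpha> (\<lambda>t x. b t x $ j)))
   \<and> (\<forall>R>0. \<forall>i j. continuous_on ({0..} \<times> ball 0 R) (\<lambda>(t, x). Q t x $ i $ j)
                 \<and> bounded ((\<lambda>(t, x). Q t x $ i $ j) ` ({0..} \<times> ball 0 R)))
   \<and> (\<exists>p\<^sub>0 > real CARD('n) + 2. \<forall>R>0.
        (\<forall>i j k. Cb_Lp p\<^sub>0 (ball 0 R) (\<lambda>t. D k (\<lambda>x. Q t x $ i $ j)))
      \<and> (\<forall>j. Cb_Lp p\<^sub>0 (ball 0 R) (\<lambda>t x. b t x $ j)))"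

text \<open>The last conjunct is \<open>inf \<eta> > 0\<close>; \<^const>\<open>Inf\<close> on \<^typ>\<open>real\<close> is unspecified for sets that are
  not bounded below.\<close>
definition elliptic :: "(real \<Rightarrow> real^'n::finite \<Rightarrow> real^'n^'n) \<Rightarrow> (real \<Rightarrow> real^'n \<Rightarrow> real) \<Rightarrow> bool" where
  "elliptic Q \<eta> \<longleftrightarrow>
     (\<forall>t\<ge>0. \<forall>x. transpose (Q t x) = Q t x)
   \<and> (\<forall>t\<ge>0. \<forall>x \<xi>. (Q t x *v \<xi>) \<bullet> \<xi> \<ge> \<eta> t x * (norm \<xi>)\<^sup>2)
   \<and> (\<exists>\<eta>\<^sub>0>0. \<forall>t\<ge>0. \<forall>x. \<eta>\<^sub>0 \<le> \<eta> t x)"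

definition lyapunov ::
  "(real \<Rightarrow> real^'n::finite \<Rightarrow> real^'n^'n) \<Rightarrow> (real \<Rightarrow> real^'n \<Rightarrow> real^'n) \<Rightarrow> (real^'n \<Rightarrow> real) \<Rightarrow> bool" where
  "lyapunov Q b V \<longleftrightarrow> C2 V \<and> (\<forall>x. 0 < V x) \<and> filterlim V at_top at_infinity
     \<and> (\<exists>a\<ge>0. \<exists>\<kappa>>0. \<forall>t\<ge>0. \<forall>x. opA Q b t V x \<le> a - \<kappa> * V x)"

definition gradient_bounds ::
  "(real \<Rightarrow> real^'n::finite \<Rightarrow> real^'n^'n) \<Rightarrow> (real \<Rightarrow> real^'n \<Rightarrow> real^'n) \<Rightarrow> (real \<Rightarrow> real^'n \<Rightarrow> real) \<Rightarrow> bool" where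
  "gradient_bounds Q b \<eta> \<longleftrightarrow>
     (\<exists>c\<^sub>0\<ge>0. \<forall>t\<ge>0. \<forall>x.
        sqrt (\<Sum>i\<in>UNIV. \<Sum>j\<in>UNIV. \<Sum>k\<in>UNIV. (D k (\<lambda>y. Q t y $ i $ j) x)\<^sup>2) \<le> c\<^sub>0 * \<eta> t x)
   \<and> (\<exists>r\<^sub>0. \<forall>t\<ge>0. \<forall>x \<xi>. (jacobian (b t) (at x) *v \<xi>) \<bullet> \<xi> \<le> r\<^sub>0 * (norm \<xi>)\<^sup>2)"

text \<open>\<^const>\<open>norm\<close> on matrices is the Frobenius norm.\<close>
definition growth_bounds ::
  "(real \<Rightarrow> real^'n::finite \<Rightarrow> real^'n^'n) \<Rightarrow> (real \<Rightarrow> real^'n \<Rightarrow> real^'n) \<Rightarrow> (real^'n \<Rightarrow> real) \<Rightarrow> bool" where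
  "growth_bounds Q b V \<longleftrightarrow> (\<exists>c>0.
     (\<forall>t\<ge>0. \<forall>x. norm (Q t x) \<le> c * (1 + norm x) * V x
              \<and> b t x \<bullet> x \<le> c * (1 + (norm x)\<^sup>2) * V x)
   \<or> (\<forall>t\<ge>0. \<forall>x. norm (Q t x) \<le> c))"

definition standing_assumptions ::
  "(real \<Rightarrow> real^'n::finite \<Rightarrow> real^'n^'n) \<Rightarrow> (real \<Rightarrow> real^'n \<Rightarrow> real^'n) \<Rightarrow> bool" where
  "standing_assumptions Q b \<longleftrightarrow> regular_coeffs Q b
     \<and> (\<exists>\<eta> V. elliptic Q \<eta> \<and> lyapunov Q b V \<and> gradient_bounds Q b \<eta> \<and> growth_bounds Q b V)"

definition C12 :: "real \<Rightarrow> (real \<Rightarrow> real^'n::finite \<Rightarrow> real) \<Rightarrow> bool" where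
  "C12 s u \<longleftrightarrow>
     (\<forall>t>s. \<forall>x. (\<lambda>\<tau>. u \<tau> x) differentiable (at t) \<and> u t differentiable (at x)
              \<and> (\<forall>i. D i (u t) differentiable (at x)))
   \<and> continuous_on ({s<..} \<times> UNIV) (\<lambda>(t, x). u t x)
   \<and> continuous_on ({s<..} \<times> UNIV) (\<lambda>(t, x). deriv (\<lambda>\<tau>. u \<tau> x) t)
   \<and> (\<forall>i. continuous_on ({s<..} \<times> UNIV) (\<lambda>(t, x). D i (u t) x))
   \<and> (\<forall>i j. continuous_on ({s<..} \<times> UNIV) (\<lambda>(t, x). D i (D j (u t)) x))"

definition bounded_solution ::
  "(real \<Rightarrow> real^'n::finite \<Rightarrow> real^'n^'n) \<Rightarrow> (real \<Rightarrow> real^'n \<Rightarrow> real^'n) \<Rightarrow> real \<Rightarrow> (real^'n \<Rightarrow> real)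
    \<Rightarrow> (real \<Rightarrow> real^'n \<Rightarrow> real) \<Rightarrow> bool" where
  "bounded_solution Q b s f u \<longleftrightarrow>
     continuous_on ({s..} \<times> UNIV) (\<lambda>(t, x). u t x)
   \<and> bounded ((\<lambda>(t, x). u t x) ` ({s..} \<times> UNIV))
   \<and> C12 s u
   \<and> (\<forall>t>s. \<forall>x. deriv (\<lambda>\<tau>. u \<tau> x) t = opA Q b t (u t) x)
   \<and> (\<forall>x. u s x = f x)"

text \<open>\<open>G t s f\<close> is \<open>G(t,s)f\<close>; it is constrained only for \<open>t \<ge> s \<ge> 0\<close> and bounded continuous \<open>f\<close>,
  where \<open>t \<mapsto> G t s f\<close> is the unique bounded classical solution of the Cauchy problem.\<close>
definition evolution_operator ::
  "(real \<Rightarrow> real^'n::finite \<Rightarrow> real^'n^'n) \<Rightarrow> (real \<Rightarrow> real^'n \<Rightarrow> real^'n)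
    \<Rightarrow> (real \<Rightarrow> real \<Rightarrow> (real^'n \<Rightarrow> real) \<Rightarrow> real^'n \<Rightarrow> real) \<Rightarrow> bool" where
  "evolution_operator Q b G \<longleftrightarrow> (\<forall>s\<ge>0. \<forall>f\<in>bcontfun.
     bounded_solution Q b s f (\<lambda>t. G t s f)
   \<and> (\<forall>v. bounded_solution Q b s f v \<longrightarrow> (\<forall>t\<ge>s. \<forall>x. v t x = G t s f x)))"

definition evolution_system_of_measures ::
  "(real \<Rightarrow> real \<Rightarrow> (real^'n::finite \<Rightarrow> real) \<Rightarrow> real^'n \<Rightarrow> real) \<Rightarrow> (real \<Rightarrow> (real^'n) measure) \<Rightarrow> bool" where
  "evolution_system_of_measures G \<mu> \<longleftrightarrow>
     (\<forall>t\<ge>0. prob_space (\<mu> t) \<and> sets (\<mu> t) = sets borel)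
   \<and> (\<forall>f\<in>bcontfun. \<forall>s\<ge>0. \<forall>t\<ge>s. integral\<^sup>L (\<mu> t) (G t s f) = integral\<^sup>L (\<mu> s) f)"

definition tight_system :: "(real \<Rightarrow> (real^'n::finite) measure) \<Rightarrow> bool" where
  "tight_system \<mu> \<longleftrightarrow> (\<forall>\<epsilon>>0. \<exists>R>0. \<forall>t\<ge>0. measure (\<mu> t) (ball 0 R) \<ge> 1 - \<epsilon>)"

end

theory Submission imports Defs begin

text \<open>Write \<open>u(t,x) = (G(t,s)f)(x)\<close> for a bounded continuous \<open>f\<close>. Since \<open>\<mu>\<^sub>t\<close> integrates \<open>u(t,\<cdot>)\<close> to
  \<open>m\<^sub>s(f)\<close>, the difference \<open>u(t,x) - m\<^sub>s(f)\<close> is the \<open>\<mu>\<^sub>t\<close>-mean over \<open>y\<close> of \<open>u(t,x) - u(t,y)\<close>. By tightness,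
  local uniform convergence follows once the oscillation of \<open>u(t,\<cdot>)\<close> on every compact set tends
  to 0. The lemma \<open>oscillation_decay\<close> gives more:
  \<open>u(t,x) - u(t,y) \<le> C exp(-\<lambda>(t-s)) (1 + V x + V y)\<close> with \<open>\<lambda> > 0\<close> and \<open>V\<close> a multiple of the Lyapunov
  function.

  That estimate is a quantitative Harris theorem, proved by doubling the variables instead of
  constructing a process. The difference \<open>u(t,x) - u(t,y)\<close> is compared with
  \<open>C exp(-\<lambda>(t-s)) W(x,y)\<close>, where
  \<open>W(x,y) = min (1 - exp(-K|x-y|)) (1 - exp(-KR)) + \<epsilon> (V x + V y)\<close>. As \<open>W\<close> is bounded below by
  \<open>2\<epsilon> inf V > 0\<close>, the comparison holds at time \<open>s\<close> although \<open>f\<close> may oscillate at arbitrarily small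
  scales; as \<open>V\<close> is coercive, a
  violation would be attained at some \<open>(t,x,y)\<close> with \<open>x \<noteq> y\<close>. There the Hessian of
  \<open>u(t,x) - u(t,y)\<close> in the pair \<open>(x,y)\<close> is at most that of the comparison function, and this
  inequality can be contracted with every positive semidefinite matrix whose diagonal blocks are
  \<open>Q(t,x)\<close> and \<open>Q(t,y)\<close>. The off-diagonal block is free, because \<open>u(t,x) - u(t,y)\<close> has no mixed second
  derivatives: choosing it is choosing a coupling of two diffusions. A block that reflects a small
  multiple of the identity along \<open>x - y\<close> and is nearly synchronous otherwise (\<open>coupling_inequality\<close>)
  produces a second-order term \<open>-2\<mu>K\<^sup>2 exp(-K|x-y|)\<close>, which beats the errors from the variation of \<open>Q\<close> and
  \<open>b\<close> when \<open>K\<close> is large (\<open>local_contraction\<close>). This settles \<open>|x-y| < R\<close>; for \<open>|x-y| \<ge> R\<close> the first summand of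
  \<open>W\<close> is dominated by a constant, one of the points is far out, and the Lyapunov inequality alone gives the decay.

  For convergence in \<open>L\<^sup>p\<close>, the maximum principle yields the Jensen inequality
  \<open>|G(t,s)\<phi> - G(t,s)\<psi>|\<^sup>p \<le> G(t,s)(|\<phi> - \<psi>|\<^sup>p)\<close>, by comparing with the tangent lines of \<open>|y|\<^sup>p\<close>. Integrating
  against \<open>\<mu>\<^sub>t\<close> gives contractivity from \<open>L\<^sup>p(\<mu>\<^sub>s)\<close> to \<open>L\<^sup>p(\<mu>\<^sub>t)\<close>. Density of bounded continuous
  functions and completeness of \<open>L\<^sup>p(\<mu>\<^sub>t)\<close> show that the extension exists and depends continuously on
  \<open>f\<close>, uniformly in \<open>t\<close> (\<open>Lp_extension_bound\<close>), so it is enough to treat bounded continuous \<open>f\<close>, where local uniform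
  convergence and tightness suffice.\<close>

section \<open>Positive semidefinite matrices and couplings\<close>


definition outer :: "real^'n \<Rightarrow> real^'n \<Rightarrow> real^'n^'n" where
  "outer v w = (\<chi> i j. v $ i * w $ j)"

definition psd :: "real^'n^'n \<Rightarrow> bool" where
  "psd S \<longleftrightarrow> transpose S = S \<and> (\<forall>v. 0 \<le> v \<bullet> (S *v v))"

lemma inner_outer: "outer v w \<bullet> X = v \<bullet> (X *v w)"
  by (simp add: outer_def inner_vec_def matrix_vector_mult_def sum_distrib_left algebra_simps)

lemma outer_mult_vec: "outer v w *v x = (w \<bullet> x) *\<^sub>R v"
  by (simp add: outer_def inner_vec_def matrix_vector_mult_def vec_eq_iff sum_distrib_right sum_distrib_left algebra_simps)

lemma norm_outer: "norm (outer v v) = (norm v)\<^sup>2"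
  by (simp add: norm_eq_sqrt_inner inner_outer outer_mult_vec)

lemma norm_sq_vec: "(norm x)\<^sup>2 = (\<Sum>j\<in>UNIV. (norm (x $ j))\<^sup>2)" for x :: "'a::real_inner^'n::finite"
  unfolding power2_norm_eq_inner inner_vec_def ..

lemma transpose_outer: "transpose (outer v v) = outer v v"
  by (simp add: outer_def transpose_def vec_eq_iff mult.commute)

lemma transpose_plus: "transpose (A + B) = transpose A + transpose (B::real^'n^'m)"
  by (simp add: transpose_def vec_eq_iff)

lemma transpose_minus: "transpose (A - B) = transpose A - transpose (B::real^'n^'m)"
  by (simp add: transpose_def vec_eq_iff)

lemma transpose_sum_matrix: "transpose (sum f I) = (\<Sum>i\<in>I. transpose (f i :: real^'n^'m))"
  by (simp add: transpose_def vec_eq_iff)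

lemma scaleR_mat_mult_vec: "(c *\<^sub>R A) *v x = c *\<^sub>R ((A::real^'n^'m) *v x)"
  by (simp add: scaleR_matrix_vector_assoc)

lemma sum_mat_mult_vec: "sum f I *v x = (\<Sum>i\<in>I. (f i::real^'n^'m) *v x)"
  by (induction I rule: infinite_finite_induct) (simp_all add: matrix_vector_mult_add_rdistrib)

lemma symmetric_inner: "transpose S = S \<Longrightarrow> v \<bullet> (S *v w) = (S *v v) \<bullet> (w::real^'n)"
  by (metis dot_lmul_matrix transpose_matrix_vector)

lemma mat_1_outer: "(mat 1::real^'n^'n) = (\<Sum>i\<in>UNIV. outer (axis i 1) (axis i 1))"
proof -
  have "(\<Sum>k\<in>UNIV. axis k 1 $ i * (axis k 1 :: real^'n) $ j) = (if i = j then 1 else 0)" for i j :: 'n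
    by (subst sum.remove[of _ i]) (auto simp: axis_def)
  thus ?thesis by (simp add: vec_eq_iff outer_def mat_def)
qed

text \<open>Elimination of one index at a time, as in the Cholesky decomposition: subtracting
  \<open>(T e)(T e)\<^sup>T / (e \<bullet> T e)\<close> keeps a positive semidefinite \<open>T\<close> positive semidefinite and clears the row of the
  basis vector \<open>e\<close>. The decomposition is what turns an inequality between quadratic forms into an
  inequality between traces.\<close>
lemma psd_sum_outer:
  fixes S :: "real^'n::finite^'n"
  assumes "psd S"
  obtains m :: "'n \<Rightarrow> real^'n" where "S = (\<Sum>i\<in>UNIV. outer (m i) (m i))"
proof -
  have "\<exists>m :: 'n \<Rightarrow> real^'n. \<exists>T. S = (\<Sum>i\<in>I. outer (m i) (m i)) + T \<and> psd T \<and> (\<forall>i\<in>I. T $ i = 0)" 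
    if "finite I" for I
    using that
  proof induction
    case empty
    show ?case by (intro exI[of _ "\<lambda>_. 0"] exI[of _ S]) (use assms in simp)
  next
    case (insert a I)
    then obtain m :: "'n \<Rightarrow> real^'n" and T where T: "S = (\<Sum>i\<in>I. outer (m i) (m i)) + T" "psd T" "\<And>i. i \<in> I \<Longrightarrow> T $ i = 0"
      by blast
    define e where "e = (axis a 1 :: real^'n)"
    define t where "t = e \<bullet> (T *v e)"
    have sym: "transpose T = T" and pos: "\<And>v. 0 \<le> v \<bullet> (T *v v)" using T(2) by (auto simp: psd_def)
    note symi = symmetric_inner[OF sym]
    have t0: "t \<ge> 0" using pos unfolding t_def .
    have row: "T *v e = T $ a"
      using sym by (simp add: e_def vec_eq_iff matrix_vector_mult_def axis_def if_distrib transpose_def cong: if_cong)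
    have expand: "(v + c *\<^sub>R e) \<bullet> (T *v (v + c *\<^sub>R e)) = v \<bullet> (T *v v) + 2 * c * ((T *v e) \<bullet> v) + c\<^sup>2 * t" for v c
      using symi[of e v] 
      by (simp add: t_def algebra_simps power2_eq_square inner_commute)
    define p where "p = (1 / sqrt t) *\<^sub>R (T *v e)"
    define m' where "m' = m(a := p)"
    define T' where "T' = T - outer p p"
    have psdT': "psd T'"
      unfolding psd_def
    proof (intro conjI allI)
      show "transpose T' = T'" using sym by (simp add: T'_def transpose_minus transpose_outer)
      fix v :: "real^'n"
      have "v \<bullet> (T' *v v) = v \<bullet> (T *v v) - (p \<bullet> v)\<^sup>2"
        by (simp add: T'_def outer_mult_vec algebra_simps power2_eq_square inner_commute)
      also have "(p \<bullet> v)\<^sup>2 = ((T *v e) \<bullet> v)\<^sup>2 / t"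
        using t0 by (simp add: p_def power_divide)
      also have "v \<bullet> (T *v v) - ((T *v e) \<bullet> v)\<^sup>2 / t \<ge> 0"
      proof (cases "t = 0")
        case False
        have "0 \<le> v \<bullet> (T *v v) + 2 * (- ((T *v e) \<bullet> v) / t) * ((T *v e) \<bullet> v) + (- ((T *v e) \<bullet> v) / t)\<^sup>2 * t"
          using pos[of "v + (- ((T *v e) \<bullet> v) / t) *\<^sub>R e"] unfolding expand .
        thus ?thesis using False by (simp add: field_simps power2_eq_square)
      qed (use pos in simp)
      finally show "0 \<le> v \<bullet> (T' *v v)" .
    qed
    have Ta: "T $ a = 0" if "t = 0"
    proof (rule ccontr)
      assume "T $ a \<noteq> 0"
      hence n: "(T *v e) \<bullet> (T *v e) > 0" using row by simp
      define v where "v = T *v e"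
      define c where "c = - (v \<bullet> (T *v v) + 1) / (2 * (v \<bullet> v))"
      have "0 \<le> v \<bullet> (T *v v) + 2 * c * (v \<bullet> v)"
        using pos[of "v + c *\<^sub>R e"] unfolding expand by (simp add: v_def that)
      thus False using n unfolding c_def v_def by (simp add: field_simps)
    qed
    have "T' $ i = 0" if "i \<in> insert a I" for i
    proof -
      have *: "T' $ i = T $ i - (p $ i) *\<^sub>R p" by (simp add: T'_def outer_def vec_eq_iff)
      show ?thesis
      proof (cases "i = a")
        case True
        have "(T $ a) $ a = t" using row unfolding t_def by (simp add: e_def inner_axis')
        thus ?thesis using True * Ta t0 by (cases "t = 0") (simp_all add: p_def row real_sqrt_mult[symmetric] divide_simps)
      next
        case False
        hence "T $ i = 0" using T(3) that by auto
        moreover have "p $ i = 0"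
        proof -
          have "T $ a $ i = T $ i $ a" using sym by (simp add: transpose_def vec_eq_iff)
          thus ?thesis using \<open>T $ i = 0\<close> by (simp add: p_def row)
        qed
        ultimately show ?thesis using * by simp
      qed
    qed
    moreover have "S = (\<Sum>i\<in>insert a I. outer (m' i) (m' i)) + T'"
    proof -
      have "(\<Sum>i\<in>I. outer (m' i) (m' i)) = (\<Sum>i\<in>I. outer (m i) (m i))"
        by (rule sum.cong) (use insert.hyps in \<open>auto simp: m'_def\<close>)
      thus ?thesis using insert.hyps T(1) by (simp add: T'_def m'_def)
    qed
    ultimately show ?case using psdT' by blast
  qed
  from this[of UNIV] obtain m :: "'n \<Rightarrow> real^'n" and T
    where "S = (\<Sum>i\<in>UNIV. outer (m i) (m i)) + T" "\<forall>i. T $ i = 0" by auto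
  moreover from this(2) have "T = 0" by (simp add: vec_eq_iff)
  ultimately show ?thesis using that by simp
qed

lemma psd_inner_le:
  fixes S X :: "real^'n::finite^'n"
  assumes "psd S" "\<And>v. v \<bullet> (X *v v) \<le> c * (norm v)\<^sup>2"
  shows "S \<bullet> X \<le> c * (S \<bullet> mat 1)"
proof -
  from psd_sum_outer[OF assms(1)] obtain m :: "'n \<Rightarrow> real^'n" where S: "S = (\<Sum>i\<in>UNIV. outer (m i) (m i))" by blast
  show ?thesis unfolding S inner_sum_left inner_outer sum_distrib_left
    by (rule sum_mono) (use assms(2) in \<open>simp add: dot_square_norm\<close>)
qed

lemma inner_mat_1: "S \<bullet> (mat 1::real^'n^'n) = (\<Sum>i\<in>UNIV. axis i 1 \<bullet> (S *v axis i 1))"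
  by (simp add: mat_1_outer inner_commute[of S] inner_sum_left inner_outer)

text \<open>For \<open>N = M\<^sup>-\<^sup>1\<close> and \<open>0 \<le> C \<le> M\<close>, the matrix \<open>C - C N C\<close> lies between \<open>0\<close> and \<open>M - C\<close>. The lower bound
  comes from the positivity of \<open>C\<close> on \<open>v - N C v\<close> together with \<open>C \<le> M\<close>. The upper bound is the identity
  \<open>C - C N C = F - F N F\<close> for \<open>F = M - C\<close>.\<close>
lemma form_minus_inverse_form_bounds:
  fixes C M N :: "real^'n::finite^'n"
  assumes sC: "transpose C = C" and sN: "transpose N = N"
    and C: "\<And>v. 0 \<le> v \<bullet> (C *v v)" and N: "\<And>v. 0 \<le> v \<bullet> (N *v v)"
    and CM: "\<And>v. v \<bullet> (C *v v) \<le> v \<bullet> (M *v v)"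
    and MN: "\<And>v. M *v (N *v v) = v" and NM: "\<And>v. N *v (M *v v) = v"
  shows "(C *v v) \<bullet> (N *v (C *v v)) \<le> v \<bullet> (C *v v)"
    and "v \<bullet> (C *v v) - (C *v v) \<bullet> (N *v (C *v v)) \<le> v \<bullet> ((M - C) *v v)"
proof -
  define x where "x = N *v (C *v v)"
  have Mx: "M *v x = C *v v" unfolding x_def MN ..
  have "0 \<le> (v - x) \<bullet> (C *v (v - x))" by (rule C)
  also have "\<dots> = v \<bullet> (C *v v) - 2 * ((C *v v) \<bullet> x) + x \<bullet> (C *v x)"
    using symmetric_inner[OF sC, of v x] by (simp add: algebra_simps inner_commute)
  also have "\<dots> \<le> v \<bullet> (C *v v) - 2 * ((C *v v) \<bullet> x) + x \<bullet> (M *v x)" using CM[of x] by simp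
  also have "\<dots> = v \<bullet> (C *v v) - (C *v v) \<bullet> x" unfolding Mx by (simp add: inner_commute)
  finally show "(C *v v) \<bullet> (N *v (C *v v)) \<le> v \<bullet> (C *v v)" unfolding x_def by simp
  define w where "w = (M - C) *v v"
  have Cv: "C *v v = M *v v - w" by (simp add: w_def matrix_vector_mult_diff_rdistrib)
  have x: "x = v - N *v w" unfolding x_def Cv by (simp add: matrix_vector_mult_diff_distrib NM)
  have "v \<bullet> (C *v v) - (C *v v) \<bullet> x = (C *v v) \<bullet> (N *v w)"
    unfolding x by (simp add: algebra_simps inner_commute)
  also have "\<dots> = x \<bullet> w" unfolding x_def by (rule symmetric_inner[OF sN])
  also have "\<dots> = v \<bullet> w - w \<bullet> (N *v w)" unfolding x by (simp add: algebra_simps inner_commute)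
  also have "\<dots> \<le> v \<bullet> w" using N[of w] by simp
  finally show "v \<bullet> (C *v v) - (C *v v) \<bullet> (N *v (C *v v)) \<le> v \<bullet> ((M - C) *v v)"
    unfolding x_def w_def .
qed

lemma positive_definite_inverse:
  fixes M :: "real^'n::finite^'n"
  assumes sM: "transpose M = M" and k: "0 < k" and M: "\<And>v. k * (norm v)\<^sup>2 \<le> v \<bullet> (M *v v)"
  obtains N where "psd N" "\<And>v. M *v (N *v v) = v" "\<And>v. N *v (M *v v) = v"
    "\<And>v. v \<bullet> (N *v v) \<le> (norm v)\<^sup>2 / k"
proof -
  have "x = 0" if "M *v x = 0" for x
    using M[of x] that k by (simp add: mult_le_0_iff)
  then obtain N where "N ** M = mat 1" using matrix_left_invertible_ker[of M] by blast
  moreover from this have "M ** N = mat 1" using matrix_left_right_inverse by blast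
  ultimately have NM: "N *v (M *v v) = v" and MN: "M *v (N *v v) = v" for v
    by (simp_all add: matrix_vector_mul_assoc)
  have b: "k * (x \<bullet> (M *v x)) \<le> (norm (M *v x))\<^sup>2" for x
  proof -
    have cs: "x \<bullet> (M *v x) \<le> norm x * norm (M *v x)" by (rule norm_cauchy_schwarz)
    have "k * norm x \<le> norm (M *v x)"
    proof (cases "x = 0")
      case False
      have "(k * norm x) * norm x \<le> norm (M *v x) * norm x" using M[of x] cs by (simp add: power2_eq_square algebra_simps)
      thus ?thesis using False by simp
    qed simp
    hence "k * norm x * norm (M *v x) \<le> norm (M *v x) * norm (M *v x)" by (intro mult_right_mono) auto
    thus ?thesis using cs k by (smt (verit) mult.assoc mult_left_mono power2_eq_square)
  qed
  have "transpose N = N"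
  proof -
    have "transpose N ** M = mat 1"
      by (metis \<open>M ** N = mat 1\<close> matrix_transpose_mul sM transpose_mat)
    thus ?thesis by (metis \<open>M ** N = mat 1\<close> matrix_mul_assoc matrix_mul_lid matrix_mul_rid)
  qed
  moreover have "0 \<le> v \<bullet> (N *v v)" for v
    using M[of "N *v v"] k by (simp add: MN inner_commute) (smt (verit) mult_nonneg_nonneg zero_le_power2)
  moreover have "v \<bullet> (N *v v) \<le> (norm v)\<^sup>2 / k" for v
    using b[of "N *v v"] k by (simp add: MN inner_commute field_simps)
  ultimately show ?thesis using that NM MN unfolding psd_def by blast
qed

text \<open>\<open>X\<close> and \<open>Y\<close> stand for the Hessians of one function at two points at distance \<open>r\<close> in direction \<open>e\<close>, and
  the right-hand side of the last hypothesis for the Hessian of a radial function \<open>h\<close>, so that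
  \<open>z = h'(r)/r\<close> and \<open>z + d = h''(r)\<close>. Only \<open>h''\<close> may be multiplied by the ellipticity constant with a
  large factor; the error must be of order \<open>z k\<close> and must not involve the size of \<open>A\<close> or \<open>B\<close>, which can
  be huge compared with \<open>\<mu>\<close>.

  Split \<open>A = (\<mu>/2) I + A'\<close> and \<open>B = (\<mu>/2) I + B'\<close>. The multiples of the identity are coupled by
  reflection along \<open>e\<close>, which gives \<open>2\<mu>(z + d)\<close>. For the rest put \<open>M = A' + k I\<close>, a common upper bound of \<open>A'\<close>
  and \<open>B'\<close>, and decompose \<open>M\<^sup>-\<^sup>1\<close> as the sum of the \<open>m m\<^sup>T\<close>. The pairs \<open>(A' m, B' m)\<close> realise the
  off-diagonal block \<open>A' M\<^sup>-\<^sup>1 B'\<close>; their difference is \<open>(A - B) m\<close>, and what they miss of \<open>A'\<close> and \<open>B'\<close> on the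
  diagonal has trace at most of order \<open>k\<close>. This behaves like the coupling through square roots of
  the matrices but needs no square root.\<close>
lemma coupling_inequality:
  fixes A B X Y :: "real^'n::finite^'n" and e :: "real^'n"
  assumes sA: "transpose A = A" and sB: "transpose B = B"
    and \<mu>: "0 < \<mu>" and A: "\<And>v. \<mu> * (norm v)\<^sup>2 \<le> v \<bullet> (A *v v)" and B: "\<And>v. \<mu> * (norm v)\<^sup>2 \<le> v \<bullet> (B *v v)"
    and k: "0 < k" "norm (A - B) \<le> k"
    and e: "norm e = 1" and z: "0 \<le> z" and d: "d \<le> 0"
    and H: "\<And>v w. v \<bullet> (X *v v) - w \<bullet> (Y *v w) \<le> z * (norm (v - w))\<^sup>2 + d * (e \<bullet> (v - w))\<^sup>2"
  shows "A \<bullet> X - B \<bullet> Y \<le> 2 * \<mu> * (z + d) + 4 * real CARD('n) * z * k"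
proof -
  define I where "I = (mat 1 :: real^'n^'n)"
  define A' where "A' = A - (\<mu>/2) *\<^sub>R I"
  define B' where "B' = B - (\<mu>/2) *\<^sub>R I"
  define E where "E = A - B"
  define M where "M = A' + k *\<^sub>R I"
  have I: "I *v v = v" "transpose I = I" for v unfolding I_def by simp_all
  have sA': "transpose A' = A'" and sB': "transpose B' = B'" and sM: "transpose M = M"
    by (simp_all add: A'_def B'_def M_def transpose_minus transpose_plus transpose_scalar sA sB I)
  have A'v: "A' *v v = A *v v - (\<mu>/2) *\<^sub>R v" and B'v: "B' *v v = B *v v - (\<mu>/2) *\<^sub>R v"
    and Mv: "M *v v = A' *v v + k *\<^sub>R v" for v
    by (simp_all only: A'_def B'_def M_def matrix_vector_mult_diff_rdistrib matrix_vector_mult_add_rdistrib scaleR_mat_mult_vec I)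
  have half: "0 \<le> a - (\<mu> * n) / 2" if "\<mu> * n \<le> a" "0 \<le> n" for a n :: real
    using that mult_nonneg_nonneg[of \<mu> n] \<mu> by linarith
  have A'pos: "0 \<le> v \<bullet> (A' *v v)" for v
    using half[OF A[of v]] unfolding A'v by (simp add: inner_diff_right dot_square_norm)
  have B'pos: "0 \<le> v \<bullet> (B' *v v)" for v
    using half[OF B[of v]] unfolding B'v by (simp add: inner_diff_right dot_square_norm)
  have Mk: "k * (norm v)\<^sup>2 \<le> v \<bullet> (M *v v)" for v
    using A'pos[of v] unfolding Mv by (simp add: inner_add_right dot_square_norm)
  have Eform: "\<bar>v \<bullet> (E *v v)\<bar> \<le> k * (norm v)\<^sup>2" for v
  proof -
    have "\<bar>v \<bullet> (E *v v)\<bar> = \<bar>outer v v \<bullet> E\<bar>" by (simp add: inner_outer)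
    also have "\<dots> \<le> norm (outer v v) * norm E" by (rule Cauchy_Schwarz_ineq2)
    also have "norm (outer v v) = (norm v)\<^sup>2" by (rule norm_outer)
    finally show ?thesis using k unfolding E_def by (smt (verit) mult.commute mult_right_mono zero_le_power2)
  qed
  have B'M: "v \<bullet> (B' *v v) \<le> v \<bullet> (M *v v)" and A'M: "v \<bullet> (A' *v v) \<le> v \<bullet> (M *v v)" for v
  proof -
    have "v \<bullet> (M *v v) = v \<bullet> (B' *v v) + v \<bullet> (E *v v) + k * (norm v)\<^sup>2"
      unfolding Mv A'v B'v E_def by (simp add: algebra_simps dot_square_norm)
    thus "v \<bullet> (B' *v v) \<le> v \<bullet> (M *v v)" using Eform[of v] by linarith
    show "v \<bullet> (A' *v v) \<le> v \<bullet> (M *v v)" using k unfolding Mv by (simp add: inner_add_right)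
  qed
  obtain N where N: "psd N" and MN: "\<And>v. M *v (N *v v) = v" and NM: "\<And>v. N *v (M *v v) = v"
    and Nle: "\<And>v. v \<bullet> (N *v v) \<le> (norm v)\<^sup>2 / k"
    using positive_definite_inverse[OF sM k(1) Mk] by blast
  obtain m :: "'n \<Rightarrow> real^'n" where Nm: "N = (\<Sum>i\<in>UNIV. outer (m i) (m i))" using psd_sum_outer[OF N] by blast
  have sN: "transpose N = N" and Npos: "\<And>v. 0 \<le> v \<bullet> (N *v v)" using N unfolding psd_def by auto
  have Nform: "w \<bullet> (N *v w) = (\<Sum>i\<in>UNIV. (m i \<bullet> w)\<^sup>2)" for w
    unfolding Nm by (simp add: sum_mat_mult_vec outer_mult_vec inner_sum_right power2_eq_square inner_commute)
  \<comment> \<open>What the family \<open>C m\<close> leaves of a diagonal block; it is coupled with \<open>0\<close> in the other point.\<close>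
  define rest where "rest C = C - (\<Sum>i\<in>UNIV. outer (C *v m i) (C *v m i))" for C
  have restform: "v \<bullet> (rest C *v v) = v \<bullet> (C *v v) - (C *v v) \<bullet> (N *v (C *v v))" if "transpose C = C" for C v
  proof -
    have "v \<bullet> (rest C *v v) = v \<bullet> (C *v v) - (\<Sum>i\<in>UNIV. (v \<bullet> (C *v m i))\<^sup>2)"
      by (simp add: rest_def matrix_vector_mult_diff_rdistrib sum_mat_mult_vec outer_mult_vec inner_sum_right
          inner_diff_right power2_eq_square inner_commute[of v])
    moreover have "v \<bullet> (C *v m i) = m i \<bullet> (C *v v)" for i
      using symmetric_inner[OF that, of v "m i"] by (simp add: inner_commute)
    ultimately show ?thesis unfolding Nform by simp
  qed
  have rest: "psd (rest C)" "rest C \<bullet> mat 1 \<le> (M - C) \<bullet> mat 1"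
    if "transpose C = C" "\<And>v. 0 \<le> v \<bullet> (C *v v)" "\<And>v. v \<bullet> (C *v v) \<le> v \<bullet> (M *v v)" for C
  proof -
    note s = form_minus_inverse_form_bounds[OF that(1) sN that(2) Npos that(3) MN NM]
    show "psd (rest C)" unfolding psd_def
    proof (intro conjI allI)
      show "transpose (rest C) = rest C"
        by (simp add: rest_def transpose_minus transpose_sum_matrix transpose_outer that(1))
      show "0 \<le> v \<bullet> (rest C *v v)" for v using s(1)[of v] unfolding restform[OF that(1)] by simp
    qed
    show "rest C \<bullet> mat 1 \<le> (M - C) \<bullet> mat 1"
      unfolding inner_mat_1 restform[OF that(1)] by (intro sum_mono s(2))
  qed
  have decomp: "C \<bullet> Z = (\<Sum>i\<in>UNIV. (C *v m i) \<bullet> (Z *v (C *v m i))) + rest C \<bullet> Z" for C Z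
    by (simp add: rest_def inner_diff_left inner_sum_left inner_outer)
  have trI: "I \<bullet> mat 1 = real CARD('n)"
    unfolding inner_mat_1 I by (simp add: inner_axis_axis)
  have X: "v \<bullet> (X *v v) \<le> z * (norm v)\<^sup>2" for v
    using H[of v 0] d by simp (smt (verit) mult_nonpos_nonneg zero_le_power2)
  have Y: "w \<bullet> ((- Y) *v w) \<le> z * (norm w)\<^sup>2" for w
  proof -
    have "(- Y) *v w = - (Y *v w)" using matrix_vector_mult_diff_rdistrib[of 0 Y w] by simp
    thus ?thesis using H[of 0 w] d by simp (smt (verit) mult_nonpos_nonneg zero_le_power2)
  qed
  have p1: "rest A' \<bullet> X \<le> z * (k * real CARD('n))"
  proof -
    have "rest A' \<bullet> X \<le> z * (rest A' \<bullet> mat 1)"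
      by (rule psd_inner_le[OF rest(1)[OF sA' A'pos A'M] X])
    also have "\<dots> \<le> z * ((M - A') \<bullet> mat 1)"
      by (rule mult_left_mono[OF rest(2)[OF sA' A'pos A'M] z])
    also have "(M - A') \<bullet> mat 1 = k * real CARD('n)" by (simp add: M_def trI)
    finally show ?thesis .
  qed
  have Etr: "E \<bullet> mat 1 \<le> k * real CARD('n)"
  proof -
    have "E \<bullet> mat 1 \<le> (\<Sum>i\<in>(UNIV::'n set). k)" unfolding inner_mat_1
    proof (rule sum_mono)
      fix i :: 'n
      show "axis i 1 \<bullet> (E *v axis i 1) \<le> k" using Eform[of "axis i 1"] by (simp add: norm_axis_1)
    qed
    thus ?thesis by (simp add: mult.commute)
  qed
  have p2: "rest B' \<bullet> (- Y) \<le> z * (2 * k * real CARD('n))"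
  proof -
    have "rest B' \<bullet> (- Y) \<le> z * (rest B' \<bullet> mat 1)"
      by (rule psd_inner_le[OF rest(1)[OF sB' B'pos B'M] Y])
    also have "\<dots> \<le> z * ((M - B') \<bullet> mat 1)"
      by (rule mult_left_mono[OF rest(2)[OF sB' B'pos B'M] z])
    also have "M - B' = E + k *\<^sub>R I" by (simp add: M_def A'_def B'_def E_def)
    also have "(E + k *\<^sub>R I) \<bullet> mat 1 = E \<bullet> mat 1 + k * real CARD('n)" by (simp add: trI inner_add_left)
    also have "z * (E \<bullet> mat 1 + k * real CARD('n)) \<le> z * (2 * k * real CARD('n))"
      using Etr z by (intro mult_left_mono) auto
    finally show ?thesis .
  qed
  have p3: "(\<Sum>i\<in>UNIV. (A' *v m i) \<bullet> (X *v (A' *v m i))) - (\<Sum>i\<in>UNIV. (B' *v m i) \<bullet> (Y *v (B' *v m i))) \<le> z * k"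
  proof -
    have "(\<Sum>i\<in>UNIV. (A' *v m i) \<bullet> (X *v (A' *v m i)) - (B' *v m i) \<bullet> (Y *v (B' *v m i)))
        \<le> (\<Sum>i\<in>UNIV. z * (norm (E *v m i))\<^sup>2)"
    proof (rule sum_mono)
      fix i
      have "A' *v m i - B' *v m i = E *v m i"
        unfolding A'v B'v E_def by (simp add: matrix_vector_mult_diff_rdistrib)
      thus "(A' *v m i) \<bullet> (X *v (A' *v m i)) - (B' *v m i) \<bullet> (Y *v (B' *v m i)) \<le> z * (norm (E *v m i))\<^sup>2"
        using H[of "A' *v m i" "B' *v m i"] d by simp (smt (verit) mult_nonpos_nonneg zero_le_power2)
    qed
    also have "\<dots> = z * (\<Sum>i\<in>UNIV. (norm (E *v m i))\<^sup>2)" by (simp add: sum_distrib_left)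
    also have "(\<Sum>i\<in>UNIV. (norm (E *v m i))\<^sup>2) = (\<Sum>i\<in>UNIV. \<Sum>j\<in>UNIV. (m i \<bullet> E $ j)\<^sup>2)"
      unfolding norm_sq_vec[of "E *v _"] matrix_vector_mul_component by (simp add: inner_commute)
    also have "\<dots> = (\<Sum>j\<in>UNIV. \<Sum>i\<in>UNIV. (m i \<bullet> E $ j)\<^sup>2)" by (rule sum.swap)
    also have "\<dots> = (\<Sum>j\<in>UNIV. E $ j \<bullet> (N *v E $ j))" unfolding Nform ..
    also have "\<dots> \<le> (\<Sum>j\<in>UNIV. (norm (E $ j))\<^sup>2 / k)" by (intro sum_mono Nle)
    also have "\<dots> = (norm E)\<^sup>2 / k"
      unfolding power2_norm_eq_inner inner_vec_def[of E] by (rule sum_divide_distrib[symmetric])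
    also have "\<dots> \<le> k\<^sup>2 / k"
      using k unfolding E_def[symmetric] by (intro divide_right_mono power_mono) auto
    also have "k\<^sup>2 / k = k" using k by (simp add: power2_eq_square)
    finally show ?thesis using z by (simp add: sum_subtractf mult_left_mono)
  qed
  have p4: "I \<bullet> X - I \<bullet> Y \<le> 4 * (z + d)"
  proof -
    \<comment> \<open>The image of the standard basis under the reflection that maps \<open>e\<close> to \<open>-e\<close>.\<close>
    define R where "R i = axis i 1 - (2 * e $ i) *\<^sub>R e" for i
    have ee: "e \<bullet> e = 1" using e by (simp add: norm_eq_1)
    have ssq: "(\<Sum>i\<in>UNIV. (e $ i)\<^sup>2) = 1" using ee by (simp add: inner_vec_def power2_eq_square)
    have out: "(\<Sum>i\<in>UNIV. outer (R i) (R i)) = I"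
    proof -
      have s3: "(\<Sum>i\<in>UNIV. (e $ i * 2) * c * (e $ i * 2) * c') = 4 * c * c'" for c c'
      proof -
        have "(\<Sum>i\<in>UNIV. (e $ i * 2) * c * (e $ i * 2) * c') = (\<Sum>i\<in>UNIV. (e $ i)\<^sup>2) * (4 * c * c')"
          unfolding sum_distrib_right by (rule sum.cong) (simp_all add: power2_eq_square)
        thus ?thesis unfolding ssq by simp
      qed
      have "(\<Sum>i\<in>UNIV. outer (R i) (R i)) $ a $ b = I $ a $ b" for a b
      proof -
        have "(\<Sum>i\<in>UNIV. outer (R i) (R i)) $ a $ b
          = (\<Sum>i\<in>UNIV. axis i 1 $ a * axis i 1 $ b - axis i 1 $ a * (2 * e $ i * e $ b)
               - axis i 1 $ b * (2 * e $ i * e $ a) + (e $ i * 2) * e $ a * (e $ i * 2) * e $ b)"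
          by (simp add: outer_def R_def algebra_simps)
        also have "\<dots> = I $ a $ b"
        proof -
          have s1: "(\<Sum>i\<in>UNIV. axis i 1 $ c * f i) = f c" for c :: 'n and f :: "'n \<Rightarrow> real"
            by (subst sum.remove[of _ c]) (auto simp: axis_def)
          have s2: "axis b 1 $ a = I $ a $ b" by (auto simp: axis_def I_def mat_def)
          have "(\<Sum>i\<in>UNIV. axis i 1 $ a * axis i 1 $ b) = I $ a $ b"
            unfolding s1 by (auto simp: axis_def I_def mat_def)
          thus ?thesis unfolding sum.distrib sum_subtractf s3 s1 by (simp add: algebra_simps)
        qed
        finally show ?thesis .
      qed
      thus ?thesis by (simp add: vec_eq_iff)
    qed
    have "I \<bullet> X - I \<bullet> Y = (\<Sum>i\<in>UNIV. axis i 1 \<bullet> (X *v axis i 1) - R i \<bullet> (Y *v R i))"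
      unfolding sum_subtractf inner_outer[symmetric] inner_sum_left[symmetric] out
      by (simp add: mat_1_outer I_def)
    also have "\<dots> \<le> (\<Sum>i\<in>UNIV. 4 * (z + d) * (e $ i)\<^sup>2)"
    proof (rule sum_mono)
      fix i
      have "axis i 1 - R i = (2 * e $ i) *\<^sub>R e" by (simp add: R_def)
      thus "axis i 1 \<bullet> (X *v axis i 1) - R i \<bullet> (Y *v R i) \<le> 4 * (z + d) * (e $ i)\<^sup>2"
        using H[of "axis i 1" "R i"] by (simp add: e ee power_mult_distrib algebra_simps)
    qed
    also have "\<dots> = 4 * (z + d)" by (simp add: ssq flip: sum_distrib_left)
    finally show ?thesis .
  qed
  have "A \<bullet> X - B \<bullet> Y = (\<mu>/2) * (I \<bullet> X - I \<bullet> Y) + (A' \<bullet> X - B' \<bullet> Y)"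
    by (simp add: A'_def B'_def algebra_simps)
  also have "(\<mu>/2) * (I \<bullet> X - I \<bullet> Y) \<le> (\<mu>/2) * (4 * (z + d))" using \<mu> p4 by (intro mult_left_mono) auto
  also have "A' \<bullet> X - B' \<bullet> Y \<le> z * k * 1 + z * (k * real CARD('n)) + z * (2 * k * real CARD('n))"
    using p1 p2 p3 unfolding decomp[of A'] decomp[of B'] inner_minus_right by linarith
  also have "z * k * 1 \<le> z * k * real CARD('n)"
    by (intro mult_left_mono) (use z k in \<open>auto simp: Suc_le_eq\<close>)
  finally show ?thesis by (simp add: algebra_simps)
qed


section \<open>Derivative tests at a touching point\<close>

definition grad :: "(real^'n::finite \<Rightarrow> real) \<Rightarrow> real^'n \<Rightarrow> real^'n" where
  "grad \<phi> x = (\<chi> i. D i \<phi> x)"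

definition hess :: "(real^'n::finite \<Rightarrow> real) \<Rightarrow> real^'n \<Rightarrow> real^'n^'n" where
  "hess \<phi> x = (\<chi> i j. D i (D j \<phi>) x)"

text \<open>What a second-order test at the single point \<open>x\<close> uses; both a solution at a fixed time and the Lyapunov
  function have this regularity at every point.\<close>
definition twice_diff :: "(real^'n::finite \<Rightarrow> real) \<Rightarrow> real^'n \<Rightarrow> bool" where
  "twice_diff \<phi> x \<longleftrightarrow> (\<forall>y. \<phi> differentiable (at y)) \<and> (\<forall>i. D i \<phi> differentiable (at x))"

lemma opA_grad_hess: "opA Q b t \<phi> x = Q t x \<bullet> hess \<phi> x + b t x \<bullet> grad \<phi> x"
  by (simp add: opA_def hess_def grad_def inner_vec_def)

lemma has_derivative_grad:
  assumes "\<phi> differentiable (at x)"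
  shows "(\<phi> has_derivative (\<lambda>h. grad \<phi> x \<bullet> h)) (at x)"
proof -
  have der: "(\<phi> has_derivative frechet_derivative \<phi> (at x)) (at x)"
    using assms by (simp add: frechet_derivative_works)
  interpret linear "frechet_derivative \<phi> (at x)" using der by (rule has_derivative_linear)
  have "frechet_derivative \<phi> (at x) h = grad \<phi> x \<bullet> h" for h
  proof -
    have "frechet_derivative \<phi> (at x) h = frechet_derivative \<phi> (at x) (\<Sum>i\<in>UNIV. h $ i *\<^sub>R axis i 1)"
      by (simp add: basis_expansion scalar_mult_eq_scaleR[symmetric])
    also have "\<dots> = (\<Sum>i\<in>UNIV. h $ i * D i \<phi> x)" by (simp add: sum scale D_def)
    finally show ?thesis by (simp add: grad_def inner_vec_def mult.commute)
  qed
  hence "frechet_derivative \<phi> (at x) = (\<lambda>h. grad \<phi> x \<bullet> h)" by blast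
  thus ?thesis using der by simp
qed

lemma eq_zero_if_orthogonal_to_all: "(\<And>v. u \<bullet> v = 0) \<Longrightarrow> u = (0::'a::real_inner)"
  using inner_eq_zero_iff by blast

lemma line_derivative:
  fixes x v :: "real^'n::finite"
  assumes "\<phi> differentiable (at (x + \<tau> *\<^sub>R v))"
  shows "((\<lambda>\<tau>. \<phi> (x + \<tau> *\<^sub>R v)) has_real_derivative grad \<phi> (x + \<tau> *\<^sub>R v) \<bullet> v) (at \<tau>)"
proof -
  have "((\<lambda>\<tau>. x + \<tau> *\<^sub>R v) has_derivative (\<lambda>h. h *\<^sub>R v)) (at \<tau>)"
    by (auto intro!: derivative_eq_intros)
  from has_derivative_compose[OF this has_derivative_grad[OF assms]]
  show ?thesis by (simp add: has_field_derivative_def mult_commute_abs)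
qed

lemma line_second_derivative:
  fixes x v :: "real^'n::finite"
  assumes "twice_diff \<phi> x"
  shows "((\<lambda>\<tau>. grad \<phi> (x + \<tau> *\<^sub>R v) \<bullet> v) has_real_derivative v \<bullet> (hess \<phi> x *v v)) (at 0)"
proof -
  have "((\<lambda>\<tau>. \<Sum>j\<in>UNIV. D j \<phi> (x + \<tau> *\<^sub>R v) * v $ j) has_real_derivative (\<Sum>j\<in>UNIV. (grad (D j \<phi>) x \<bullet> v) * v $ j)) (at 0)"
  proof (rule DERIV_sum)
    fix j
    have "((\<lambda>\<tau>. D j \<phi> (x + \<tau> *\<^sub>R v)) has_real_derivative grad (D j \<phi>) x \<bullet> v) (at 0)"
      using line_derivative[of "D j \<phi>" x 0 v] assms by (simp add: twice_diff_def)
    from DERIV_cmult_right[OF this, of "v $ j"]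
    show "((\<lambda>\<tau>. D j \<phi> (x + \<tau> *\<^sub>R v) * v $ j) has_real_derivative (grad (D j \<phi>) x \<bullet> v) * v $ j) (at 0)" .
  qed
  moreover have "(\<Sum>j\<in>UNIV. (grad (D j \<phi>) x \<bullet> v) * v $ j) = v \<bullet> (hess \<phi> x *v v)"
  proof -
    have "(\<Sum>j\<in>UNIV. (grad (D j \<phi>) x \<bullet> v) * v $ j) = (\<Sum>j\<in>UNIV. \<Sum>i\<in>UNIV. v $ i * (D i (D j \<phi>) x * v $ j))"
      unfolding grad_def inner_vec_def sum_distrib_right by (simp add: mult_ac)
    also have "\<dots> = (\<Sum>i\<in>UNIV. \<Sum>j\<in>UNIV. v $ i * (D i (D j \<phi>) x * v $ j))" by (rule sum.swap)
    also have "\<dots> = v \<bullet> (hess \<phi> x *v v)"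
      unfolding hess_def inner_vec_def matrix_vector_mult_def by (simp add: sum_distrib_left)
    finally show ?thesis .
  qed
  ultimately show ?thesis by (simp add: grad_def inner_vec_def)
qed

lemma second_derivative_test:
  fixes f f' :: "real \<Rightarrow> real"
  assumes ev: "\<forall>\<^sub>F \<tau> in nhds 0. (f has_real_derivative f' \<tau>) (at \<tau>)"
    and f'': "(f' has_real_derivative l) (at 0)"
    and max: "\<And>\<tau>. f \<tau> \<le> f 0"
  shows "f' 0 = 0" "l \<le> 0"
proof -
  from ev obtain d where d: "d > 0" "\<And>\<tau>. \<bar>\<tau>\<bar> < d \<Longrightarrow> (f has_real_derivative f' \<tau>) (at \<tau>)"
    unfolding eventually_nhds_metric by (auto simp: dist_real_def)
  show f'0: "f' 0 = 0"
    by (rule DERIV_local_max[OF d(2)[of 0] d(1)]) (use d max in auto)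
  show "l \<le> 0"
  proof (rule ccontr)
    assume "\<not> l \<le> 0"
    then obtain e where e: "e > 0" "\<And>h. h > 0 \<Longrightarrow> h < e \<Longrightarrow> f' 0 < f' (0 + h)"
      using DERIV_pos_inc_right[OF f''] by auto
    define h where "h = min d e / 2"
    have h: "0 < h" "h < d" "h < e" using d(1) e(1) by (auto simp: h_def)
    have "\<exists>z>0. z < h \<and> f h - f 0 = (h - 0) * f' z"
      by (rule MVT2) (use h d(2) in auto)
    then obtain z where z: "0 < z" "z < h" "f h - f 0 = h * f' z" by auto
    have "f' z > 0" using e(2)[of z] z h f'0 by simp
    hence "f h > f 0" using z(3) mult_pos_pos[OF h(1), of "f' z"] by linarith
    thus False using max[of h] by simp
  qed
qed

lemma touching_gradient_hessian:
  fixes x v :: "real^'n::finite"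
  assumes f: "twice_diff f x" and V: "twice_diff V x"
    and max: "\<And>y. f y - c * V y \<le> f x - c * V x"
  shows "grad f x = c *\<^sub>R grad V x" "v \<bullet> ((hess f x - c *\<^sub>R hess V x) *v v) \<le> 0"
proof -
  have *: "grad f x \<bullet> v - c * (grad V x \<bullet> v) = 0 \<and> v \<bullet> (hess f x *v v) - c * (v \<bullet> (hess V x *v v)) \<le> 0" for v
  proof -
    let ?F = "\<lambda>\<tau>. f (x + \<tau> *\<^sub>R v) - c * V (x + \<tau> *\<^sub>R v)"
    let ?F' = "\<lambda>\<tau>. grad f (x + \<tau> *\<^sub>R v) \<bullet> v - c * (grad V (x + \<tau> *\<^sub>R v) \<bullet> v)"
    have 1: "\<forall>\<^sub>F \<tau> in nhds 0. (?F has_real_derivative ?F' \<tau>) (at \<tau>)"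
      using f V by (intro always_eventually allI DERIV_diff DERIV_cmult line_derivative) (auto simp: twice_diff_def)
    have 2: "(?F' has_real_derivative v \<bullet> (hess f x *v v) - c * (v \<bullet> (hess V x *v v))) (at 0)"
      by (intro DERIV_diff DERIV_cmult line_second_derivative f V)
    have 3: "?F \<tau> \<le> ?F 0" for \<tau> using max by simp
    show ?thesis using second_derivative_test[OF 1 2 3] by simp
  qed
  have "(grad f x - c *\<^sub>R grad V x) \<bullet> v = 0" for v using *[of v] by (simp add: inner_diff_left)
  hence "grad f x - c *\<^sub>R grad V x = 0" by (rule eq_zero_if_orthogonal_to_all)
  thus "grad f x = c *\<^sub>R grad V x" by simp
  show "v \<bullet> ((hess f x - c *\<^sub>R hess V x) *v v) \<le> 0"
    using *[of v] by (simp only: matrix_vector_mult_diff_rdistrib scaleR_mat_mult_vec inner_diff_right inner_scaleR_right)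
qed

text \<open>Where \<open>f - c V\<close> is maximal the gradients agree and the Hessians are ordered. This is the one-point
  comparison behind the maximum principle.\<close>
lemma opA_le_of_touching:
  assumes f: "twice_diff f x" and V: "twice_diff V x"
    and max: "\<And>y. f y - c * V y \<le> f x - c * V x"
    and psd: "psd (Q t x)"
  shows "opA Q b t f x \<le> c * opA Q b t V x"
proof -
  note * = touching_gradient_hessian[OF f V max]
  have "Q t x \<bullet> (hess f x - c *\<^sub>R hess V x) \<le> 0 * (Q t x \<bullet> mat 1)"
    by (rule psd_inner_le[OF psd]) (use *(2) in simp)
  thus ?thesis unfolding opA_grad_hess *(1) by (simp add: inner_diff_right algebra_simps)
qed

lemma norm_line_derivative:
  fixes p q :: "'a::real_inner"
  assumes "p + \<tau> *\<^sub>R q \<noteq> 0"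
  shows "((\<lambda>\<tau>. norm (p + \<tau> *\<^sub>R q)) has_real_derivative ((p + \<tau> *\<^sub>R q) \<bullet> q) / norm (p + \<tau> *\<^sub>R q)) (at \<tau>)"
proof -
  have "((\<lambda>\<tau>. p + \<tau> *\<^sub>R q) has_derivative (\<lambda>h. h *\<^sub>R q)) (at \<tau>)"
    by (auto intro!: derivative_eq_intros)
  note d = has_derivative_compose[OF this has_derivative_norm[OF assms]]
  show ?thesis unfolding has_field_derivative_def
    by (rule has_derivative_eq_rhs[OF d]) (simp add: fun_eq_iff sgn_div_norm inner_commute divide_inverse algebra_simps)
qed

text \<open>For \<open>K > 0\<close> the function \<open>1 - exp(-K|z|)\<close> is increasing and strictly concave in \<open>|z|\<close>. Its second derivative at \<open>p\<close>
  in a direction \<open>q\<close> orthogonal to \<open>p\<close> is positive of order \<open>1/|p|\<close>, whereas along \<open>p\<close> it is \<open>-K\<^sup>2 exp(-K|p|)\<close>: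
  this is why a coupling should move \<open>x - y\<close> mainly in its own direction.\<close>
lemma radial_second_derivative:
  fixes p q :: "'a::real_inner"
  assumes p: "p \<noteq> 0"
  defines "h \<equiv> (\<lambda>\<tau>. norm (p + \<tau> *\<^sub>R q))"
  defines "h' \<equiv> (\<lambda>\<tau>. ((p + \<tau> *\<^sub>R q) \<bullet> q) / norm (p + \<tau> *\<^sub>R q))"
  shows "\<forall>\<^sub>F \<tau> in nhds 0. ((\<lambda>\<tau>. 1 - exp (- K * h \<tau>)) has_real_derivative K * exp (- K * h \<tau>) * h' \<tau>) (at \<tau>)"
    and "((\<lambda>\<tau>. K * exp (- K * h \<tau>) * h' \<tau>) has_real_derivative
          K * exp (- K * norm p) / norm p * (norm q)\<^sup>2
          - (K\<^sup>2 * exp (- K * norm p) + K * exp (- K * norm p) / norm p) * ((p \<bullet> q) / norm p)\<^sup>2) (at 0)"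
proof -
  have "open {\<tau>. p + \<tau> *\<^sub>R q \<noteq> 0}" by (intro open_Collect_neq continuous_intros)
  from eventually_nhds_in_open[OF this] p
  have ev: "\<forall>\<^sub>F \<tau> in nhds 0. p + \<tau> *\<^sub>R q \<noteq> 0" by simp
  show "\<forall>\<^sub>F \<tau> in nhds 0. ((\<lambda>\<tau>. 1 - exp (- K * h \<tau>)) has_real_derivative K * exp (- K * h \<tau>) * h' \<tau>) (at \<tau>)"
    using ev
  proof eventually_elim
    case (elim \<tau>)
    show ?case unfolding h_def h'_def
      by (rule derivative_eq_intros norm_line_derivative elim refl | simp)+
  qed
  have hd: "(h has_real_derivative (p \<bullet> q) / norm p) (at 0)"
    using norm_line_derivative[of p 0 q] p by (simp add: h_def)
  have n: "norm p \<noteq> 0" using p by simp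
  have h0: "h 0 = norm p" by (simp add: h_def)
  have "((\<lambda>\<tau>. p \<bullet> q + \<tau> * (q \<bullet> q)) has_real_derivative (q \<bullet> q)) (at 0)"
    by (auto intro!: derivative_eq_intros)
  from DERIV_divide[OF this hd] have h'd: "(h' has_real_derivative ((q \<bullet> q) * norm p - (p \<bullet> q) * ((p \<bullet> q) / norm p)) / (norm p * norm p)) (at 0)"
    using n by (simp add: h'_def h_def inner_add_left)
  have "((\<lambda>\<tau>. K * exp (- K * h \<tau>)) has_real_derivative K * (exp (- K * h 0) * (- K * ((p \<bullet> q) / norm p)))) (at 0)"
    by (rule derivative_eq_intros hd refl | simp)+
  from DERIV_mult[OF this h'd]
  show "((\<lambda>\<tau>. K * exp (- K * h \<tau>) * h' \<tau>) has_real_derivative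
          K * exp (- K * norm p) / norm p * (norm q)\<^sup>2
          - (K\<^sup>2 * exp (- K * norm p) + K * exp (- K * norm p) / norm p) * ((p \<bullet> q) / norm p)\<^sup>2) (at 0)"
    by (rule DERIV_cong) (use n in \<open>simp add: h0 h'_def dot_square_norm field_simps power2_eq_square\<close>)
qed

text \<open>The doubled variables are tested along all lines \<open>(x + \<tau> v, y + \<tau> w)\<close>. The independent choice of \<open>v\<close> and
  \<open>w\<close> is what the coupling inequality exploits later.\<close>
lemma two_point_touching:
  fixes x y :: "real^'n::finite" and K c \<epsilon> :: real
  defines "r \<equiv> norm (x - y)"
  defines "e \<equiv> (1 / r) *\<^sub>R (x - y)" and "E \<equiv> exp (- K * r)"
  assumes fx: "twice_diff f x" and fy: "twice_diff f y" and Vx: "twice_diff V x" and Vy: "twice_diff V y"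
    and xy: "x \<noteq> y"
    and max: "\<And>x' y'. f x' - f y' - c * (1 - exp (- K * norm (x' - y')) + \<epsilon> * (V x' + V y'))
              \<le> f x - f y - c * (1 - exp (- K * norm (x - y)) + \<epsilon> * (V x + V y))"
  shows "grad f x - (c * \<epsilon>) *\<^sub>R grad V x = (c * K * E) *\<^sub>R e"
    and "grad f y + (c * \<epsilon>) *\<^sub>R grad V y = (c * K * E) *\<^sub>R e"
    and "v \<bullet> ((hess f x - (c * \<epsilon>) *\<^sub>R hess V x) *v v) - w \<bullet> ((hess f y + (c * \<epsilon>) *\<^sub>R hess V y) *v w)
        \<le> c * (K * E / r * (norm (v - w))\<^sup>2 - (K\<^sup>2 * E + K * E / r) * (e \<bullet> (v - w))\<^sup>2)"
proof -
  have r0: "r \<noteq> 0" using xy by (simp add: r_def)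
  have *: "grad f x \<bullet> v - grad f y \<bullet> w - c * (K * E * (e \<bullet> (v - w)) + \<epsilon> * (grad V x \<bullet> v + grad V y \<bullet> w)) = 0"
    "v \<bullet> (hess f x *v v) - w \<bullet> (hess f y *v w)
      - c * ((K * E / r * (norm (v - w))\<^sup>2 - (K\<^sup>2 * E + K * E / r) * (e \<bullet> (v - w))\<^sup>2)
             + \<epsilon> * (v \<bullet> (hess V x *v v) + w \<bullet> (hess V y *v w))) \<le> 0" for v w
  proof -
    define p q where "p = x - y" and "q = v - w"
    have p: "p \<noteq> 0" using xy by (simp add: p_def)
    let ?h = "\<lambda>\<tau>. norm (p + \<tau> *\<^sub>R q)"
    let ?h' = "\<lambda>\<tau>. ((p + \<tau> *\<^sub>R q) \<bullet> q) / norm (p + \<tau> *\<^sub>R q)"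
    have eq: "(x + \<tau> *\<^sub>R v) - (y + \<tau> *\<^sub>R w) = p + \<tau> *\<^sub>R q" for \<tau>
      by (simp add: p_def q_def algebra_simps)
    let ?F = "\<lambda>\<tau>. f (x + \<tau> *\<^sub>R v) - f (y + \<tau> *\<^sub>R w)
        - c * ((1 - exp (- K * ?h \<tau>)) + \<epsilon> * (V (x + \<tau> *\<^sub>R v) + V (y + \<tau> *\<^sub>R w)))"
    let ?F' = "\<lambda>\<tau>. grad f (x + \<tau> *\<^sub>R v) \<bullet> v - grad f (y + \<tau> *\<^sub>R w) \<bullet> w
        - c * (K * exp (- K * ?h \<tau>) * ?h' \<tau> + \<epsilon> * (grad V (x + \<tau> *\<^sub>R v) \<bullet> v + grad V (y + \<tau> *\<^sub>R w) \<bullet> w))"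
    note rad = radial_second_derivative[OF p, where K = K and q = q]
    have 1: "\<forall>\<^sub>F \<tau> in nhds 0. (?F has_real_derivative ?F' \<tau>) (at \<tau>)"
      using rad(1)
    proof eventually_elim
      case (elim \<tau>)
      show ?case
        using fx fy Vx Vy by (intro DERIV_diff DERIV_add DERIV_cmult line_derivative elim) (auto simp: twice_diff_def)
    qed
    have 2: "(?F' has_real_derivative v \<bullet> (hess f x *v v) - w \<bullet> (hess f y *v w)
      - c * ((K * exp (- K * norm p) / norm p * (norm q)\<^sup>2
          - (K\<^sup>2 * exp (- K * norm p) + K * exp (- K * norm p) / norm p) * ((p \<bullet> q) / norm p)\<^sup>2)
             + \<epsilon> * (v \<bullet> (hess V x *v v) + w \<bullet> (hess V y *v w)))) (at 0)"
      by (intro DERIV_diff DERIV_add DERIV_cmult line_second_derivative fx fy Vx Vy rad(2))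
    have 3: "?F \<tau> \<le> ?F 0" for \<tau>
      using max[of "x + \<tau> *\<^sub>R v" "y + \<tau> *\<^sub>R w"] unfolding eq by (simp add: p_def)
    have e: "e \<bullet> q = (p \<bullet> q) / norm p" by (simp add: e_def r_def p_def)
    from second_derivative_test[OF 1 2 3]
    show "grad f x \<bullet> v - grad f y \<bullet> w - c * (K * E * (e \<bullet> (v - w)) + \<epsilon> * (grad V x \<bullet> v + grad V y \<bullet> w)) = 0"
    "v \<bullet> (hess f x *v v) - w \<bullet> (hess f y *v w)
      - c * ((K * E / r * (norm (v - w))\<^sup>2 - (K\<^sup>2 * E + K * E / r) * (e \<bullet> (v - w))\<^sup>2)
             + \<epsilon> * (v \<bullet> (hess V x *v v) + w \<bullet> (hess V y *v w))) \<le> 0"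
      unfolding q_def[symmetric] e by (simp_all add: E_def r_def p_def[symmetric])
  qed
  have "(grad f x - (c * \<epsilon>) *\<^sub>R grad V x - (c * K * E) *\<^sub>R e) \<bullet> v = 0" for v
    using *(1)[of v 0] by (simp add: algebra_simps)
  hence "grad f x - (c * \<epsilon>) *\<^sub>R grad V x - (c * K * E) *\<^sub>R e = 0" by (rule eq_zero_if_orthogonal_to_all)
  thus "grad f x - (c * \<epsilon>) *\<^sub>R grad V x = (c * K * E) *\<^sub>R e" by simp
  have "(grad f y + (c * \<epsilon>) *\<^sub>R grad V y - (c * K * E) *\<^sub>R e) \<bullet> w = 0" for w
    using *(1)[of 0 w] by (simp add: algebra_simps)
  hence "grad f y + (c * \<epsilon>) *\<^sub>R grad V y - (c * K * E) *\<^sub>R e = 0" by (rule eq_zero_if_orthogonal_to_all)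
  thus "grad f y + (c * \<epsilon>) *\<^sub>R grad V y = (c * K * E) *\<^sub>R e" by simp
  show "v \<bullet> ((hess f x - (c * \<epsilon>) *\<^sub>R hess V x) *v v) - w \<bullet> ((hess f y + (c * \<epsilon>) *\<^sub>R hess V y) *v w)
        \<le> c * (K * E / r * (norm (v - w))\<^sup>2 - (K\<^sup>2 * E + K * E / r) * (e \<bullet> (v - w))\<^sup>2)"
    using *(2)[of v w]
    unfolding matrix_vector_mult_diff_rdistrib matrix_vector_mult_add_rdistrib scaleR_mat_mult_vec
      inner_diff_right inner_add_right inner_scaleR_right
    by (simp only: distrib_left right_diff_distrib mult.assoc)
qed

lemma two_point_generator:
  fixes x y :: "real^'n::finite" and K c \<epsilon> \<mu> k :: real
  defines "r \<equiv> norm (x - y)"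
  defines "E \<equiv> exp (- K * r)"
  assumes fx: "twice_diff f x" and fy: "twice_diff f y" and Vx: "twice_diff V x" and Vy: "twice_diff V y"
    and xy: "x \<noteq> y" and c: "0 < c" and K: "0 < K"
    and max: "\<And>x' y'. f x' - f y' - c * (1 - exp (- K * norm (x' - y')) + \<epsilon> * (V x' + V y'))
              \<le> f x - f y - c * (1 - exp (- K * norm (x - y)) + \<epsilon> * (V x + V y))"
    and sym: "transpose (Q t x) = Q t x" "transpose (Q t y) = Q t y"
    and \<mu>: "0 < \<mu>" "\<And>v. \<mu> * (norm v)\<^sup>2 \<le> v \<bullet> (Q t x *v v)" "\<And>v. \<mu> * (norm v)\<^sup>2 \<le> v \<bullet> (Q t y *v v)"
    and k: "0 < k" "norm (Q t x - Q t y) \<le> k"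
  shows "opA Q b t f x - opA Q b t f y
      \<le> c * (- 2 * \<mu> * K\<^sup>2 * E + 4 * real CARD('n) * (K * E / r) * k
             + K * E / r * ((b t x - b t y) \<bullet> (x - y)) + \<epsilon> * (opA Q b t V x + opA Q b t V y))"
proof -
  define e where "e = (1 / r) *\<^sub>R (x - y)"
  have r: "r > 0" using xy by (simp add: r_def)
  have E: "E > 0" by (simp add: E_def)
  note tt = two_point_touching[OF fx fy Vx Vy xy max, folded r_def, folded e_def E_def]
  define X where "X = hess f x - (c * \<epsilon>) *\<^sub>R hess V x"
  define Y where "Y = hess f y + (c * \<epsilon>) *\<^sub>R hess V y"
  define z where "z = c * (K * E / r)"
  define d where "d = - c * (K\<^sup>2 * E + K * E / r)"
  have ne: "norm e = 1" using r by (simp add: e_def r_def)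
  have z: "0 \<le> z" using c K E r by (simp add: z_def)
  have d: "d \<le> 0" using c K E r unfolding d_def by (simp add: zero_le_mult_iff)
  have H: "v \<bullet> (X *v v) - w \<bullet> (Y *v w) \<le> z * (norm (v - w))\<^sup>2 + d * (e \<bullet> (v - w))\<^sup>2" for v w
  proof -
    have "c * (K * E / r * (norm (v - w))\<^sup>2 - (K\<^sup>2 * E + K * E / r) * (e \<bullet> (v - w))\<^sup>2)
        = z * (norm (v - w))\<^sup>2 + d * (e \<bullet> (v - w))\<^sup>2"
    proof -
      have "c * (a * p - b * q) = (c * a) * p + (- c * b) * q" for a b p q by (simp add: algebra_simps)
      thus ?thesis unfolding z_def d_def by blast
    qed
    thus ?thesis using tt(3)[of v w] unfolding X_def Y_def by linarith
  qed
  have "Q t x \<bullet> X - Q t y \<bullet> Y \<le> 2 * \<mu> * (z + d) + 4 * real CARD('n) * z * k"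
    by (rule coupling_inequality[OF sym \<mu> k ne z d H])
  also have "z + d = - c * K\<^sup>2 * E" by (simp add: z_def d_def algebra_simps)
  finally have 1: "Q t x \<bullet> X - Q t y \<bullet> Y \<le> c * (- 2 * \<mu> * K\<^sup>2 * E + 4 * real CARD('n) * (K * E / r) * k)"
    by (simp add: z_def algebra_simps)
  have gx: "grad f x = (c * \<epsilon>) *\<^sub>R grad V x + (c * K * E) *\<^sub>R e"
    and gy: "grad f y = (c * K * E) *\<^sub>R e - (c * \<epsilon>) *\<^sub>R grad V y"
    using tt(1,2) by (simp_all add: algebra_simps)
  have "opA Q b t f x - opA Q b t f y
     = (Q t x \<bullet> X - Q t y \<bullet> Y) + c * K * E * ((b t x - b t y) \<bullet> e) + c * \<epsilon> * (opA Q b t V x + opA Q b t V y)"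
    unfolding opA_grad_hess gx gy X_def Y_def by (simp add: algebra_simps)
  also have "\<dots> \<le> c * (- 2 * \<mu> * K\<^sup>2 * E + 4 * real CARD('n) * (K * E / r) * k)
     + c * K * E * ((b t x - b t y) \<bullet> e) + c * \<epsilon> * (opA Q b t V x + opA Q b t V y)"
    using 1 by simp
  also have "(b t x - b t y) \<bullet> e = (b t x - b t y) \<bullet> (x - y) / r" by (simp add: e_def)
  also have "\<And>p S v. c * p + c * K * E * (S / r) + c * \<epsilon> * v = c * (p + K * E / r * S + \<epsilon> * v)"
    by (simp add: algebra_simps)
  finally show ?thesis .
qed


section \<open>Comparing the coefficients at two points\<close>

lemma matrix_line_derivative:
  fixes A :: "real^'n::finite \<Rightarrow> real^'n^'n"
  assumes "\<And>i j. (\<lambda>y. A y $ i $ j) differentiable (at (x + \<tau> *\<^sub>R h))"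
  shows "\<exists>l. ((\<lambda>\<tau>. S \<bullet> A (x + \<tau> *\<^sub>R h)) has_real_derivative l) (at \<tau>) \<and>
     \<bar>l\<bar> \<le> norm S * (sqrt (\<Sum>i\<in>UNIV. \<Sum>j\<in>UNIV. \<Sum>k\<in>UNIV. (D k (\<lambda>y. A y $ i $ j) (x + \<tau> *\<^sub>R h))\<^sup>2) * norm h)"
proof -
  define z where "z = x + \<tau> *\<^sub>R h"
  define W where "W = (\<chi> i j. grad (\<lambda>y. A y $ i $ j) z \<bullet> h)"
  have "((\<lambda>\<tau>. \<Sum>i\<in>UNIV. \<Sum>j\<in>UNIV. S $ i $ j * A (x + \<tau> *\<^sub>R h) $ i $ j) has_real_derivative
      (\<Sum>i\<in>UNIV. \<Sum>j\<in>UNIV. S $ i $ j * (grad (\<lambda>y. A y $ i $ j) z \<bullet> h))) (at \<tau>)"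
    unfolding z_def
    by (intro DERIV_sum DERIV_cmult line_derivative[where \<phi> = "\<lambda>y. A y $ _ $ _"] assms)
  hence "((\<lambda>\<tau>. S \<bullet> A (x + \<tau> *\<^sub>R h)) has_real_derivative S \<bullet> W) (at \<tau>)"
    by (simp add: inner_vec_def W_def)
  moreover have "\<bar>S \<bullet> W\<bar> \<le> norm S * norm W" by (rule Cauchy_Schwarz_ineq2)
  moreover have "norm W \<le> sqrt (\<Sum>i\<in>UNIV. \<Sum>j\<in>UNIV. \<Sum>k\<in>UNIV. (D k (\<lambda>y. A y $ i $ j) z)\<^sup>2) * norm h"
  proof (rule power2_le_imp_le)
    have "(norm W)\<^sup>2 = (\<Sum>i\<in>UNIV. \<Sum>j\<in>UNIV. (grad (\<lambda>y. A y $ i $ j) z \<bullet> h)\<^sup>2)"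
      unfolding norm_sq_vec[of W] norm_sq_vec[of "W $ _"] by (simp add: W_def)
    also have "\<dots> \<le> (\<Sum>i\<in>UNIV. \<Sum>j\<in>UNIV. (norm (grad (\<lambda>y. A y $ i $ j) z))\<^sup>2 * (norm h)\<^sup>2)"
    proof (intro sum_mono)
      fix i j
      show "(grad (\<lambda>y. A y $ i $ j) z \<bullet> h)\<^sup>2 \<le> (norm (grad (\<lambda>y. A y $ i $ j) z))\<^sup>2 * (norm h)\<^sup>2"
        unfolding power_mult_distrib[symmetric] power2_abs[symmetric, of "_ \<bullet> _"]
        by (intro power_mono Cauchy_Schwarz_ineq2) auto
    qed
    also have "\<dots> = (\<Sum>i\<in>UNIV. \<Sum>j\<in>UNIV. \<Sum>k\<in>UNIV. (D k (\<lambda>y. A y $ i $ j) z)\<^sup>2) * (norm h)\<^sup>2"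
      unfolding norm_sq_vec[of "grad _ _"] sum_distrib_right by (simp add: grad_def)
    also have "\<dots> = (sqrt (\<Sum>i\<in>UNIV. \<Sum>j\<in>UNIV. \<Sum>k\<in>UNIV. (D k (\<lambda>y. A y $ i $ j) z)\<^sup>2) * norm h)\<^sup>2"
      by (simp add: power_mult_distrib sum_nonneg)
    finally show "(norm W)\<^sup>2 \<le> (sqrt (\<Sum>i\<in>UNIV. \<Sum>j\<in>UNIV. \<Sum>k\<in>UNIV. (D k (\<lambda>y. A y $ i $ j) z)\<^sup>2) * norm h)\<^sup>2" .
  qed (simp add: sum_nonneg)
  ultimately show ?thesis unfolding z_def[symmetric]
    by (intro exI[of _ "S \<bullet> W"]) (meson mult_left_mono norm_ge_zero order_trans)
qed

lemma exponential_growth_bounds: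
  fixes g :: "real \<Rightarrow> real"
  assumes "\<And>\<tau>. \<exists>l. (g has_real_derivative l) (at \<tau>) \<and> \<bar>l\<bar> \<le> c * g \<tau>"
    and \<tau>: "0 \<le> \<tau>"
  shows "g \<tau> \<le> exp (c * \<tau>) * g 0" "exp (- c * \<tau>) * g 0 \<le> g \<tau>"
proof -
  have "g \<tau> * exp (- c * \<tau>) \<le> g 0 * exp (- c * 0)"
  proof (rule DERIV_nonpos_imp_nonincreasing[OF \<tau>])
    fix \<sigma>
    obtain l where l: "(g has_real_derivative l) (at \<sigma>)" "\<bar>l\<bar> \<le> c * g \<sigma>" using assms(1) by blast
    have "((\<lambda>\<sigma>. g \<sigma> * exp (- c * \<sigma>)) has_real_derivative (l - c * g \<sigma>) * exp (- c * \<sigma>)) (at \<sigma>)"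
      by (rule derivative_eq_intros l(1) refl | simp)+ (simp add: algebra_simps)
    moreover have "(l - c * g \<sigma>) * exp (- c * \<sigma>) \<le> 0" using l(2) by (intro mult_nonpos_nonneg) auto
    ultimately show "\<exists>y. ((\<lambda>\<sigma>. g \<sigma> * exp (- c * \<sigma>)) has_real_derivative y) (at \<sigma>) \<and> y \<le> 0" by blast
  qed
  hence "g \<tau> * exp (- c * \<tau>) * exp (c * \<tau>) \<le> g 0 * exp (c * \<tau>)" by (intro mult_right_mono) auto
  moreover have e: "exp (- c * \<tau>) * exp (c * \<tau>) = 1" by (simp add: exp_minus)
  ultimately show "g \<tau> \<le> exp (c * \<tau>) * g 0" unfolding mult.assoc e by (simp add: mult.commute)
  have "- (g \<tau> * exp (c * \<tau>)) \<le> - (g 0 * exp (c * 0))"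
  proof (rule DERIV_nonpos_imp_nonincreasing[OF \<tau>])
    fix \<sigma>
    obtain l where l: "(g has_real_derivative l) (at \<sigma>)" "\<bar>l\<bar> \<le> c * g \<sigma>" using assms(1) by blast
    have "((\<lambda>\<sigma>. - (g \<sigma> * exp (c * \<sigma>))) has_real_derivative (- l - c * g \<sigma>) * exp (c * \<sigma>)) (at \<sigma>)"
      by (rule derivative_eq_intros l(1) refl | simp)+ (simp add: algebra_simps)
    moreover have "(- l - c * g \<sigma>) * exp (c * \<sigma>) \<le> 0" using l(2) by (intro mult_nonpos_nonneg) auto
    ultimately show "\<exists>y. ((\<lambda>\<sigma>. - (g \<sigma> * exp (c * \<sigma>))) has_real_derivative y) (at \<sigma>) \<and> y \<le> 0" by blast
  qed
  hence "g 0 * exp (- c * \<tau>) \<le> g \<tau> * exp (c * \<tau>) * exp (- c * \<tau>)" by (intro mult_right_mono) auto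
  thus "exp (- c * \<tau>) * g 0 \<le> g \<tau>"
    using e by (simp only: mult.assoc mult.commute[of "exp (c * \<tau>)"] mult_1_right mult.commute[of "g 0"])
qed

text \<open>The bound \<open>|\<nabla>Q| \<le> c \<eta>\<close> compares \<open>\<nabla>Q\<close> with every value \<open>w \<bullet> Q w\<close> on unit vectors, since \<open>\<eta>\<close> is a lower
  bound for all of them. So each of these values changes at most by the factor \<open>exp(c|h|)\<close> along a
  segment of length \<open>|h|\<close>. Applied to a minimising unit vector this controls \<open>\<eta>\<close> itself along the
  segment, although \<open>\<eta>\<close> has no regularity, and the mean value inequality bounds the variation of \<open>Q\<close> by
  the smallest eigenvalue \<open>l\<close> at \<open>x\<close>.\<close>
lemma diffusion_comparability:
  fixes A :: "real^'n::finite \<Rightarrow> real^'n^'n" and x h :: "real^'n"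
  assumes diff: "\<And>i j z. (\<lambda>y. A y $ i $ j) differentiable (at z)"
    and ell: "\<And>z v. \<eta> z * (norm v)\<^sup>2 \<le> v \<bullet> (A z *v v)"
    and \<eta>0: "0 < \<eta>\<^sub>0" and \<eta>: "\<And>z. \<eta>\<^sub>0 \<le> \<eta> z" and c: "0 \<le> c"
    and bd: "\<And>z. sqrt (\<Sum>i\<in>UNIV. \<Sum>j\<in>UNIV. \<Sum>k\<in>UNIV. (D k (\<lambda>y. A y $ i $ j) z)\<^sup>2) \<le> c * \<eta> z"
  shows "\<exists>l\<ge>\<eta>\<^sub>0. (\<forall>v. l * (norm v)\<^sup>2 \<le> v \<bullet> (A x *v v))
      \<and> (\<forall>v. exp (- c * norm h) * l * (norm v)\<^sup>2 \<le> v \<bullet> (A (x + h) *v v))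
      \<and> norm (A x - A (x + h)) \<le> c * norm h * exp (c * norm h) * l"
proof -
  let ?r = "norm h"
  have scale: "l * (norm v)\<^sup>2 \<le> v \<bullet> (B *v v)" if "\<And>w. norm w = 1 \<Longrightarrow> l \<le> w \<bullet> (B *v w)" for l B and v :: "real^'n"
  proof (cases "v = 0")
    case False
    have "l \<le> (v /\<^sub>R norm v) \<bullet> (B *v (v /\<^sub>R norm v))" by (rule that) (use False in simp)
    thus ?thesis using False by (simp add: matrix_vector_mult_scaleR field_simps power2_eq_square)
  qed simp
  have growth: "\<exists>l. ((\<lambda>\<tau>. w \<bullet> (A (x + \<tau> *\<^sub>R h) *v w)) has_real_derivative l) (at \<tau>)
      \<and> \<bar>l\<bar> \<le> c * ?r * (w \<bullet> (A (x + \<tau> *\<^sub>R h) *v w))" if w: "norm w = 1" for w \<tau>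
  proof -
    from matrix_line_derivative[of A x \<tau> h "outer w w", OF diff] obtain l where
      l: "((\<lambda>\<tau>. outer w w \<bullet> A (x + \<tau> *\<^sub>R h)) has_real_derivative l) (at \<tau>)"
      "\<bar>l\<bar> \<le> norm (outer w w) * (sqrt (\<Sum>i\<in>UNIV. \<Sum>j\<in>UNIV. \<Sum>k\<in>UNIV. (D k (\<lambda>y. A y $ i $ j) (x + \<tau> *\<^sub>R h))\<^sup>2) * ?r)"
      by blast
    note l(2)
    also have "norm (outer w w) = 1" by (simp add: norm_outer w)
    also have "1 * (sqrt (\<Sum>i\<in>UNIV. \<Sum>j\<in>UNIV. \<Sum>k\<in>UNIV. (D k (\<lambda>y. A y $ i $ j) (x + \<tau> *\<^sub>R h))\<^sup>2) * ?r)
       \<le> 1 * (c * \<eta> (x + \<tau> *\<^sub>R h) * ?r)"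
      by (intro mult_left_mono mult_right_mono bd) auto
    also have "\<dots> \<le> 1 * (c * (w \<bullet> (A (x + \<tau> *\<^sub>R h) *v w)) * ?r)"
      using ell[of "x + \<tau> *\<^sub>R h" w] c w by (intro mult_left_mono mult_right_mono) auto
    finally have "\<bar>l\<bar> \<le> c * ?r * (w \<bullet> (A (x + \<tau> *\<^sub>R h) *v w))" by (simp add: mult_ac)
    thus ?thesis using l(1) unfolding inner_outer by blast
  qed
  have "sphere 0 1 \<noteq> ({} :: (real^'n) set)"
    using norm_axis_1 by (auto simp: set_eq_iff intro: exI[of _ "axis undefined 1"])
  moreover have "continuous_on (sphere 0 1) (\<lambda>w::real^'n. w \<bullet> (A x *v w))"
    by (intro continuous_intros)
  ultimately obtain w0 where w0: "norm w0 = 1" and min: "\<And>w. norm w = 1 \<Longrightarrow> w0 \<bullet> (A x *v w0) \<le> w \<bullet> (A x *v w)"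
    using continuous_attains_inf[OF compact_sphere, of "0 :: real^'n" 1 "\<lambda>w. w \<bullet> (A x *v w)"] by auto
  define l where "l = w0 \<bullet> (A x *v w0)"
  have l: "\<eta>\<^sub>0 \<le> l" using ell[of x w0] \<eta>[of x] w0 unfolding l_def by simp
  have \<eta>l: "\<eta> (x + \<tau> *\<^sub>R h) \<le> exp (c * ?r) * l" if "0 \<le> \<tau>" "\<tau> \<le> 1" for \<tau>
  proof -
    have lpos: "0 \<le> l" using l \<eta>0 by simp
    have "\<eta> (x + \<tau> *\<^sub>R h) \<le> w0 \<bullet> (A (x + \<tau> *\<^sub>R h) *v w0)" using ell[of "x + \<tau> *\<^sub>R h" w0] w0 by simp
    also have "\<dots> \<le> exp (c * ?r * \<tau>) * l"
      using exponential_growth_bounds(1)[OF growth[OF w0] that(1)] unfolding l_def by simp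
    also have "\<dots> \<le> exp (c * ?r) * l"
      using c that lpos by (intro mult_right_mono) (auto simp: mult_left_le)
    finally show ?thesis .
  qed
  have low: "exp (- c * ?r) * l * (norm v)\<^sup>2 \<le> v \<bullet> (A (x + h) *v v)" for v
  proof (rule scale)
    fix w :: "real^'n" assume w: "norm w = 1"
    have "exp (- c * ?r) * l \<le> exp (- (c * ?r) * 1) * (w \<bullet> (A (x + 0 *\<^sub>R h) *v w))"
      using min[OF w] unfolding l_def by simp
    also have "\<dots> \<le> w \<bullet> (A (x + 1 *\<^sub>R h) *v w)"
      by (rule exponential_growth_bounds(2)[OF growth[OF w]]) simp
    finally show "exp (- c * ?r) * l \<le> w \<bullet> (A (x + h) *v w)" by simp
  qed
  have "norm (A x - A (x + h)) \<le> c * ?r * exp (c * ?r) * l"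
  proof -
    define S where "S = A x - A (x + h)"
    define B where "B = norm S * (c * ?r * exp (c * ?r) * l)"
    have "- (S \<bullet> A (x + 1 *\<^sub>R h)) - B * 1 \<le> - (S \<bullet> A (x + 0 *\<^sub>R h)) - B * 0"
    proof (rule DERIV_nonpos_imp_nonincreasing[where f = "\<lambda>\<tau>. - (S \<bullet> A (x + \<tau> *\<^sub>R h)) - B * \<tau>"])
      fix \<tau> :: real assume \<tau>: "0 \<le> \<tau>" "\<tau> \<le> 1"
      from matrix_line_derivative[of A x \<tau> h S, OF diff] obtain d where
        d: "((\<lambda>\<tau>. S \<bullet> A (x + \<tau> *\<^sub>R h)) has_real_derivative d) (at \<tau>)"
        "\<bar>d\<bar> \<le> norm S * (sqrt (\<Sum>i\<in>UNIV. \<Sum>j\<in>UNIV. \<Sum>k\<in>UNIV. (D k (\<lambda>y. A y $ i $ j) (x + \<tau> *\<^sub>R h))\<^sup>2) * ?r)"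
        by blast
      note d(2)
      also have "norm S * (sqrt (\<Sum>i\<in>UNIV. \<Sum>j\<in>UNIV. \<Sum>k\<in>UNIV. (D k (\<lambda>y. A y $ i $ j) (x + \<tau> *\<^sub>R h))\<^sup>2) * ?r)
         \<le> norm S * (c * \<eta> (x + \<tau> *\<^sub>R h) * ?r)"
        by (intro mult_left_mono mult_right_mono bd) auto
      also have "\<dots> \<le> norm S * (c * (exp (c * ?r) * l) * ?r)"
        by (intro mult_left_mono mult_right_mono \<eta>l \<tau> c) auto
      also have "\<dots> = B" by (simp add: B_def)
      finally have "- d - B \<le> 0" by linarith
      moreover have "((\<lambda>\<tau>. - (S \<bullet> A (x + \<tau> *\<^sub>R h)) - B * \<tau>) has_real_derivative - d - B) (at \<tau>)"
        by (rule derivative_eq_intros d(1) refl | simp)+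
      ultimately show "\<exists>y. ((\<lambda>\<tau>. - (S \<bullet> A (x + \<tau> *\<^sub>R h)) - B * \<tau>) has_real_derivative y) (at \<tau>) \<and> y \<le> 0" by blast
    qed simp
    hence "S \<bullet> S \<le> B" by (simp add: S_def inner_diff_right)
    hence "norm S * norm S \<le> norm S * (c * ?r * exp (c * ?r) * l)"
      unfolding B_def dot_square_norm by (simp add: power2_eq_square)
    thus ?thesis unfolding S_def[symmetric]
    proof (cases "norm S = 0")
      case True
      have "0 \<le> c * ?r * exp (c * ?r) * l" using c l \<eta>0 by simp
      thus "norm S \<le> c * ?r * exp (c * ?r) * l" using True by simp
    qed (simp)
  qed
  thus ?thesis using l low scale[of l "A x"] min unfolding l_def by blast
qed

lemma one_sided_Lipschitz:
  fixes f :: "real^'n::finite \<Rightarrow> real^'n"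
  assumes diff: "\<And>z. f differentiable (at z)"
    and J: "\<And>z \<xi>. (jacobian f (at z) *v \<xi>) \<bullet> \<xi> \<le> r\<^sub>0 * (norm \<xi>)\<^sup>2"
  shows "(f x - f y) \<bullet> (x - y) \<le> r\<^sub>0 * (norm (x - y))\<^sup>2"
proof -
  define h where "h = x - y"
  have "f (y + 1 *\<^sub>R h) \<bullet> h - r\<^sub>0 * (norm h)\<^sup>2 * 1 \<le> f (y + 0 *\<^sub>R h) \<bullet> h - r\<^sub>0 * (norm h)\<^sup>2 * 0"
  proof (rule DERIV_nonpos_imp_nonincreasing[where f = "\<lambda>\<tau>. f (y + \<tau> *\<^sub>R h) \<bullet> h - r\<^sub>0 * (norm h)\<^sup>2 * \<tau>"])
    fix \<tau> :: real
    have 1: "((\<lambda>\<tau>. y + \<tau> *\<^sub>R h) has_derivative (\<lambda>d. d *\<^sub>R h)) (at \<tau>)"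
      by (auto intro!: derivative_eq_intros)
    have 2: "(f has_derivative (\<lambda>d. jacobian f (at (y + \<tau> *\<^sub>R h)) *v d)) (at (y + \<tau> *\<^sub>R h))"
      using diff jacobian_works by blast
    note 3 = has_derivative_inner_left[OF has_derivative_compose[OF 1 2], of h]
    have "((\<lambda>\<tau>. f (y + \<tau> *\<^sub>R h) \<bullet> h) has_real_derivative (jacobian f (at (y + \<tau> *\<^sub>R h)) *v h) \<bullet> h) (at \<tau>)"
      unfolding has_field_derivative_def
      by (rule has_derivative_eq_rhs[OF 3]) (simp add: fun_eq_iff matrix_vector_mult_scaleR)
    from DERIV_diff[OF this DERIV_cmult_Id[of "r\<^sub>0 * (norm h)\<^sup>2"]]
    moreover have "(jacobian f (at (y + \<tau> *\<^sub>R h)) *v h) \<bullet> h - r\<^sub>0 * (norm h)\<^sup>2 \<le> 0" using J by simp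
    ultimately show "\<exists>l. ((\<lambda>\<tau>. f (y + \<tau> *\<^sub>R h) \<bullet> h - r\<^sub>0 * (norm h)\<^sup>2 * \<tau>) has_real_derivative l) (at \<tau>) \<and> l \<le> 0"
      by blast
  qed simp
  thus ?thesis by (simp add: h_def inner_diff_left)
qed

text \<open>All constants are uniform in time; this is where a decay rate that does not depend on time comes
  from. The smallest eigenvalue \<open>l\<close> of \<open>Q(t,x)\<close>, in contrast, may grow without bound.\<close>
lemma standing_assumptions_constants:
  fixes Q :: "real \<Rightarrow> real^'n::finite \<Rightarrow> real^'n^'n"
  assumes "standing_assumptions Q b"
  obtains V a \<kappa> \<eta>\<^sub>0 c\<^sub>0 r\<^sub>0 where
    "C2 V" "\<And>x. 0 < V x" "filterlim V at_top at_infinity" "0 \<le> a" "0 < \<kappa>"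
    "\<And>t x. 0 \<le> t \<Longrightarrow> opA Q b t V x \<le> a - \<kappa> * V x"
    "0 < \<eta>\<^sub>0" "0 \<le> c\<^sub>0" "\<And>t x. 0 \<le> t \<Longrightarrow> psd (Q t x)"
    "\<And>t x y. 0 \<le> t \<Longrightarrow> \<exists>l\<ge>\<eta>\<^sub>0. (\<forall>v. l * (norm v)\<^sup>2 \<le> v \<bullet> (Q t x *v v))
      \<and> (\<forall>v. exp (- c\<^sub>0 * norm (x - y)) * l * (norm v)\<^sup>2 \<le> v \<bullet> (Q t y *v v))
      \<and> norm (Q t x - Q t y) \<le> c\<^sub>0 * norm (x - y) * exp (c\<^sub>0 * norm (x - y)) * l"
    "\<And>t x y. 0 \<le> t \<Longrightarrow> (b t x - b t y) \<bullet> (x - y) \<le> r\<^sub>0 * (norm (x - y))\<^sup>2"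
proof -
  from assms obtain \<eta> V where reg: "regular_coeffs Q b" and ell: "elliptic Q \<eta>"
    and lyap: "lyapunov Q b V" and gb: "gradient_bounds Q b \<eta>"
    unfolding standing_assumptions_def by blast
  from lyap obtain a \<kappa> where V: "C2 V" "\<And>x. 0 < V x" "filterlim V at_top at_infinity" "0 \<le> a" "0 < \<kappa>"
    "\<And>t x. 0 \<le> t \<Longrightarrow> opA Q b t V x \<le> a - \<kappa> * V x"
    unfolding lyapunov_def by blast
  from ell obtain \<eta>\<^sub>0 where \<eta>0: "0 < \<eta>\<^sub>0" and \<eta>: "\<And>t x. 0 \<le> t \<Longrightarrow> \<eta>\<^sub>0 \<le> \<eta> t x"
    and sym: "\<And>t x. 0 \<le> t \<Longrightarrow> transpose (Q t x) = Q t x"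
    and form: "\<And>t x v. 0 \<le> t \<Longrightarrow> \<eta> t x * (norm v)\<^sup>2 \<le> v \<bullet> (Q t x *v v)"
    unfolding elliptic_def by (metis inner_commute)
  from gb obtain c\<^sub>0 where c0: "0 \<le> c\<^sub>0" "\<And>t x. 0 \<le> t \<Longrightarrow>
        sqrt (\<Sum>i\<in>UNIV. \<Sum>j\<in>UNIV. \<Sum>k\<in>UNIV. (D k (\<lambda>y. Q t y $ i $ j) x)\<^sup>2) \<le> c\<^sub>0 * \<eta> t x"
    unfolding gradient_bounds_def by blast
  from gb obtain r\<^sub>0 where r0: "\<And>t x \<xi>. 0 \<le> t \<Longrightarrow> (jacobian (b t) (at x) *v \<xi>) \<bullet> \<xi> \<le> r\<^sub>0 * (norm \<xi>)\<^sup>2"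
    unfolding gradient_bounds_def by blast
  have Qd: "(\<lambda>y. Q t y $ i $ j) differentiable (at x)" if "0 \<le> t" for t x i j
    using reg that unfolding regular_coeffs_def C1_loc_Hoelder_def by blast
  have bd: "b t differentiable (at x)" if "0 \<le> t" for t x
  proof -
    have "(\<lambda>y. b t y $ i) differentiable (at x)" for i
      using reg that unfolding regular_coeffs_def C1_loc_Hoelder_def by blast
    thus ?thesis by (subst differentiable_componentwise_within) (auto simp: Basis_vec_def inner_axis)
  qed
  show ?thesis
  proof (rule that[OF V \<eta>0 c0(1)])
    show "psd (Q t x)" if t: "0 \<le> t" for t x
      unfolding psd_def using sym[OF t] form[OF t] \<eta>[OF t, of x] \<eta>0
      by (metis dual_order.trans less_eq_real_def mult_nonneg_nonneg zero_le_power2)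
    show "\<exists>l\<ge>\<eta>\<^sub>0. (\<forall>v. l * (norm v)\<^sup>2 \<le> v \<bullet> (Q t x *v v))
      \<and> (\<forall>v. exp (- c\<^sub>0 * norm (x - y)) * l * (norm v)\<^sup>2 \<le> v \<bullet> (Q t y *v v))
      \<and> norm (Q t x - Q t y) \<le> c\<^sub>0 * norm (x - y) * exp (c\<^sub>0 * norm (x - y)) * l" if t: "0 \<le> t" for t x y
      using diffusion_comparability[OF Qd[OF t] form[OF t] \<eta>0 \<eta>[OF t] c0(1) c0(2)[OF t], of x "y - x"]
      by (simp add: norm_minus_commute)
    show "(b t x - b t y) \<bullet> (x - y) \<le> r\<^sub>0 * (norm (x - y))\<^sup>2" if t: "0 \<le> t" for t x y
      by (rule one_sided_Lipschitz[OF bd[OF t] r0[OF t]])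
  qed
qed

lemma C2_twice_diff: "C2 V \<Longrightarrow> twice_diff V x"
  unfolding C2_def twice_diff_def by blast

text \<open>Near the diagonal the concave part of the comparison function is a strict supersolution, by an
  amount \<open>\<delta>\<close> that is uniform in time and space. With \<open>\<mu> \<ge> m0 > 0\<close> the ellipticity available at the pair
  \<open>(x,y)\<close> and \<open>k = N \<mu> |x-y|\<close> the variation of \<open>Q\<close>, the generator produces at most
  \<open>K exp(-K|x-y|) (-2\<mu>K + 4nN\<mu> + |r\<^sub>0|R)\<close>. All terms except the drift scale with \<open>\<mu>\<close>, so a large \<open>K\<close> makes
  the bracket at most \<open>-1\<close> even where \<open>\<mu>\<close> is unbounded.\<close>
lemma local_contraction:
  fixes Q :: "real \<Rightarrow> real^'n::finite \<Rightarrow> real^'n^'n"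
  assumes \<eta>0: "0 < \<eta>\<^sub>0" and c0: "0 \<le> c\<^sub>0" and R: "0 < R" and psd: "\<And>t x. 0 \<le> t \<Longrightarrow> psd (Q t x)"
    and comp: "\<And>t x y. 0 \<le> t \<Longrightarrow> \<exists>l\<ge>\<eta>\<^sub>0. (\<forall>v. l * (norm v)\<^sup>2 \<le> v \<bullet> (Q t x *v v))
      \<and> (\<forall>v. exp (- c\<^sub>0 * norm (x - y)) * l * (norm v)\<^sup>2 \<le> v \<bullet> (Q t y *v v))
      \<and> norm (Q t x - Q t y) \<le> c\<^sub>0 * norm (x - y) * exp (c\<^sub>0 * norm (x - y)) * l"
    and lip: "\<And>t x y. 0 \<le> t \<Longrightarrow> (b t x - b t y) \<bullet> (x - y) \<le> r\<^sub>0 * (norm (x - y))\<^sup>2"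
  obtains K \<delta> where "0 < K" "0 < \<delta>"
    "\<And>t f V x y c \<epsilon>. \<lbrakk>0 \<le> t; twice_diff f x; twice_diff f y; twice_diff V x; twice_diff V y;
        x \<noteq> y; norm (x - y) \<le> R; 0 < c;
        \<And>x' y'. f x' - f y' - c * (1 - exp (- K * norm (x' - y')) + \<epsilon> * (V x' + V y'))
              \<le> f x - f y - c * (1 - exp (- K * norm (x - y)) + \<epsilon> * (V x + V y))\<rbrakk> \<Longrightarrow>
      opA Q b t f x - opA Q b t f y \<le> c * (- \<delta> + \<epsilon> * (opA Q b t V x + opA Q b t V y))"
proof -
  define n where "n = real CARD('n)"
  define m0 where "m0 = exp (- c\<^sub>0 * R) * \<eta>\<^sub>0"
  define N where "N = (c\<^sub>0 + 1) * exp (2 * c\<^sub>0 * R)"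
  define K where "K = 2 * n * N + (\<bar>r\<^sub>0\<bar> * R + 1) / (2 * m0)"
  define \<delta> where "\<delta> = K * exp (- K * R)"
  have m0: "m0 > 0" using \<eta>0 by (simp add: m0_def)
  have N: "N \<ge> 0" using c0 by (simp add: N_def)
  have K: "K > 0" unfolding K_def using N R m0 by (intro add_nonneg_pos) (auto simp: n_def intro!: divide_pos_pos add_nonneg_pos)
  have \<delta>: "\<delta> > 0" using K by (simp add: \<delta>_def)
  show ?thesis
  proof (rule that[OF K \<delta>])
    fix t :: real and f V and x y :: "real^'n" and c \<epsilon> :: real
    assume t: "0 \<le> t" and fx: "twice_diff f x" and fy: "twice_diff f y" and Vx: "twice_diff V x" and Vy: "twice_diff V y"
      and xy: "x \<noteq> y" and rR: "norm (x - y) \<le> R" and c: "0 < c"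
      and max: "\<And>x' y'. f x' - f y' - c * (1 - exp (- K * norm (x' - y')) + \<epsilon> * (V x' + V y'))
              \<le> f x - f y - c * (1 - exp (- K * norm (x - y)) + \<epsilon> * (V x + V y))"
    define r where "r = norm (x - y)"
    have r: "0 < r" "r \<le> R" using xy rR by (auto simp: r_def)
    from comp[OF t, of x y, folded r_def] obtain l where l: "\<eta>\<^sub>0 \<le> l" "\<And>v. l * (norm v)\<^sup>2 \<le> v \<bullet> (Q t x *v v)"
      "\<And>v. exp (- c\<^sub>0 * r) * l * (norm v)\<^sup>2 \<le> v \<bullet> (Q t y *v v)"
      "norm (Q t x - Q t y) \<le> c\<^sub>0 * r * exp (c\<^sub>0 * r) * l" by blast
    define \<mu> where "\<mu> = exp (- c\<^sub>0 * R) * l"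
    define k where "k = N * \<mu> * r"
    have lpos: "0 < l" using l(1) \<eta>0 by simp
    have \<mu>0: "m0 \<le> \<mu>" using l(1) by (simp add: m0_def \<mu>_def)
    hence \<mu>pos: "0 < \<mu>" using m0 by simp
    have e1: "exp (- c\<^sub>0 * R) \<le> exp (- c\<^sub>0 * r)" using r c0 by (simp add: mult_left_mono)
    have mx: "\<mu> * (norm v)\<^sup>2 \<le> v \<bullet> (Q t x *v v)" for v
    proof -
      have "\<mu> \<le> 1 * l" unfolding \<mu>_def using c0 R lpos by (intro mult_right_mono) auto
      hence "\<mu> * (norm v)\<^sup>2 \<le> l * (norm v)\<^sup>2" by (intro mult_right_mono) auto
      thus ?thesis using l(2) order_trans by blast
    qed
    have my: "\<mu> * (norm v)\<^sup>2 \<le> v \<bullet> (Q t y *v v)" for v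
    proof -
      have "\<mu> * (norm v)\<^sup>2 \<le> exp (- c\<^sub>0 * r) * l * (norm v)\<^sup>2"
        unfolding \<mu>_def using e1 lpos by (intro mult_right_mono) auto
      thus ?thesis using l(3) order_trans by blast
    qed
    have kk: "k = (c\<^sub>0 + 1) * r * exp (c\<^sub>0 * R) * l"
    proof -
      have "exp (2 * c\<^sub>0 * R) * exp (- c\<^sub>0 * R) = exp (c\<^sub>0 * R)" unfolding exp_add[symmetric] by simp
      thus ?thesis unfolding k_def N_def \<mu>_def by (metis (no_types, lifting) mult.assoc mult.commute)
    qed
    have kpos: "0 < k" unfolding kk using c0 r lpos by simp
    have kn: "norm (Q t x - Q t y) \<le> k"
    proof -
      have "c\<^sub>0 * r * exp (c\<^sub>0 * r) * l \<le> (c\<^sub>0 + 1) * r * exp (c\<^sub>0 * R) * l"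
        using c0 r lpos by (intro mult_right_mono mult_mono) (auto simp: mult_left_mono)
      thus ?thesis using l(4) unfolding kk by linarith
    qed
    define E where "E = exp (- K * r)"
    have E: "E > 0" "exp (- K * R) \<le> E" using r K by (auto simp: E_def)
    have sym: "transpose (Q t x) = Q t x" "transpose (Q t y) = Q t y" using psd[OF t] unfolding psd_def by blast+
    have "opA Q b t f x - opA Q b t f y
      \<le> c * (- 2 * \<mu> * K\<^sup>2 * E + 4 * n * (K * E / r) * k
             + K * E / r * ((b t x - b t y) \<bullet> (x - y)) + \<epsilon> * (opA Q b t V x + opA Q b t V y))"
      using two_point_generator[where f = f and V = V and \<epsilon> = \<epsilon> and b = b and Q = Q and t = t, OF fx fy Vx Vy xy c K max sym \<mu>pos mx my kpos kn]
      unfolding r_def[symmetric] E_def[symmetric] n_def[symmetric] .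
    also have "\<dots> \<le> c * (- \<delta> + \<epsilon> * (opA Q b t V x + opA Q b t V y))"
    proof -
      have "(b t x - b t y) \<bullet> (x - y) \<le> r\<^sub>0 * r\<^sup>2" using lip[OF t] unfolding r_def .
      also have "\<dots> \<le> \<bar>r\<^sub>0\<bar> * (R * r)" unfolding power2_eq_square using r by (intro mult_mono) auto
      finally have "K * E / r * ((b t x - b t y) \<bullet> (x - y)) \<le> K * E / r * (\<bar>r\<^sub>0\<bar> * (R * r))"
        using K E r by (intro mult_left_mono) auto
      also have "\<dots> = K * E * (\<bar>r\<^sub>0\<bar> * R)" using r by simp
      finally have 1: "K * E / r * ((b t x - b t y) \<bullet> (x - y)) \<le> K * E * (\<bar>r\<^sub>0\<bar> * R)" .
      have 2: "4 * n * (K * E / r) * k = K * E * (4 * n * N * \<mu>)" using r by (simp add: k_def)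
      have "- 2 * \<mu> * K + 4 * n * N * \<mu> + \<bar>r\<^sub>0\<bar> * R = \<bar>r\<^sub>0\<bar> * R - \<mu> / m0 * (\<bar>r\<^sub>0\<bar> * R + 1)"
        using m0 by (simp add: K_def field_simps)
      also have "\<dots> \<le> \<bar>r\<^sub>0\<bar> * R - 1 * (\<bar>r\<^sub>0\<bar> * R + 1)"
        using \<mu>0 m0 R by (intro diff_left_mono mult_right_mono) (auto intro!: add_nonneg_nonneg)
      finally have 3: "- 2 * \<mu> * K + 4 * n * N * \<mu> + \<bar>r\<^sub>0\<bar> * R \<le> - 1" by simp
      have "- 2 * \<mu> * K\<^sup>2 * E + 4 * n * (K * E / r) * k + K * E / r * ((b t x - b t y) \<bullet> (x - y))
        \<le> K * E * (- 2 * \<mu> * K + 4 * n * N * \<mu> + \<bar>r\<^sub>0\<bar> * R)"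
        using 1 unfolding 2 by (simp add: algebra_simps power2_eq_square)
      also have "\<dots> \<le> K * E * (- 1)" using 3 K E by (intro mult_left_mono) auto
      also have "\<dots> \<le> - \<delta>" using E K by (simp add: \<delta>_def)
      finally show ?thesis using c by simp
    qed
    finally show "opA Q b t f x - opA Q b t f y \<le> c * (- \<delta> + \<epsilon> * (opA Q b t V x + opA Q b t V y))" .
  qed
qed


section \<open>Bounded solutions and the maximum principle\<close>

lemma D_lincomb:
  assumes "f differentiable (at x)" "g differentiable (at x)"
  shows "D i (\<lambda>x. \<alpha> * f x + \<beta> * g x) x = \<alpha> * D i f x + \<beta> * D i g x"
proof -
  have "((\<lambda>x. \<alpha> * f x + \<beta> * g x) has_derivative
      (\<lambda>h. \<alpha> * frechet_derivative f (at x) h + \<beta> * frechet_derivative g (at x) h)) (at x)"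
    by (intro has_derivative_add has_derivative_mult_right) (use assms in \<open>simp_all add: frechet_derivative_works\<close>)
  from fun_cong[OF frechet_derivative_at[OF this], of "axis i 1"] show ?thesis by (simp add: D_def)
qed

lemma D_lincomb_fun:
  assumes "\<And>x. f differentiable (at x)" "\<And>x. g differentiable (at x)"
  shows "D i (\<lambda>x. \<alpha> * f x + \<beta> * g x) = (\<lambda>x. \<alpha> * D i f x + \<beta> * D i g x)"
  using D_lincomb assms by blast

lemma twice_diff_lincomb:
  assumes f: "twice_diff f x" and g: "twice_diff g x"
  shows "twice_diff (\<lambda>x. \<alpha> * f x + \<beta> * g x) x"
proof -
  have "\<And>x. f differentiable (at x)" "\<And>x. g differentiable (at x)"
    using f g by (auto simp: twice_diff_def)
  thus ?thesis using f g unfolding twice_diff_def D_lincomb_fun[OF \<open>\<And>x. f differentiable (at x)\<close> \<open>\<And>x. g differentiable (at x)\<close>]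
    by (auto intro!: differentiable_add differentiable_mult)
qed

lemma D2_lincomb:
  assumes f: "twice_diff f x" and g: "twice_diff g x"
  shows "D i (D j (\<lambda>x. \<alpha> * f x + \<beta> * g x)) x = \<alpha> * D i (D j f) x + \<beta> * D i (D j g) x"
proof -
  have "\<And>x. f differentiable (at x)" "\<And>x. g differentiable (at x)"
    using f g by (auto simp: twice_diff_def)
  from D_lincomb_fun[OF this] show ?thesis using f g by (simp add: D_lincomb twice_diff_def)
qed

lemma opA_lincomb:
  assumes f: "twice_diff f x" and g: "twice_diff g x"
  shows "opA Q b t (\<lambda>x. \<alpha> * f x + \<beta> * g x) x = \<alpha> * opA Q b t f x + \<beta> * opA Q b t g x"
proof -
  have "f differentiable (at x)" "g differentiable (at x)" using f g by (auto simp: twice_diff_def)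
  thus ?thesis unfolding opA_def D2_lincomb[OF f g]
    by (simp add: D_lincomb sum_distrib_left sum.distrib[symmetric] algebra_simps)
qed

lemma bounded_solution_twice_diff: "bounded_solution Q b s f u \<Longrightarrow> s < t \<Longrightarrow> twice_diff (u t) x"
  unfolding bounded_solution_def C12_def twice_diff_def by blast

lemma bounded_solution_derivative:
  assumes "bounded_solution Q b s f u" "s < t"
  shows "((\<lambda>\<tau>. u \<tau> x) has_real_derivative opA Q b t (u t) x) (at t)"
proof -
  have "(\<lambda>\<tau>. u \<tau> x) differentiable (at t)" "deriv (\<lambda>\<tau>. u \<tau> x) t = opA Q b t (u t) x"
    using assms unfolding bounded_solution_def C12_def by blast+
  thus ?thesis using DERIV_deriv_iff_real_differentiable by metis
qed

lemma bounded_solution_bound: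
  assumes "bounded_solution Q b s f u"
  obtains B where "B \<ge> 0" "\<And>t x. s \<le> t \<Longrightarrow> \<bar>u t x\<bar> \<le> B"
proof -
  from assms have "bounded ((\<lambda>(t, x). u t x) ` ({s..} \<times> UNIV))" unfolding bounded_solution_def by blast
  then obtain B where "\<forall>y\<in>(\<lambda>(t, x). u t x) ` ({s..} \<times> UNIV). norm y \<le> B" unfolding bounded_iff by blast
  hence "\<bar>u t x\<bar> \<le> B" if "s \<le> t" for t x using that by force
  thus ?thesis using that[of "max B 0"] by (meson max.cobounded1 max.cobounded2 order_trans)
qed

lemma bounded_solution_continuous:
  assumes "bounded_solution Q b s f u"
  shows "continuous_on ({s..} \<times> UNIV) (\<lambda>(t, x). u t x)" "s \<le> t \<Longrightarrow> continuous_on UNIV (u t)"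
proof -
  show *: "continuous_on ({s..} \<times> UNIV) (\<lambda>(t, x). u t x)" using assms unfolding bounded_solution_def by blast
  assume "s \<le> t"
  hence "continuous_on UNIV ((\<lambda>(t, x). u t x) \<circ> (\<lambda>x. (t, x)))"
    by (intro continuous_on_compose continuous_intros continuous_on_subset[OF *]) auto
  thus "continuous_on UNIV (u t)" by (simp add: o_def)
qed

lemma bounded_solution_lincomb:
  assumes u: "bounded_solution Q b s f u" and v: "bounded_solution Q b s g v"
  shows "bounded_solution Q b s (\<lambda>x. \<alpha> * f x + \<beta> * g x) (\<lambda>t x. \<alpha> * u t x + \<beta> * v t x)"
proof -
  let ?w = "\<lambda>t x. \<alpha> * u t x + \<beta> * v t x"
  note tu = bounded_solution_twice_diff[OF u] and tv = bounded_solution_twice_diff[OF v]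
  have du: "\<And>t x. s < t \<Longrightarrow> u t differentiable (at x)" and dv: "\<And>t x. s < t \<Longrightarrow> v t differentiable (at x)"
    using tu tv unfolding twice_diff_def by blast+
  have dw: "((\<lambda>\<tau>. ?w \<tau> x) has_real_derivative \<alpha> * opA Q b t (u t) x + \<beta> * opA Q b t (v t) x) (at t)" if "s < t" for t x
    using bounded_solution_derivative[OF u that] bounded_solution_derivative[OF v that]
    by (intro DERIV_add DERIV_cmult)
  have cont: "continuous_on X (\<lambda>(t, x). \<alpha> * F t x + \<beta> * G t x)"
    if "continuous_on X (\<lambda>(t, x). F t x)" "continuous_on X (\<lambda>(t, x). G t x)" for X F G
    using that by (auto intro!: continuous_intros simp: case_prod_unfold)
  have eq1: "D i (?w t) x = \<alpha> * D i (u t) x + \<beta> * D i (v t) x" if "s < t" for t x i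
    using D_lincomb du[OF that] dv[OF that] by blast
  have eq2: "D i (D j (?w t)) x = \<alpha> * D i (D j (u t)) x + \<beta> * D i (D j (v t)) x" if "s < t" for t x i j
    using D2_lincomb tu[OF that] tv[OF that] by blast
  have eq0: "deriv (\<lambda>\<tau>. ?w \<tau> x) t = \<alpha> * deriv (\<lambda>\<tau>. u \<tau> x) t + \<beta> * deriv (\<lambda>\<tau>. v \<tau> x) t" if "s < t" for t x
    using DERIV_imp_deriv[OF dw[OF that]] DERIV_imp_deriv[OF bounded_solution_derivative[OF u that]]
      DERIV_imp_deriv[OF bounded_solution_derivative[OF v that]] by simp
  have C12u: "C12 s u" and C12v: "C12 s v" using u v unfolding bounded_solution_def by blast+
  show ?thesis unfolding bounded_solution_def
  proof (intro conjI allI impI)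
    show "continuous_on ({s..} \<times> UNIV) (\<lambda>(t, x). ?w t x)"
      by (intro cont bounded_solution_continuous(1)[OF u] bounded_solution_continuous(1)[OF v])
    obtain B1 B2 where B: "\<And>t x. s \<le> t \<Longrightarrow> \<bar>u t x\<bar> \<le> B1" "\<And>t x. s \<le> t \<Longrightarrow> \<bar>v t x\<bar> \<le> B2"
      using bounded_solution_bound[OF u] bounded_solution_bound[OF v] by metis
    have "norm (?w t x) \<le> \<bar>\<alpha>\<bar> * B1 + \<bar>\<beta>\<bar> * B2" if "s \<le> t" for t x
      using abs_triangle_ineq[of "\<alpha> * u t x" "\<beta> * v t x"]
        mult_left_mono[OF B(1)[OF that, of x], of "\<bar>\<alpha>\<bar>"] mult_left_mono[OF B(2)[OF that, of x], of "\<bar>\<beta>\<bar>"]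
      by (simp add: abs_mult)
    thus "bounded ((\<lambda>(t, x). ?w t x) ` ({s..} \<times> UNIV))"
      unfolding bounded_iff by (intro exI[of _ "\<bar>\<alpha>\<bar> * B1 + \<bar>\<beta>\<bar> * B2"]) auto
    show "C12 s ?w" unfolding C12_def
    proof (intro conjI allI impI)
      fix t x i assume t: "s < t"
      show "(\<lambda>\<tau>. ?w \<tau> x) differentiable (at t)" using dw[OF t] real_differentiable_def by blast
      show "?w t differentiable (at x)" "D i (?w t) differentiable (at x)"
        using twice_diff_lincomb[OF tu[OF t] tv[OF t]] unfolding twice_diff_def by blast+
    next
      show "continuous_on ({s<..} \<times> UNIV) (\<lambda>(t, x). ?w t x)"
        using C12u C12v unfolding C12_def by (intro cont) blast+
      have "continuous_on ({s<..} \<times> UNIV) (\<lambda>(t, x). \<alpha> * deriv (\<lambda>\<tau>. u \<tau> x) t + \<beta> * deriv (\<lambda>\<tau>. v \<tau> x) t)"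
        using C12u C12v unfolding C12_def by (intro cont) blast+
      thus "continuous_on ({s<..} \<times> UNIV) (\<lambda>(t, x). deriv (\<lambda>\<tau>. ?w \<tau> x) t)"
        by (rule continuous_on_eq) (auto simp: eq0)
      fix i j
      have "continuous_on ({s<..} \<times> UNIV) (\<lambda>(t, x). \<alpha> * D i (u t) x + \<beta> * D i (v t) x)"
        using C12u C12v unfolding C12_def by (intro cont) blast+
      thus "continuous_on ({s<..} \<times> UNIV) (\<lambda>(t, x). D i (?w t) x)"
        by (rule continuous_on_eq) (auto simp: eq1)
      have "continuous_on ({s<..} \<times> UNIV) (\<lambda>(t, x). \<alpha> * D i (D j (u t)) x + \<beta> * D i (D j (v t)) x)"
        using C12u C12v unfolding C12_def by (intro cont) blast+
      thus "continuous_on ({s<..} \<times> UNIV) (\<lambda>(t, x). D i (D j (?w t)) x)"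
        by (rule continuous_on_eq) (auto simp: eq2)
    qed
    show "deriv (\<lambda>\<tau>. ?w \<tau> x) t = opA Q b t (?w t) x" if "s < t" for t x
      using DERIV_imp_deriv[OF dw[OF that]] opA_lincomb[OF tu[OF that] tv[OF that]] by simp
    show "?w s x = \<alpha> * f x + \<beta> * g x" for x using u v unfolding bounded_solution_def by simp
  qed
qed

lemma bounded_solution_const: "bounded_solution Q b s (\<lambda>_. c) (\<lambda>_ _. c)"
proof -
  have D0: "D i (\<lambda>_. c) = (\<lambda>_. 0)" for c :: real and i by (simp add: D_def fun_eq_iff)
  show ?thesis
    by (auto simp: bounded_solution_def C12_def D0 opA_def case_prod_unfold intro: bounded_subset[of "{c}"])
qed

text \<open>At the final time of a space-time maximum only the past is available for comparison.\<close>
lemma derivative_nonneg_at_running_max: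
  fixes \<phi> :: "real \<Rightarrow> real"
  assumes "(\<phi> has_real_derivative l) (at t)" "s < t" "\<And>\<tau>. s \<le> \<tau> \<Longrightarrow> \<tau> \<le> t \<Longrightarrow> \<phi> \<tau> \<le> \<phi> t"
  shows "0 \<le> l"
proof (rule ccontr)
  assume "\<not> 0 \<le> l"
  then obtain d where d: "d > 0" "\<And>h. h > 0 \<Longrightarrow> h < d \<Longrightarrow> \<phi> t < \<phi> (t - h)"
    using DERIV_neg_dec_left[OF assms(1)] by auto
  define h where "h = min d (t - s) / 2"
  have "h > 0" "h < d" "h \<le> t - s" using d(1) assms(2) by (auto simp: h_def)
  thus False using d(2)[of h] assms(3)[of "t - h"] by simp
qed

lemma coercive_sublevel_bounded:
  fixes V :: "real^'n::finite \<Rightarrow> real"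
  assumes "filterlim V at_top at_infinity"
  obtains \<rho> where "\<rho> > 0" "\<And>x. V x \<le> M \<Longrightarrow> norm x \<le> \<rho>"
proof -
  have "\<forall>\<^sub>F x in at_infinity. M < V x" using assms filterlim_at_top_dense by blast
  then obtain \<rho> where "\<And>x. \<rho> \<le> norm x \<Longrightarrow> M < V x" unfolding eventually_at_infinity by blast
  hence "V x \<le> M \<Longrightarrow> norm x \<le> max \<rho> 1" for x by (meson linear max.coboundedI1 not_le)
  thus ?thesis using that[of "max \<rho> 1"] by simp
qed

text \<open>The function \<open>V + (a + 1)(t - s)\<close> is a strict supersolution that tends to infinity in space. Subtracting
  a positive multiple \<open>\<theta>\<close> of it from \<open>u\<close> makes a positive maximum attained, and at such a point the equation
  is violated by at least \<open>\<theta>\<close>. Then \<open>\<theta>\<close> tends to 0.\<close>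
lemma maximum_principle:
  fixes u :: "real \<Rightarrow> real^'n::finite \<Rightarrow> real"
  assumes V: "C2 V" "\<And>x. 0 < V x" "filterlim V at_top at_infinity"
    and a: "0 \<le> a" "0 < \<kappa>" and lyap: "\<And>t x. 0 \<le> t \<Longrightarrow> opA Q b t V x \<le> a - \<kappa> * V x"
    and psd: "\<And>t x. 0 \<le> t \<Longrightarrow> psd (Q t x)" and s: "0 \<le> s"
    and u: "bounded_solution Q b s f u" and f: "\<And>x. f x \<le> 0" and t: "s \<le> t"
  shows "u t x \<le> 0"
proof -
  obtain B where B: "B \<ge> 0" "\<And>t x. s \<le> t \<Longrightarrow> \<bar>u t x\<bar> \<le> B" using bounded_solution_bound[OF u] by blast
  have contV: "continuous_on UNIV V"
    using V(1) unfolding C2_def by (simp add: continuous_at_imp_continuous_on differentiable_imp_continuous_within)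
  have *: "u t x \<le> \<theta> * (V x + (a + 1) * (t - s))" if \<theta>: "\<theta> > 0" for \<theta>
  proof (rule ccontr)
    define \<Phi> where "\<Phi> = (\<lambda>(\<tau>, y). u \<tau> y - \<theta> * (V y + (a + 1) * (\<tau> - s)))"
    assume "\<not> ?thesis"
    hence pos: "\<Phi> (t, x) > 0" by (simp add: \<Phi>_def)
    obtain \<rho> where \<rho>: "\<rho> > 0" "\<And>x. V x \<le> B / \<theta> \<Longrightarrow> norm x \<le> \<rho>" using coercive_sublevel_bounded[OF V(3)] by blast
    have small: "norm y \<le> \<rho>" if "\<Phi> (\<tau>, y) > 0" "s \<le> \<tau>" for \<tau> y
    proof (rule \<rho>(2))
      have "0 \<le> \<theta> * ((a + 1) * (\<tau> - s))" using that(2) \<theta> a by simp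
      hence "\<theta> * V y < B"
        using that(1) B(2)[OF that(2), of y] unfolding \<Phi>_def prod.case distrib_left[of \<theta>] by linarith
      thus "V y \<le> B / \<theta>" using \<theta> by (simp add: field_simps)
    qed
    have "compact ({s..t} \<times> cball (0::real^'n) \<rho>)" by (intro compact_Times) auto
    moreover have mem: "(t, x) \<in> {s..t} \<times> cball 0 \<rho>" using t small[OF pos t] by simp
    moreover have "continuous_on ({s..t} \<times> cball 0 \<rho>) \<Phi>"
    proof -
      have "{s..t} \<times> cball (0::real^'n) \<rho> \<subseteq> {s..} \<times> UNIV" by auto
      from continuous_on_subset[OF bounded_solution_continuous(1)[OF u] this]
      have "continuous_on ({s..t} \<times> cball 0 \<rho>) (\<lambda>p. u (fst p) (snd p))" by (simp add: case_prod_unfold)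
      thus ?thesis unfolding \<Phi>_def case_prod_unfold
        by (intro continuous_intros continuous_on_compose2[OF contV]) auto
    qed
    ultimately obtain p where p: "p \<in> {s..t} \<times> cball 0 \<rho>" "\<And>q. q \<in> {s..t} \<times> cball 0 \<rho> \<Longrightarrow> \<Phi> q \<le> \<Phi> p"
      using continuous_attains_sup[of "{s..t} \<times> cball 0 \<rho>" \<Phi>] by blast
    obtain t1 x1 where p1: "p = (t1, x1)" by (cases p)
    have t1: "s \<le> t1" "t1 \<le> t" using p(1) p1 by auto
    have pos1: "\<Phi> (t1, x1) > 0" using p(2)[OF mem] pos p1 by simp
    have max: "\<Phi> (\<tau>, y) \<le> \<Phi> (t1, x1)" if "s \<le> \<tau>" "\<tau> \<le> t1" for \<tau> y
    proof (cases "\<Phi> (\<tau>, y) > 0")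
      case True
      thus ?thesis using p(2)[of "(\<tau>, y)"] small[OF True that(1)] that t1 p1 by simp
    qed (use pos1 in simp)
    have "t1 \<noteq> s"
    proof
      assume "t1 = s"
      hence "\<Phi> (t1, x1) = f x1 - \<theta> * V x1" using u by (simp add: \<Phi>_def bounded_solution_def)
      thus False using pos1 f[of x1] V(2)[of x1] \<theta> by (smt (verit) mult_pos_pos)
    qed
    hence st1: "s < t1" using t1 by simp
    have "opA Q b t1 (u t1) x1 \<le> \<theta> * opA Q b t1 V x1"
    proof (rule opA_le_of_touching[OF bounded_solution_twice_diff[OF u st1] C2_twice_diff[OF V(1)]])
      show "u t1 y - \<theta> * V y \<le> u t1 x1 - \<theta> * V x1" for y
        using max[of t1 y] t1 by (simp add: \<Phi>_def algebra_simps)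
      show "psd (Q t1 x1)" using psd t1 s by simp
    qed
    also have "\<dots> \<le> \<theta> * a"
    proof (intro mult_left_mono)
      show "opA Q b t1 V x1 \<le> a" using lyap[of t1 x1] t1 s a V(2)[of x1] by (smt (verit) mult_pos_pos)
    qed (use \<theta> in simp)
    finally have 1: "opA Q b t1 (u t1) x1 \<le> \<theta> * a" .
    have "((\<lambda>\<tau>. \<Phi> (\<tau>, x1)) has_real_derivative opA Q b t1 (u t1) x1 - \<theta> * (a + 1)) (at t1)"
      unfolding \<Phi>_def prod.case
      by (rule derivative_eq_intros bounded_solution_derivative[OF u st1] refl | simp)+
    from derivative_nonneg_at_running_max[OF this st1] max
    have "0 \<le> opA Q b t1 (u t1) x1 - \<theta> * (a + 1)" by simp
    thus False using 1 \<theta> by (simp add: algebra_simps)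
  qed
  define C where "C = V x + (a + 1) * (t - s)"
  have C: "C > 0" unfolding C_def using V(2)[of x] a t by (intro add_pos_nonneg) auto
  show ?thesis
  proof (rule ccontr)
    assume "\<not> ?thesis"
    hence "u t x > 0" by simp
    thus False using *[of "u t x / (2 * C)", folded C_def] C by (simp add: field_simps)
  qed
qed


section \<open>Exponential decay of oscillations\<close>

lemma C2_continuous: "C2 V \<Longrightarrow> continuous_on A V"
  unfolding C2_def by (meson continuous_at_imp_continuous_on differentiable_imp_continuous_within)

lemma coercive_bounded_below:
  fixes V :: "real^'n::finite \<Rightarrow> real"
  assumes "continuous_on UNIV V" "\<And>x. 0 < V x" "filterlim V at_top at_infinity"
  obtains v where "v > 0" "\<And>x. v \<le> V x"
proof -
  obtain \<rho> where \<rho>: "\<rho> > 0" "\<And>x. V x \<le> V 0 \<Longrightarrow> norm x \<le> \<rho>"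
    using coercive_sublevel_bounded[OF assms(3)] by blast
  have "\<exists>x\<in>cball 0 \<rho>. \<forall>y\<in>cball 0 \<rho>. V x \<le> V y"
    by (rule continuous_attains_inf) (use \<rho> continuous_on_subset[OF assms(1)] in auto)
  then obtain x where "\<forall>y\<in>cball 0 \<rho>. V x \<le> V y" by blast
  hence x: "\<And>y. norm y \<le> \<rho> \<Longrightarrow> V x \<le> V y" by simp
  have "V x \<le> V y" for y
  proof (cases "norm y \<le> \<rho>")
    case False
    hence "V 0 < V y" using \<rho>(2) by (meson not_le)
    thus ?thesis using x[of 0] \<rho>(1) by simp
  qed (rule x)
  thus ?thesis using that assms(2) by blast
qed

lemma opA_uminus: "twice_diff f x \<Longrightarrow> opA Q b t (\<lambda>x. - f x) x = - opA Q b t f x"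
  using opA_lincomb[of f x f Q b t "-1" 0] by simp

lemma twice_diff_uminus: "twice_diff f x \<Longrightarrow> twice_diff (\<lambda>x. - f x) x"
  using twice_diff_lincomb[of f x f "-1" 0] by simp

text \<open>The choice of constants follows the order of dependence. The level \<open>M\<close> is where the Lyapunov
  inequality turns into decay at rate \<open>\<kappa>/2\<close>, and \<open>R\<close> is a distance beyond which \<open>V x + V y \<ge> M\<close>. This \<open>R\<close>
  determines \<open>K\<close> and the gain \<open>\<delta>\<close> of \<open>local_contraction\<close>; \<open>\<epsilon>\<close> is so small that the growth \<open>2\<epsilon>a\<close> of the
  Lyapunov part costs at most half of \<open>\<delta>\<close>, and the rate \<open>l\<close> is a fraction of what remains in either regime.
  The minimum in \<open>W\<close> is not differentiable, but a function that lies below a minimum and touches it also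
  touches from below whichever of the two smooth functions is active there.\<close>
lemma oscillation_decay:
  fixes Q :: "real \<Rightarrow> real^'n::finite \<Rightarrow> real^'n^'n"
  assumes "standing_assumptions Q b" and s: "0 \<le> s" and u: "bounded_solution Q b s f u"
  shows "\<exists>C V l. 0 < l \<and> continuous_on UNIV V \<and>
     (\<forall>t\<ge>s. \<forall>x y. u t x - u t y \<le> C * exp (- l * (t - s)) * (1 + V x + V y))"
proof -
  obtain V a \<kappa> \<eta>\<^sub>0 c\<^sub>0 r\<^sub>0 where V: "C2 V" "\<And>x. 0 < V x" "filterlim V at_top at_infinity"
    and a: "0 \<le> a" "0 < \<kappa>" and lyap: "\<And>t x. 0 \<le> t \<Longrightarrow> opA Q b t V x \<le> a - \<kappa> * V x"
    and coef: "0 < \<eta>\<^sub>0" "0 \<le> c\<^sub>0" and psd: "\<And>t x. 0 \<le> t \<Longrightarrow> psd (Q t x)"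
    and comp: "\<And>t x y. 0 \<le> t \<Longrightarrow> \<exists>l\<ge>\<eta>\<^sub>0. (\<forall>v. l * (norm v)\<^sup>2 \<le> v \<bullet> (Q t x *v v))
      \<and> (\<forall>v. exp (- c\<^sub>0 * norm (x - y)) * l * (norm v)\<^sup>2 \<le> v \<bullet> (Q t y *v v))
      \<and> norm (Q t x - Q t y) \<le> c\<^sub>0 * norm (x - y) * exp (c\<^sub>0 * norm (x - y)) * l"
    and lip: "\<And>t x y. 0 \<le> t \<Longrightarrow> (b t x - b t y) \<bullet> (x - y) \<le> r\<^sub>0 * (norm (x - y))\<^sup>2"
    by (rule standing_assumptions_constants[OF assms(1)]; rule that; assumption)
  have contV: "continuous_on A V" for A using V(1) by (rule C2_continuous)
  note tV = C2_twice_diff[OF V(1)]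
  obtain v where v: "v > 0" "\<And>x. v \<le> V x" using coercive_bounded_below[OF contV V(2,3)] by blast
  obtain B where B: "B \<ge> 0" "\<And>t x. s \<le> t \<Longrightarrow> \<bar>u t x\<bar> \<le> B" using bounded_solution_bound[OF u] by blast
  \<comment> \<open>Because of the lower bound 1, the Lyapunov decay \<open>\<epsilon> \<kappa> M / 2\<close> also absorbs \<open>l\<close> times the bounded part of \<open>W\<close>.\<close>
  define M where "M = max 1 (4 * a / \<kappa>)"
  obtain \<rho> where \<rho>: "\<rho> > 0" "\<And>x. V x \<le> M \<Longrightarrow> norm x \<le> \<rho>" using coercive_sublevel_bounded[OF V(3)] by blast
  define R where "R = 2 * \<rho> + 1"
  have R: "0 < R" using \<rho> by (simp add: R_def)
  have far: "M \<le> V x + V y" if "R \<le> norm (x - y)" for x y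
  proof (rule ccontr)
    assume "\<not> ?thesis"
    hence "V x \<le> M" "V y \<le> M" using V(2)[of x] V(2)[of y] by linarith+
    hence "norm x \<le> \<rho>" "norm y \<le> \<rho>" using \<rho>(2) by auto
    thus False using that norm_triangle_ineq4[of x y] by (simp add: R_def)
  qed
  obtain K \<delta> where K: "0 < K" "0 < \<delta>"
    and near: "\<And>t f V x y c \<epsilon>. 0 \<le> t \<Longrightarrow> twice_diff f x \<Longrightarrow> twice_diff f y \<Longrightarrow> twice_diff V x \<Longrightarrow> twice_diff V y \<Longrightarrow>
      x \<noteq> y \<Longrightarrow> norm (x - y) \<le> R \<Longrightarrow> 0 < c \<Longrightarrow>
     (\<And>x' y'. f x' - f y' - c * (1 - exp (- K * norm (x' - y')) + \<epsilon> * (V x' + V y'))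
              \<le> f x - f y - c * (1 - exp (- K * norm (x - y)) + \<epsilon> * (V x + V y))) \<Longrightarrow>
     opA Q b t f x - opA Q b t f y \<le> c * (- \<delta> + \<epsilon> * (opA Q b t V x + opA Q b t V y))"
    apply (rule local_contraction[where Q = Q and b = b, OF coef R psd comp lip])
       apply assumption+
    subgoal premises p by (rule p(1)[OF p(2,3)]; rule p(4); assumption)
    done
  define \<epsilon> where "\<epsilon> = \<delta> / (4 * (a + 1))"
  have \<epsilon>: "0 < \<epsilon>" using K a by (simp add: \<epsilon>_def)
  have \<epsilon>a: "2 * \<epsilon> * a \<le> \<delta> / 2" using K a by (simp add: \<epsilon>_def field_simps)
  define l where "l = min (\<delta> / 4) (min (\<kappa> / 8) (\<epsilon> * \<kappa> / 8))"
  have l: "0 < l" "l \<le> \<delta> / 4" "l \<le> \<kappa> / 8" "l \<le> \<epsilon> * \<kappa> / 8" using K a \<epsilon> by (auto simp: l_def)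
  define m where "m = 1 - exp (- K * R)"
  have m: "0 \<le> m" "m \<le> 1" using K R by (auto simp: m_def)
  define W where "W x y = min (1 - exp (- K * norm (x - y))) m + \<epsilon> * (V x + V y)" for x y
  have psi0: "0 \<le> 1 - exp (- K * norm z)" for z :: "real^'n" using K by simp
  have W_low: "\<epsilon> * (V x + V y) \<le> W x y" and W_up: "W x y \<le> 1 + \<epsilon> * (V x + V y)" for x y
    using psi0[of "x - y"] m unfolding W_def by auto
  have W_pos: "0 < W x y" for x y
  proof -
    have "0 < \<epsilon> * (V x + V y)" by (rule mult_pos_pos[OF \<epsilon> add_pos_pos[OF V(2) V(2)]])
    thus ?thesis using W_low[of x y] by linarith
  qed
  \<comment> \<open>Chosen so that \<open>C W\<close> exceeds every possible initial difference of \<open>u\<close>.\<close>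
  define C where "C = (B + 1) / (\<epsilon> * v)"
  have C: "0 < C" using B \<epsilon> v by (simp add: C_def)
  have CW: "2 * B < C * W x y" for x y
  proof -
    have "2 * B < C * (\<epsilon> * (v + v))" using \<epsilon> v by (simp add: C_def field_simps)
    also have "\<dots> \<le> C * (\<epsilon> * (V x + V y))" using v \<epsilon> C by (intro mult_left_mono add_mono) auto
    also have "\<dots> \<le> C * W x y" using W_low C by (intro mult_left_mono) auto
    finally show ?thesis .
  qed
  have main: "u t x - u t y \<le> C * exp (- l * (t - s)) * W x y" if t: "s \<le> t" for t x y
  proof (rule ccontr)
    define \<Phi> where "\<Phi> = (\<lambda>(\<tau>, x, y). u \<tau> x - u \<tau> y - C * exp (- l * (\<tau> - s)) * W x y)"
    assume "\<not> ?thesis"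
    hence pos: "\<Phi> (t, x, y) > 0" by (simp add: \<Phi>_def)
    \<comment> \<open>The smallest value of the time factor on \<open>[s,t]\<close>; it confines a violation to a bounded set.\<close>
    define cT where "cT = C * exp (- l * (t - s))"
    have cT: "0 < cT" using C by (simp add: cT_def)
    obtain \<sigma> where \<sigma>: "\<sigma> > 0" "\<And>x. V x \<le> 2 * B / (cT * \<epsilon>) \<Longrightarrow> norm x \<le> \<sigma>"
      using coercive_sublevel_bounded[OF V(3)] by blast
    have small: "norm x \<le> \<sigma> \<and> norm y \<le> \<sigma>" if "\<Phi> (\<tau>, x, y) > 0" "s \<le> \<tau>" "\<tau> \<le> t" for \<tau> x y
    proof -
      have "cT \<le> C * exp (- l * (\<tau> - s))" using C l that by (simp add: cT_def)
      hence "cT * W x y \<le> C * exp (- l * (\<tau> - s)) * W x y" by (intro mult_right_mono less_imp_le[OF W_pos])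
      also have "\<dots> \<le> 2 * B" using that(1) B(2)[OF that(2), of x] B(2)[OF that(2), of y] by (simp add: \<Phi>_def)
      finally have "cT * W x y \<le> 2 * B" .
      moreover have "cT * (\<epsilon> * (V x + V y)) \<le> cT * W x y" using W_low cT by (intro mult_left_mono) auto
      ultimately have "cT * (\<epsilon> * (V x + V y)) \<le> 2 * B" by linarith
      hence "V x + V y \<le> 2 * B / (cT * \<epsilon>)" using cT \<epsilon> by (simp add: field_simps)
      hence "V x \<le> 2 * B / (cT * \<epsilon>)" "V y \<le> 2 * B / (cT * \<epsilon>)" using V(2)[of x] V(2)[of y] by linarith+
      thus ?thesis using \<sigma>(2) by blast
    qed
    let ?S = "{s..t} \<times> cball (0::real^'n) \<sigma> \<times> cball (0::real^'n) \<sigma>"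
    have "compact ?S" by (intro compact_Times) auto
    moreover have mem: "(t, x, y) \<in> ?S" using t small[OF pos t] by simp
    moreover have "continuous_on ?S \<Phi>"
    proof -
      have cu: "continuous_on ({s..} \<times> UNIV) (\<lambda>p. u (fst p) (snd p))"
        using bounded_solution_continuous(1)[OF u] by (simp add: case_prod_unfold)
      have "continuous_on ?S (\<lambda>p. u (fst p) (fst (snd p)))" "continuous_on ?S (\<lambda>p. u (fst p) (snd (snd p)))"
        by (rule continuous_on_compose2[OF cu, where f = "\<lambda>p. (fst p, fst (snd p))", simplified]
             continuous_on_compose2[OF cu, where f = "\<lambda>p. (fst p, snd (snd p))", simplified];
            auto intro!: continuous_intros)+
      thus ?thesis unfolding \<Phi>_def case_prod_unfold W_def
        by (intro continuous_intros continuous_on_compose2[OF contV]) auto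
    qed
    ultimately obtain p where p: "p \<in> ?S" "\<And>q. q \<in> ?S \<Longrightarrow> \<Phi> q \<le> \<Phi> p"
      using continuous_attains_sup[of ?S \<Phi>] by blast
    obtain t1 x1 y1 where p1: "p = (t1, x1, y1)" by (cases p)
    have t1: "s \<le> t1" "t1 \<le> t" using p(1) p1 by auto
    have pos1: "\<Phi> (t1, x1, y1) > 0" using p(2)[OF mem] pos p1 by simp
    have max: "\<Phi> (\<tau>, x', y') \<le> \<Phi> (t1, x1, y1)" if "s \<le> \<tau>" "\<tau> \<le> t1" for \<tau> x' y'
    proof (cases "\<Phi> (\<tau>, x', y') > 0")
      case True
      thus ?thesis using p(2)[of "(\<tau>, x', y')"] small[OF True that(1)] that t1 p1 by simp
    qed (use pos1 in simp)
    have "t1 \<noteq> s"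
    proof
      assume "t1 = s"
      hence "\<Phi> (t1, x1, y1) = u s x1 - u s y1 - C * W x1 y1" by (simp add: \<Phi>_def)
      thus False using pos1 CW[of x1 y1] B(2)[of s x1] B(2)[of s y1] by auto
    qed
    hence st1: "s < t1" and t10: "0 \<le> t1" using t1 s by auto
    define c where "c = C * exp (- l * (t1 - s))"
    have c: "0 < c" using C by (simp add: c_def)
    have xy1: "x1 \<noteq> y1"
    proof
      assume "x1 = y1"
      hence "\<Phi> (t1, x1, y1) = - (c * W x1 y1)" by (simp add: \<Phi>_def c_def)
      thus False using pos1 mult_pos_pos[OF c W_pos[of x1 y1]] by linarith
    qed
    note tu = bounded_solution_twice_diff[OF u st1]
    define S where "S = V x1 + V y1"
    have S: "0 < S" using V(2)[of x1] V(2)[of y1] by (simp add: S_def)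
    have max1: "u t1 x' - u t1 y' - c * W x' y' \<le> u t1 x1 - u t1 y1 - c * W x1 y1" for x' y'
      using max[of t1 x' y'] t1 by (simp add: \<Phi>_def c_def)
    have AV: "opA Q b t1 V x1 + opA Q b t1 V y1 \<le> 2 * a - \<kappa> * S"
      using lyap[OF t10, of x1] lyap[OF t10, of y1] by (simp add: S_def algebra_simps)
    have "opA Q b t1 (u t1) x1 - opA Q b t1 (u t1) y1 < - (c * (l * W x1 y1))"
    proof (cases "norm (x1 - y1) < R")
      case True
      have "opA Q b t1 (u t1) x1 - opA Q b t1 (u t1) y1 \<le> c * (- \<delta> + \<epsilon> * (opA Q b t1 V x1 + opA Q b t1 V y1))"
      proof (rule near[OF t10 tu tu tV tV xy1 _ c])
        show "norm (x1 - y1) \<le> R" using True by simp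
        fix x' y'
        have "W x' y' \<le> 1 - exp (- K * norm (x' - y')) + \<epsilon> * (V x' + V y')" by (simp add: W_def)
        hence "c * W x' y' \<le> c * (1 - exp (- K * norm (x' - y')) + \<epsilon> * (V x' + V y'))"
          using c by (intro mult_left_mono) auto
        moreover have Weq: "W x1 y1 = 1 - exp (- K * norm (x1 - y1)) + \<epsilon> * (V x1 + V y1)"
          using True K by (simp add: W_def m_def min_def)
        ultimately show "u t1 x' - u t1 y' - c * (1 - exp (- K * norm (x' - y')) + \<epsilon> * (V x' + V y'))
              \<le> u t1 x1 - u t1 y1 - c * (1 - exp (- K * norm (x1 - y1)) + \<epsilon> * (V x1 + V y1))"
          using max1[of x' y'] unfolding Weq by linarith
      qed
      also have "\<dots> < c * (- (l * W x1 y1))"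
      proof (rule mult_strict_left_mono[OF _ c])
        have "\<epsilon> * (opA Q b t1 V x1 + opA Q b t1 V y1) \<le> \<epsilon> * (2 * a - \<kappa> * S)"
          using AV \<epsilon> by (intro mult_left_mono) auto
        moreover have "l * W x1 y1 \<le> l * (1 + \<epsilon> * S)" using W_up[of x1 y1] l(1) by (intro mult_left_mono) (auto simp: S_def)
        moreover have "l * (\<epsilon> * S) \<le> \<kappa> / 8 * (\<epsilon> * S)" using l \<epsilon> S by (intro mult_right_mono) auto
        moreover have "0 < \<kappa> * (\<epsilon> * S)" using a \<epsilon> S by simp
        ultimately show "- \<delta> + \<epsilon> * (opA Q b t1 V x1 + opA Q b t1 V y1) < - (l * W x1 y1)"
          using \<epsilon>a l(2) K(2) by (simp add: algebra_simps)
      qed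
      finally show ?thesis by simp
    next
      case False
      hence SM: "M \<le> S" using far by (simp add: S_def)
      have Weq: "W x1 y1 = m + \<epsilon> * (V x1 + V y1)" using False K by (simp add: W_def m_def min_def)
      have Wle: "W x' y' \<le> m + \<epsilon> * (V x' + V y')" for x' y' by (simp add: W_def)
      have touch: "u t1 x' - u t1 y' - c * (m + \<epsilon> * (V x' + V y')) \<le> u t1 x1 - u t1 y1 - c * (m + \<epsilon> * (V x1 + V y1))" for x' y'
        using max1[of x' y'] mult_left_mono[OF Wle[of x' y'], of c] c unfolding Weq by linarith
      have "opA Q b t1 (u t1) x1 \<le> (c * \<epsilon>) * opA Q b t1 V x1"
        by (rule opA_le_of_touching[where Q = Q and t = t1, OF tu tV _ psd[OF t10]])
          (use touch[of _ y1] in \<open>simp add: algebra_simps\<close>)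
      moreover have "opA Q b t1 (\<lambda>x. - u t1 x) y1 \<le> (c * \<epsilon>) * opA Q b t1 V y1"
        by (rule opA_le_of_touching[where Q = Q and t = t1, OF twice_diff_uminus[OF tu] tV _ psd[OF t10]])
          (use touch[of x1] in \<open>simp add: algebra_simps\<close>)
      ultimately have "opA Q b t1 (u t1) x1 - opA Q b t1 (u t1) y1 \<le> c * (\<epsilon> * (opA Q b t1 V x1 + opA Q b t1 V y1))"
        unfolding opA_uminus[OF tu] by (simp add: algebra_simps)
      also have "\<dots> < c * (- (l * W x1 y1))"
      proof (rule mult_strict_left_mono[OF _ c])
        have "\<epsilon> * (opA Q b t1 V x1 + opA Q b t1 V y1) \<le> \<epsilon> * (2 * a - \<kappa> * S)"
          using AV \<epsilon> by (intro mult_left_mono) auto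
        moreover have "l * W x1 y1 \<le> l * (1 + \<epsilon> * S)" using W_up[of x1 y1] l(1) by (intro mult_left_mono) (auto simp: S_def)
        moreover have "l * (\<epsilon> * S) \<le> \<kappa> / 8 * (\<epsilon> * S)" using l \<epsilon> S by (intro mult_right_mono) auto
        moreover have "l * 1 \<le> \<epsilon> * \<kappa> / 8 * S"
          using l \<epsilon> a SM by (intro mult_mono) (auto simp: M_def)
        moreover have "\<epsilon> * (2 * a) \<le> \<epsilon> * (\<kappa> * S / 2)"
        proof (rule mult_left_mono)
          have "4 * a / \<kappa> \<le> S" using SM by (simp add: M_def)
          thus "2 * a \<le> \<kappa> * S / 2" using a by (simp add: field_simps)
        qed (use \<epsilon> in simp)
        moreover have "0 < \<kappa> * (\<epsilon> * S)" using a \<epsilon> S by simp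
        ultimately show "\<epsilon> * (opA Q b t1 V x1 + opA Q b t1 V y1) < - (l * W x1 y1)"
          by (simp add: algebra_simps)
      qed
      finally show ?thesis by simp
    qed
    moreover have "((\<lambda>\<tau>. \<Phi> (\<tau>, x1, y1)) has_real_derivative
        opA Q b t1 (u t1) x1 - opA Q b t1 (u t1) y1 + c * (l * W x1 y1)) (at t1)"
    proof -
      have "((\<lambda>\<tau>. C * exp (- l * (\<tau> - s)) * W x1 y1) has_real_derivative - (c * (l * W x1 y1))) (at t1)"
        by (rule derivative_eq_intros refl | simp add: c_def)+
      from DERIV_diff[OF DERIV_diff[OF bounded_solution_derivative[OF u st1, of x1] bounded_solution_derivative[OF u st1, of y1]] this]
      show ?thesis by (simp add: \<Phi>_def)
    qed
    from derivative_nonneg_at_running_max[OF this st1] max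
    have "0 \<le> opA Q b t1 (u t1) x1 - opA Q b t1 (u t1) y1 + c * (l * W x1 y1)" by simp
    ultimately show False by linarith
  qed
  have "u t x - u t y \<le> C * exp (- l * (t - s)) * (1 + \<epsilon> * V x + \<epsilon> * V y)" if "s \<le> t" for t x y
  proof -
    have "C * exp (- l * (t - s)) * W x y \<le> C * exp (- l * (t - s)) * (1 + \<epsilon> * V x + \<epsilon> * V y)"
      using W_up[of x y] C by (intro mult_left_mono) (auto simp: algebra_simps)
    thus ?thesis using main[OF that, of x y] by linarith
  qed
  thus ?thesis using l(1) contV
    by (intro exI[of _ C] exI[of _ "\<lambda>x. \<epsilon> * V x"] exI[of _ l]) (auto intro!: continuous_intros)
qed


section \<open>Moments of order p and completeness\<close>

text \<open>Jensen's inequality is used twice, for a measure and for the evolution operator. In both cases it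
  follows from positivity, linearity and the value on constants, once the supporting line is taken at
  the right point \<open>c\<close>.\<close>
lemma powr_abs_tangent:
  fixes p c :: real
  assumes p: "1 \<le> p"
  obtains \<alpha> \<beta> where "\<And>y. \<alpha> + \<beta> * y \<le> \<bar>y\<bar> powr p" "\<alpha> + \<beta> * c = \<bar>c\<bar> powr p"
proof -
  have pos: "c powr p + p * c powr (p - 1) * (y - c) \<le> \<bar>y\<bar> powr p" if c: "0 < c" for c y :: real
  proof (cases "0 < y")
    case True
    have "((\<lambda>x. x powr p) has_real_derivative p * c powr (p - 1)) (at c within {0<..})"
      by (rule has_field_derivative_at_within[OF has_real_derivative_powr[OF c]])
    from convex_on_imp_above_tangent[OF powr_convex[OF p] _ _ _ this] c True
    have "p * c powr (p - 1) * (y - c) \<le> y powr p - c powr p" by (auto simp: interior_open)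
    thus ?thesis using True by simp
  next
    case False
    have "c powr p + p * c powr (p - 1) * (y - c) \<le> c powr p + p * c powr (p - 1) * (- c)"
      using False p by (intro add_left_mono mult_left_mono) auto
    also have "\<dots> = (1 - p) * c powr p" using c by (simp add: powr_diff field_simps)
    also have "\<dots> \<le> 0" using p by (simp add: mult_nonpos_nonneg)
    finally show ?thesis using powr_ge_zero[of "\<bar>y\<bar>" p] by linarith
  qed
  consider "0 < c" | "c = 0" | "0 < - c" by linarith
  thus ?thesis
  proof cases
    case 1
    show ?thesis
      by (rule that[of "c powr p - p * c powr (p - 1) * c" "p * c powr (p - 1)"])
        (use pos[OF 1] 1 in \<open>simp_all add: algebra_simps\<close>)
  next
    case 2
    show ?thesis by (rule that[of 0 0]) (use 2 in simp_all)
  next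
    case 3
    show ?thesis
    proof (rule that[of "(- c) powr p - p * (- c) powr (p - 1) * (- c)" "- (p * (- c) powr (p - 1))"])
      show "(- c) powr p - p * (- c) powr (p - 1) * (- c) + - (p * (- c) powr (p - 1)) * y \<le> \<bar>y\<bar> powr p" for y
        using pos[OF 3, of "- y"] by (simp add: algebra_simps)
    qed (use 3 in \<open>simp add: algebra_simps\<close>)
  qed
qed

text \<open>A quasi-triangle inequality for \<open>|y|\<^sup>p\<close>. All convergence arguments below tolerate the factor \<open>2\<^sup>p\<close>, so
  Minkowski's inequality can be avoided by working with \<open>p\<close>-th powers of norms.\<close>
lemma powr_abs_add_le:
  fixes p a b :: real
  assumes p: "1 \<le> p"
  shows "\<bar>a + b\<bar> powr p \<le> 2 powr p * (\<bar>a\<bar> powr p + \<bar>b\<bar> powr p)"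
proof -
  have "\<bar>a + b\<bar> powr p \<le> (2 * max \<bar>a\<bar> \<bar>b\<bar>) powr p" using p by (intro powr_mono2) auto
  also have "\<dots> = 2 powr p * (max \<bar>a\<bar> \<bar>b\<bar>) powr p" by (simp add: powr_mult)
  also have "(max \<bar>a\<bar> \<bar>b\<bar>) powr p \<le> \<bar>a\<bar> powr p + \<bar>b\<bar> powr p" by (auto simp: max_def)
  finally show ?thesis by simp
qed

definition pth_moment :: "real \<Rightarrow> 'a measure \<Rightarrow> ('a \<Rightarrow> real) \<Rightarrow> real" where
  "pth_moment p M f = (\<integral>x. \<bar>f x\<bar> powr p \<partial>M)"

lemma pth_moment_nonneg: "0 \<le> pth_moment p M f"
  unfolding pth_moment_def by simp

lemma Lp_norm_tendsto_0_iff: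
  assumes p: "1 \<le> p"
  shows "((\<lambda>i. Lp_norm p (M i) (f i)) \<longlongrightarrow> 0) F \<longleftrightarrow> ((\<lambda>i. pth_moment p (M i) (f i)) \<longlongrightarrow> 0) F"
proof
  assume "((\<lambda>i. Lp_norm p (M i) (f i)) \<longlongrightarrow> 0) F"
  hence "((\<lambda>i. Lp_norm p (M i) (f i) powr p) \<longlongrightarrow> 0 powr p) F"
    using p by (intro tendsto_powr' tendsto_const) (auto simp: Lp_norm_def)
  moreover have "Lp_norm p (M i) (f i) powr p = pth_moment p (M i) (f i)" for i
    using p pth_moment_nonneg[of p "M i" "f i"] by (simp add: Lp_norm_def pth_moment_def powr_powr)
  ultimately show "((\<lambda>i. pth_moment p (M i) (f i)) \<longlongrightarrow> 0) F" by simp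
next
  assume "((\<lambda>i. pth_moment p (M i) (f i)) \<longlongrightarrow> 0) F"
  hence "((\<lambda>i. pth_moment p (M i) (f i) powr (1 / p)) \<longlongrightarrow> 0 powr (1 / p)) F"
    using p by (intro tendsto_powr' tendsto_const) (auto simp: pth_moment_nonneg)
  thus "((\<lambda>i. Lp_norm p (M i) (f i)) \<longlongrightarrow> 0) F" by (simp add: Lp_norm_def pth_moment_def)
qed

lemma Lp_fun_add:
  assumes p: "1 \<le> p" and f: "Lp_fun p M f" and g: "Lp_fun p M g"
  shows "Lp_fun p M (\<lambda>x. f x + g x)"
    and "pth_moment p M (\<lambda>x. f x + g x) \<le> 2 powr p * (pth_moment p M f + pth_moment p M g)"
proof -
  have m[measurable]: "f \<in> borel_measurable M" "g \<in> borel_measurable M"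
    and i: "integrable M (\<lambda>x. \<bar>f x\<bar> powr p)" "integrable M (\<lambda>x. \<bar>g x\<bar> powr p)"
    using f g unfolding Lp_fun_def by auto
  have i2: "integrable M (\<lambda>x. 2 powr p * (\<bar>f x\<bar> powr p + \<bar>g x\<bar> powr p))" using i by simp
  have i3: "integrable M (\<lambda>x. \<bar>f x + g x\<bar> powr p)"
    by (rule Bochner_Integration.integrable_bound[OF i2]) (use powr_abs_add_le[OF p] in \<open>auto simp: abs_mult\<close>)
  show "Lp_fun p M (\<lambda>x. f x + g x)" unfolding Lp_fun_def using i3 by simp
  have "pth_moment p M (\<lambda>x. f x + g x) \<le> (\<integral>x. 2 powr p * (\<bar>f x\<bar> powr p + \<bar>g x\<bar> powr p) \<partial>M)"
    unfolding pth_moment_def by (rule integral_mono[OF i3 i2 powr_abs_add_le[OF p]])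
  thus "pth_moment p M (\<lambda>x. f x + g x) \<le> 2 powr p * (pth_moment p M f + pth_moment p M g)"
    using i by (simp add: pth_moment_def)
qed

lemma Lp_fun_minus: "Lp_fun p M (\<lambda>x. - f x) \<longleftrightarrow> Lp_fun p M f"
  unfolding Lp_fun_def by simp

lemma pth_moment_minus_commute: "pth_moment p M (\<lambda>x. f x - g x) = pth_moment p M (\<lambda>x. g x - f x)"
  unfolding pth_moment_def by (simp add: abs_minus_commute)

lemma Lp_fun_diff:
  assumes p: "1 \<le> p" and f: "Lp_fun p M f" and g: "Lp_fun p M g"
  shows "Lp_fun p M (\<lambda>x. f x - g x)"
  using Lp_fun_add(1)[OF p f, of "\<lambda>x. - g x"] g by (simp add: Lp_fun_minus)

lemma pth_moment_triangle:
  assumes p: "1 \<le> p" and f: "Lp_fun p M f" and g: "Lp_fun p M g" and h: "Lp_fun p M h"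
  shows "pth_moment p M (\<lambda>x. f x - h x) \<le> 2 powr p * (pth_moment p M (\<lambda>x. f x - g x) + pth_moment p M (\<lambda>x. g x - h x))"
  using Lp_fun_add(2)[OF p Lp_fun_diff[OF p f g] Lp_fun_diff[OF p g h]] by simp

lemma Lp_fun_bounded:
  assumes "prob_space M" and "f \<in> borel_measurable M" and "\<And>x. \<bar>f x\<bar> \<le> B" and p: "1 \<le> p"
  shows "Lp_fun p M f" "integrable M f"
proof -
  interpret prob_space M by fact
  show "integrable M f" by (rule integrable_const_bound[of _ B]) (use assms in auto)
  have "integrable M (\<lambda>x. \<bar>f x\<bar> powr p)"
    by (rule integrable_const_bound[of _ "B powr p"]) (use assms in \<open>auto intro!: powr_mono2\<close>)
  thus "Lp_fun p M f" using assms by (simp add: Lp_fun_def)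
qed

lemma Lp_fun_integrable:
  assumes "prob_space M" and p: "1 \<le> p" and f: "Lp_fun p M f"
  shows "integrable M f"
proof -
  interpret prob_space M by fact
  have "\<bar>y\<bar> \<le> 1 + \<bar>y\<bar> powr p" for y :: real
  proof (cases "\<bar>y\<bar> \<le> 1")
    case False
    hence "\<bar>y\<bar> powr 1 \<le> \<bar>y\<bar> powr p" using p by (intro powr_mono) auto
    thus ?thesis using False by simp
  qed (use powr_ge_zero[of "\<bar>y\<bar>" p] in linarith)
  hence *: "\<bar>f x\<bar> \<le> \<bar>1 + \<bar>f x\<bar> powr p\<bar>" for x by (meson abs_ge_self order_trans)
  have i: "integrable M (\<lambda>x. 1 + \<bar>f x\<bar> powr p)" using f by (simp add: Lp_fun_def)
  show ?thesis
    by (rule Bochner_Integration.integrable_bound[OF i]) (use f * in \<open>auto simp: Lp_fun_def\<close>)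
qed

lemma integral_powr_le_pth_moment:
  assumes "prob_space M" and p: "1 \<le> p" and f: "Lp_fun p M f"
  shows "\<bar>\<integral>x. f x \<partial>M\<bar> powr p \<le> pth_moment p M f" "(\<integral>x. \<bar>f x\<bar> \<partial>M) powr p \<le> pth_moment p M f"
proof -
  interpret prob_space M by fact
  have *: "\<bar>\<integral>x. f x \<partial>M\<bar> powr p \<le> pth_moment p M f" if f: "Lp_fun p M f" for f
  proof -
    obtain \<alpha> \<beta> where t: "\<And>y. \<alpha> + \<beta> * y \<le> \<bar>y\<bar> powr p" "\<alpha> + \<beta> * (\<integral>x. f x \<partial>M) = \<bar>\<integral>x. f x \<partial>M\<bar> powr p"
      using powr_abs_tangent[OF p] by metis
    note int = Lp_fun_integrable[OF \<open>prob_space M\<close> p f]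
    have "\<alpha> + \<beta> * (\<integral>x. f x \<partial>M) = (\<integral>x. \<alpha> + \<beta> * f x \<partial>M)" using int by (simp add: prob_space)
    also have "\<dots> \<le> pth_moment p M f" unfolding pth_moment_def
      by (rule integral_mono) (use int f t(1) in \<open>auto simp: Lp_fun_def\<close>)
    finally show ?thesis using t(2) by simp
  qed
  show "\<bar>\<integral>x. f x \<partial>M\<bar> powr p \<le> pth_moment p M f" by (rule *[OF f])
  have "Lp_fun p M (\<lambda>x. \<bar>f x\<bar>)" using f unfolding Lp_fun_def by (auto intro: borel_measurable_abs)
  from *[OF this] show "(\<integral>x. \<bar>f x\<bar> \<partial>M) powr p \<le> pth_moment p M f" by (simp add: pth_moment_def)
qed

text \<open>A Cauchy sequence in \<open>L\<^sup>p\<close> is Cauchy in \<open>L\<^sup>1\<close> because the measure is a probability, hence has an almost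
  everywhere convergent subsequence. By Fatou's lemma its limit is the \<open>L\<^sup>p\<close>-limit of the whole sequence.\<close>
lemma Lp_complete:
  fixes h :: "nat \<Rightarrow> 'a \<Rightarrow> real"
  assumes M: "prob_space M" and p: "1 \<le> p" and h: "\<And>n. Lp_fun p M (h n)"
    and cauchy: "\<And>e. 0 < e \<Longrightarrow> \<exists>N. \<forall>n\<ge>N. \<forall>m\<ge>N. pth_moment p M (\<lambda>x. h n x - h m x) < e"
  obtains g where "Lp_fun p M g" "(\<lambda>n. pth_moment p M (\<lambda>x. h n x - g x)) \<longlonglongrightarrow> 0"
proof -
  interpret prob_space M by fact
  have [measurable]: "h n \<in> borel_measurable M" for n using h by (simp add: Lp_fun_def)
  have L1: "\<exists>N. \<forall>i\<ge>N. \<forall>j\<ge>N. LINT x|M. norm (h i x - h j x) < e" if e: "e > 0" for e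
  proof -
    have "0 < e powr p" using e by simp
    then obtain N where N: "\<forall>n\<ge>N. \<forall>m\<ge>N. pth_moment p M (\<lambda>x. h n x - h m x) < e powr p" using cauchy by blast
    have "LINT x|M. norm (h i x - h j x) < e" if "i \<ge> N" "j \<ge> N" for i j
    proof (rule ccontr)
      assume "\<not> ?thesis"
      hence "e powr p \<le> (LINT x|M. \<bar>h i x - h j x\<bar>) powr p" using e p by (intro powr_mono2) auto
      moreover have "(LINT x|M. \<bar>h i x - h j x\<bar>) powr p \<le> pth_moment p M (\<lambda>x. h i x - h j x)"
        by (rule integral_powr_le_pth_moment(2)[OF M p Lp_fun_diff[OF p h h]])
      moreover have "pth_moment p M (\<lambda>x. h i x - h j x) < e powr p" using N that by blast
      ultimately show False by linarith
    qed
    thus ?thesis by blast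
  qed
  obtain r where r: "strict_mono r" "AE x in M. Cauchy (\<lambda>i. h (r i) x)"
    by (rule cauchy_L1_AE_cauchy_subseq[of M h], rule Lp_fun_integrable[OF M p h], erule L1, rule that)
  define g where "g x = lim (\<lambda>i. h (r i) x)" for x
  have [measurable]: "g \<in> borel_measurable M" unfolding g_def by measurable
  have lim: "AE x in M. (\<lambda>i. h (r i) x) \<longlonglongrightarrow> g x"
    using r(2) by eventually_elim (simp add: g_def Cauchy_convergent convergent_LIMSEQ_iff[symmetric])
  have bound: "(\<integral>\<^sup>+x. \<bar>h n x - g x\<bar> powr p \<partial>M) \<le> ennreal e"
    if N: "\<forall>n\<ge>N. \<forall>m\<ge>N. pth_moment p M (\<lambda>x. h n x - h m x) < e" and n: "n \<ge> N" for n N e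
  proof -
    have "(\<integral>\<^sup>+x. \<bar>h n x - g x\<bar> powr p \<partial>M) = (\<integral>\<^sup>+x. liminf (\<lambda>i. ennreal (\<bar>h n x - h (r i) x\<bar> powr p)) \<partial>M)"
    proof (rule nn_integral_cong_AE)
      show "AE x in M. ennreal (\<bar>h n x - g x\<bar> powr p) = liminf (\<lambda>i. ennreal (\<bar>h n x - h (r i) x\<bar> powr p))"
        using lim
      proof eventually_elim
        case (elim x)
        have "(\<lambda>i. ennreal (\<bar>h n x - h (r i) x\<bar> powr p)) \<longlonglongrightarrow> ennreal (\<bar>h n x - g x\<bar> powr p)"
          using p by (intro tendsto_ennrealI tendsto_powr' tendsto_intros elim) auto
        from lim_imp_Liminf[OF sequentially_bot this] show ?case by simp
      qed
    qed
    also have "\<dots> \<le> liminf (\<lambda>i. \<integral>\<^sup>+x. ennreal (\<bar>h n x - h (r i) x\<bar> powr p) \<partial>M)"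
      by (rule nn_integral_liminf) measurable
    also have "\<dots> \<le> liminf (\<lambda>i. ennreal e)"
    proof (rule Liminf_mono)
      show "\<forall>\<^sub>F i in sequentially. (\<integral>\<^sup>+x. ennreal (\<bar>h n x - h (r i) x\<bar> powr p) \<partial>M) \<le> ennreal e"
        using eventually_ge_at_top[of N]
      proof eventually_elim
        case (elim i)
        have "r i \<ge> N" using seq_suble[OF r(1), of i] elim by linarith
        hence "pth_moment p M (\<lambda>x. h n x - h (r i) x) \<le> e" using N n by (simp add: less_imp_le)
        moreover have "(\<integral>\<^sup>+x. ennreal (\<bar>h n x - h (r i) x\<bar> powr p) \<partial>M) = ennreal (pth_moment p M (\<lambda>x. h n x - h (r i) x))"
          unfolding pth_moment_def
          by (rule nn_integral_eq_integral) (use Lp_fun_diff[OF p h h] in \<open>auto simp: Lp_fun_def\<close>)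
        ultimately show ?case by (simp add: ennreal_leI)
      qed
    qed
    finally show ?thesis by (simp add: Liminf_const)
  qed
  have diffLp: "Lp_fun p M (\<lambda>x. h n x - g x)" "pth_moment p M (\<lambda>x. h n x - g x) \<le> e"
    if N: "\<forall>n\<ge>N. \<forall>m\<ge>N. pth_moment p M (\<lambda>x. h n x - h m x) < e" and n: "n \<ge> N" and e: "0 < e" for n N e
  proof -
    have i: "integrable M (\<lambda>x. \<bar>h n x - g x\<bar> powr p)"
      by (rule integrableI_bounded) (use le_less_trans[OF bound[OF N n]] in auto)
    thus "Lp_fun p M (\<lambda>x. h n x - g x)" by (simp add: Lp_fun_def)
    have "ennreal (pth_moment p M (\<lambda>x. h n x - g x)) = (\<integral>\<^sup>+x. \<bar>h n x - g x\<bar> powr p \<partial>M)"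
      unfolding pth_moment_def by (rule nn_integral_eq_integral[symmetric, OF i]) simp
    with bound[OF N n] have "ennreal (pth_moment p M (\<lambda>x. h n x - g x)) \<le> ennreal e" by metis
    thus "pth_moment p M (\<lambda>x. h n x - g x) \<le> e" using e by (metis ennreal_le_iff less_imp_le)
  qed
  obtain N1 where N1: "\<forall>n\<ge>N1. \<forall>m\<ge>N1. pth_moment p M (\<lambda>x. h n x - h m x) < 1" using cauchy[of 1] by auto
  have "Lp_fun p M (\<lambda>x. h N1 x - (h N1 x - g x))"
    by (rule Lp_fun_diff[OF p h diffLp(1)[OF N1]]) auto
  hence gLp: "Lp_fun p M g" by simp
  have "(\<lambda>n. pth_moment p M (\<lambda>x. h n x - g x)) \<longlonglongrightarrow> 0"
  proof (rule LIMSEQ_I)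
    fix e :: real assume e: "0 < e"
    obtain N where N: "\<forall>n\<ge>N. \<forall>m\<ge>N. pth_moment p M (\<lambda>x. h n x - h m x) < e / 2" using cauchy[of "e / 2"] e by auto
    show "\<exists>no. \<forall>n\<ge>no. norm (pth_moment p M (\<lambda>x. h n x - g x) - 0) < e"
      using diffLp(2)[OF N] e pth_moment_nonneg[of p M] by (intro exI[of _ N]) fastforce
  qed
  thus ?thesis using that gLp by blast
qed

section \<open>Density of bounded continuous functions and extension of operators\<close>

lemma bcontfun_realI:
  fixes f :: "'a::topological_space \<Rightarrow> real"
  assumes "continuous_on UNIV f" "\<And>x. \<bar>f x\<bar> \<le> B"
  shows "f \<in> bcontfun"
  using assms unfolding bcontfun_def bounded_iff by auto

lemma bcontfun_realD:
  fixes f :: "'a::topological_space \<Rightarrow> real"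
  assumes "f \<in> bcontfun"
  shows "continuous_on UNIV f" "\<exists>B. \<forall>x. \<bar>f x\<bar> \<le> B"
  using assms unfolding bcontfun_def bounded_iff by auto

lemma borel_sets_measurable:
  fixes f :: "'a::topological_space \<Rightarrow> real"
  assumes "sets M = sets borel" "continuous_on UNIV f"
  shows "f \<in> borel_measurable M"
  using borel_measurable_continuous_onI[OF assms(2)] measurable_cong_sets[OF assms(1) refl] by blast

lemma bcontfun_Lp:
  fixes M :: "(real^'n::finite) measure"
  assumes M: "prob_space M" "sets M = sets borel" and p: "1 \<le> p" and f: "f \<in> bcontfun"
  shows "Lp_fun p M f" "integrable M f" "f \<in> borel_measurable M"
  using bcontfun_realD[OF f] Lp_fun_bounded[OF M(1) borel_sets_measurable[OF M(2)], of f _ p] p borel_sets_measurable[OF M(2)] by auto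

text \<open>Regularity of the measure encloses \<open>A\<close> between a compact and an open set of nearly equal measure, and
  Urysohn's lemma interpolates between them.\<close>
lemma bcontfun_indicator_approx:
  fixes M :: "(real^'n::finite) measure"
  assumes M: "prob_space M" "sets M = sets borel" and A: "A \<in> sets M" and e: "0 < (e::real)"
  shows "\<exists>\<phi>\<in>bcontfun. (\<integral>x. \<bar>indicator A x - \<phi> x :: real\<bar> \<partial>M) < e"
proof -
  interpret prob_space M by fact
  have Ab: "A \<in> sets borel" using A M by simp
  have fin: "emeasure M (space M) \<noteq> \<infinity>" by simp
  have "\<exists>K. K \<subseteq> A \<and> compact K \<and> measure M A < measure M K + e / 3"
  proof (rule ccontr)
    assume "\<not> ?thesis"
    hence le: "measure M K \<le> measure M A - e / 3" if "K \<subseteq> A" "compact K" for K using that by (auto simp: not_less algebra_simps)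
    hence nn: "0 \<le> measure M A - e / 3" using le[of "{}"] by simp
    have "emeasure M A \<le> ennreal (measure M A - e / 3)"
      unfolding inner_regular[OF M(2) fin Ab]
      by (rule SUP_least) (use le in \<open>auto intro!: ennreal_leI simp: emeasure_eq_measure\<close>)
    thus False using nn e by (simp add: emeasure_eq_measure)
  qed
  then obtain K where K: "K \<subseteq> A" "compact K" "measure M A < measure M K + e / 3" by blast
  have "\<exists>U. A \<subseteq> U \<and> open U \<and> measure M U < measure M A + e / 3"
  proof (rule ccontr)
    assume "\<not> ?thesis"
    hence le: "measure M A + e / 3 \<le> measure M U" if "A \<subseteq> U" "open U" for U using that by (auto simp: not_less)
    have "ennreal (measure M A + e / 3) \<le> emeasure M A"
      unfolding outer_regular[OF M(2) fin Ab]
      by (rule INF_greatest) (use le in \<open>auto intro!: ennreal_leI simp: emeasure_eq_measure\<close>)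
    thus False using e by (simp add: emeasure_eq_measure)
  qed
  then obtain U where U: "A \<subseteq> U" "open U" "measure M U < measure M A + e / 3" by blast
  have sets: "K \<in> sets M" "U \<in> sets M" using K U M by (auto simp: borel_compact)
  have cl: "closed K" "closed (- U)" "K \<inter> - U = {}" using K U by (auto simp: compact_imp_closed)
  obtain \<phi> :: "real^'n \<Rightarrow> real" where \<phi>: "continuous_on UNIV \<phi>" "\<And>x. \<phi> x \<in> closed_segment 1 0"
    "\<And>x. x \<in> K \<Longrightarrow> \<phi> x = 1" "\<And>x. x \<in> - U \<Longrightarrow> \<phi> x = 0"
    by (rule Urysohn[OF cl, where a = 1 and b = 0]; rule that; assumption)
  have rng: "0 \<le> \<phi> x" "\<phi> x \<le> 1" for x using \<phi>(2)[of x] by (auto simp: closed_segment_eq_real_ivl)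
  have \<phi>b: "\<phi> \<in> bcontfun" using rng by (intro bcontfun_realI[OF \<phi>(1), of 1]) auto
  have [measurable]: "\<phi> \<in> borel_measurable M" by (rule borel_sets_measurable[OF M(2) \<phi>(1)])
  have [measurable]: "A \<in> sets M" "K \<in> sets M" "U \<in> sets M" using A sets by auto
  have "(\<integral>x. \<bar>indicator A x - \<phi> x\<bar> \<partial>M) \<le> (\<integral>x. indicator (U - K) x \<partial>M)"
  proof (rule integral_mono)
    show "integrable M (\<lambda>x. \<bar>indicator A x - \<phi> x\<bar>)"
    proof (rule integrable_const_bound[of _ 1])
      have "\<bar>indicator A x - \<phi> x\<bar> \<le> 1" for x using rng[of x] by (auto simp: indicator_def)
      thus "AE x in M. norm \<bar>indicator A x - \<phi> x\<bar> \<le> 1" by simp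
    qed measurable
    show "\<bar>indicator A x - \<phi> x\<bar> \<le> indicator (U - K) x" for x
      using rng[of x] \<phi>(3,4)[of x] K(1) U(1) by (auto simp: indicator_def)
  qed (auto intro!: integrable_real_indicator simp: less_top[symmetric])
  also have "\<dots> = measure M U - measure M K"
    using finite_measure_Diff[of U K] sets K U by (simp add: subset_trans[OF K(1) U(1)])
  also have "\<dots> < e" using K(3) U(3) e by simp
  finally show ?thesis using \<phi>b by blast
qed

lemma bcontfun_add: "f \<in> bcontfun \<Longrightarrow> g \<in> bcontfun \<Longrightarrow> (\<lambda>x. f x + g x :: real) \<in> bcontfun"
  using bcontfun_realD[of f] bcontfun_realD[of g]
  by (auto intro!: continuous_intros bcontfun_realI[where B = "_ + _"] order_trans[OF abs_triangle_ineq] add_mono)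

lemma bcontfun_L1_dense:
  fixes M :: "(real^'n::finite) measure" and f :: "real^'n \<Rightarrow> real"
  assumes M: "prob_space M" "sets M = sets borel" and f: "integrable M f"
  shows "\<forall>e>0. \<exists>\<phi>\<in>bcontfun. (\<integral>x. \<bar>f x - \<phi> x\<bar> \<partial>M) < (e::real)"
  using f
proof (induction rule: integrable_induct)
  case (base A c)
  show ?case
  proof (intro allI impI)
    fix e :: real assume e: "0 < e"
    have "0 < e / (\<bar>c\<bar> + 1)" using e by simp
    from bcontfun_indicator_approx[OF M base(1) this] obtain \<phi> where
      \<phi>: "\<phi> \<in> bcontfun" "(\<integral>x. \<bar>indicator A x - \<phi> x\<bar> \<partial>M) < e / (\<bar>c\<bar> + 1)" by blast
    obtain B where B: "\<And>x. \<bar>\<phi> x\<bar> \<le> B" using bcontfun_realD(2)[OF \<phi>(1)] by blast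
    have "(\<lambda>x. \<phi> x * c) \<in> bcontfun"
      using B by (intro bcontfun_realI[where B = "B * \<bar>c\<bar>"] continuous_intros bcontfun_realD(1)[OF \<phi>(1)]) (auto simp: abs_mult mult_right_mono)
    moreover have "(\<integral>x. \<bar>indicator A x *\<^sub>R c - \<phi> x * c\<bar> \<partial>M) < e"
    proof -
      have "(\<integral>x. \<bar>indicator A x *\<^sub>R c - \<phi> x * c\<bar> \<partial>M) = \<bar>c\<bar> * (\<integral>x. \<bar>indicator A x - \<phi> x\<bar> \<partial>M)"
      proof -
        have "\<bar>indicator A x *\<^sub>R c - \<phi> x * c\<bar> = \<bar>c\<bar> * \<bar>indicator A x - \<phi> x\<bar>" for x
          unfolding real_scaleR_def left_diff_distrib[symmetric] abs_mult by (rule mult.commute)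
        thus ?thesis by (simp only: integral_mult_right_zero)
      qed
      also have "\<dots> \<le> \<bar>c\<bar> * (e / (\<bar>c\<bar> + 1))" using \<phi>(2) by (intro mult_left_mono) auto
      also have "\<dots> < e" using e by (simp add: field_simps)
      finally show ?thesis .
    qed
    ultimately show "\<exists>\<phi>\<in>bcontfun. (\<integral>x. \<bar>indicator A x *\<^sub>R c - \<phi> x\<bar> \<partial>M) < e"
      by (intro bexI[where x = "\<lambda>x. \<phi> x * c"])
  qed
next
  case (add f g)
  show ?case
  proof (intro allI impI)
    fix e :: real assume e: "0 < e"
    obtain \<phi> where \<phi>: "\<phi> \<in> bcontfun" "(\<integral>x. \<bar>f x - \<phi> x\<bar> \<partial>M) < e / 2" using add(3) e half_gt_zero by blast
    obtain \<psi> where \<psi>: "\<psi> \<in> bcontfun" "(\<integral>x. \<bar>g x - \<psi> x\<bar> \<partial>M) < e / 2" using add(4) e half_gt_zero by blast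
    note int = bcontfun_Lp(2)[OF M order_refl]
    have "(\<integral>x. \<bar>f x + g x - (\<phi> x + \<psi> x)\<bar> \<partial>M) \<le> (\<integral>x. \<bar>f x - \<phi> x\<bar> + \<bar>g x - \<psi> x\<bar> \<partial>M)"
      using add(1,2) int[OF \<phi>(1)] int[OF \<psi>(1)] by (intro integral_mono) auto
    also have "\<dots> = (\<integral>x. \<bar>f x - \<phi> x\<bar> \<partial>M) + (\<integral>x. \<bar>g x - \<psi> x\<bar> \<partial>M)"
      using add(1,2) int[OF \<phi>(1)] int[OF \<psi>(1)] by (intro Bochner_Integration.integral_add) auto
    also have "\<dots> < e" using \<phi>(2) \<psi>(2) by simp
    finally show "\<exists>\<phi>\<in>bcontfun. (\<integral>x. \<bar>f x + g x - \<phi> x\<bar> \<partial>M) < e"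
      using bcontfun_add[OF \<phi>(1) \<psi>(1)] by (intro bexI[where x = "\<lambda>x. \<phi> x + \<psi> x"])
  qed
next
  case (lim f h)
  show ?case
  proof (intro allI impI)
    fix e :: real assume e: "0 < e"
    have "(\<lambda>i. \<integral>x. \<bar>h i x - f x\<bar> \<partial>M) \<longlonglongrightarrow> (\<integral>x. 0 \<partial>M)"
    proof (rule integral_dominated_convergence[where w = "\<lambda>x. 3 * \<bar>f x\<bar>"])
      show "AE x in M. (\<lambda>i. \<bar>h i x - f x\<bar>) \<longlonglongrightarrow> 0"
        by (intro AE_I2 tendsto_rabs_zero LIM_zero lim.hyps(2))
      show "AE x in M. norm \<bar>h i x - f x\<bar> \<le> 3 * \<bar>f x\<bar>" for i
      proof (rule AE_I2)
        fix x assume "x \<in> space M"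
        from lim.hyps(3)[OF this, of i] show "norm \<bar>h i x - f x\<bar> \<le> 3 * \<bar>f x\<bar>" by simp
      qed
    qed (use lim.hyps(1,4) in auto)
    hence "\<forall>\<^sub>F i in sequentially. (\<integral>x. \<bar>h i x - f x\<bar> \<partial>M) < e / 2"
      by (rule order_tendstoD(2)) (use e in simp)
    from eventually_happens'[OF sequentially_bot this]
    obtain i where i: "(\<integral>x. \<bar>h i x - f x\<bar> \<partial>M) < e / 2" by blast
    obtain \<phi> where \<phi>: "\<phi> \<in> bcontfun" "(\<integral>x. \<bar>h i x - \<phi> x\<bar> \<partial>M) < e / 2" using lim.IH e half_gt_zero by blast
    note int = bcontfun_Lp(2)[OF M order_refl \<phi>(1)]
    have "(\<integral>x. \<bar>f x - \<phi> x\<bar> \<partial>M) \<le> (\<integral>x. \<bar>h i x - f x\<bar> + \<bar>h i x - \<phi> x\<bar> \<partial>M)"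
      using lim.hyps(1,4) int by (intro integral_mono) auto
    also have "\<dots> = (\<integral>x. \<bar>h i x - f x\<bar> \<partial>M) + (\<integral>x. \<bar>h i x - \<phi> x\<bar> \<partial>M)"
      using lim.hyps(1,4) int by (intro Bochner_Integration.integral_add) auto
    also have "\<dots> < e" using i \<phi>(2) by simp
    finally show "\<exists>\<phi>\<in>bcontfun. (\<integral>x. \<bar>f x - \<phi> x\<bar> \<partial>M) < e" using \<phi>(1) by blast
  qed
qed

text \<open>Truncation at height \<open>k\<close> reduces the claim to functions bounded by \<open>k\<close>. For these an approximation in
  \<open>L\<^sup>1\<close> can be truncated as well, and then \<open>|\<phi> - g|\<^sup>p \<le> (2k)\<^sup>p\<^sup>-\<^sup>1 |\<phi> - g|\<close>.\<close>
lemma bcontfun_Lp_dense: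
  fixes M :: "(real^'n::finite) measure" and f :: "real^'n \<Rightarrow> real"
  assumes M: "prob_space M" "sets M = sets borel" and p: "1 \<le> p" and f: "Lp_fun p M f" and e: "0 < e"
  shows "\<exists>\<phi>\<in>bcontfun. pth_moment p M (\<lambda>x. \<phi> x - f x) < e"
proof -
  interpret prob_space M by fact
  have [measurable]: "f \<in> borel_measurable M" and fi: "integrable M (\<lambda>x. \<bar>f x\<bar> powr p)" using f by (auto simp: Lp_fun_def)
  define T where "T k y = max (- k) (min k y)" for k y :: real
  have Tb: "\<bar>T k y\<bar> \<le> k" if "0 \<le> k" for k y using that by (auto simp: T_def)
  have "(\<lambda>k. \<integral>x. \<bar>T (real k) (f x) - f x\<bar> powr p \<partial>M) \<longlonglongrightarrow> (\<integral>x. 0 \<partial>M)"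
  proof (rule integral_dominated_convergence[where w = "\<lambda>x. \<bar>f x\<bar> powr p"])
    show "AE x in M. (\<lambda>k. \<bar>T (real k) (f x) - f x\<bar> powr p) \<longlonglongrightarrow> 0"
    proof (rule AE_I2)
      fix x
      obtain n where n: "\<bar>f x\<bar> \<le> real n" using real_arch_simple by blast
      have "\<forall>\<^sub>F k in sequentially. \<bar>T (real k) (f x) - f x\<bar> powr p = 0"
        using eventually_ge_at_top[of n] by eventually_elim (use n in \<open>auto simp: T_def\<close>)
      thus "(\<lambda>k. \<bar>T (real k) (f x) - f x\<bar> powr p) \<longlonglongrightarrow> 0" by (rule tendsto_eventually)
    qed
    show "AE x in M. norm (\<bar>T (real k) (f x) - f x\<bar> powr p) \<le> \<bar>f x\<bar> powr p" for k
      using p by (intro AE_I2) (auto intro!: powr_mono2 simp: T_def)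
    show "(\<lambda>x. \<bar>T (real k) (f x) - f x\<bar> powr p) \<in> borel_measurable M" for k unfolding T_def by measurable
  qed (use fi in auto)
  hence "\<forall>\<^sub>F k in sequentially. (\<integral>x. \<bar>T (real k) (f x) - f x\<bar> powr p \<partial>M) < e / (2 * 2 powr p)"
    by (rule order_tendstoD(2)) (use e in simp)
  hence "\<forall>\<^sub>F k in sequentially. (\<integral>x. \<bar>T (real k) (f x) - f x\<bar> powr p \<partial>M) < e / (2 * 2 powr p) \<and> 1 \<le> k"
    using eventually_ge_at_top[of 1] by eventually_elim simp
  from eventually_happens'[OF sequentially_bot this]
  obtain k where k: "pth_moment p M (\<lambda>x. T (real k) (f x) - f x) < e / (2 * 2 powr p)" "1 \<le> k"
    unfolding pth_moment_def by blast
  define g where "g x = T (real k) (f x)" for x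
  have gm [measurable]: "g \<in> borel_measurable M" unfolding g_def T_def by measurable
  have gb: "\<bar>g x\<bar> \<le> real k" for x unfolding g_def by (rule Tb) simp
  note gLp = Lp_fun_bounded[where f = g, OF M(1) gm gb p]
  define c where "c = (2 * real k) powr (p - 1)"
  have c: "0 < c" using k(2) by (simp add: c_def)
  have "0 < e / (2 * 2 powr p * c)" using e c by simp
  then obtain \<psi> where \<psi>: "\<psi> \<in> bcontfun" "(\<integral>x. \<bar>g x - \<psi> x\<bar> \<partial>M) < e / (2 * 2 powr p * c)"
    using bcontfun_L1_dense[OF M gLp(2)] by auto
  define \<phi> where "\<phi> x = T (real k) (\<psi> x)" for x
  have \<phi>b: "\<bar>\<phi> x\<bar> \<le> real k" for x unfolding \<phi>_def by (rule Tb) simp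
  have \<phi>: "\<phi> \<in> bcontfun"
    by (rule bcontfun_realI[OF _ \<phi>b]) (auto simp: \<phi>_def T_def intro!: continuous_intros bcontfun_realD(1)[OF \<psi>(1)])
  note [measurable] = bcontfun_Lp(3)[OF M p \<phi>] bcontfun_Lp(3)[OF M p \<psi>(1)]
  have "pth_moment p M (\<lambda>x. \<phi> x - g x) \<le> (\<integral>x. c * \<bar>g x - \<psi> x\<bar> \<partial>M)"
    unfolding pth_moment_def
  proof (rule integral_mono)
    show "integrable M (\<lambda>x. \<bar>\<phi> x - g x\<bar> powr p)"
      using Lp_fun_diff[OF p bcontfun_Lp(1)[OF M p \<phi>] gLp(1)] by (simp add: Lp_fun_def)
    show "integrable M (\<lambda>x. c * \<bar>g x - \<psi> x\<bar>)"
      using gLp(2) bcontfun_Lp(2)[OF M p \<psi>(1)] by auto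
    fix x
    have "\<bar>\<phi> x - g x\<bar> \<le> 2 * real k" using \<phi>b[of x] gb[of x] by linarith
    hence "\<bar>\<phi> x - g x\<bar> powr (p - 1) * \<bar>\<phi> x - g x\<bar> \<le> c * \<bar>\<phi> x - g x\<bar>"
      unfolding c_def using p by (intro mult_right_mono powr_mono2) auto
    moreover have "\<bar>\<phi> x - g x\<bar> powr (p - 1) * \<bar>\<phi> x - g x\<bar> = \<bar>\<phi> x - g x\<bar> powr p"
      by (cases "\<phi> x = g x") (simp_all add: powr_diff)
    moreover have "\<bar>\<phi> x - g x\<bar> \<le> \<bar>g x - \<psi> x\<bar>"
      unfolding \<phi>_def g_def T_def by (auto simp: max_def min_def)
    ultimately show "\<bar>\<phi> x - g x\<bar> powr p \<le> c * \<bar>g x - \<psi> x\<bar>"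
      using c mult_left_mono[of "\<bar>\<phi> x - g x\<bar>" "\<bar>g x - \<psi> x\<bar>" c] by linarith
  qed
  also have "\<dots> < e / (2 * 2 powr p)"
    using \<psi>(2) c by (simp add: field_simps)
  finally have 1: "pth_moment p M (\<lambda>x. \<phi> x - g x) < e / (2 * 2 powr p)" .
  have "pth_moment p M (\<lambda>x. \<phi> x - f x) \<le> 2 powr p * (pth_moment p M (\<lambda>x. \<phi> x - g x) + pth_moment p M (\<lambda>x. g x - f x))"
    by (rule pth_moment_triangle[OF p bcontfun_Lp(1)[OF M p \<phi>] gLp(1) f])
  also have "\<dots> < 2 powr p * (e / (2 * 2 powr p) + e / (2 * 2 powr p))"
    using 1 k(1) unfolding g_def by (intro mult_strict_left_mono add_strict_mono) auto
  also have "\<dots> = e" by (simp add: field_simps)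
  finally show ?thesis using \<phi> by blast
qed


text \<open>\<^const>\<open>Lp_extension\<close> is a choice, so a representative has to be exhibited first: the limit of the
  images of one approximating sequence \<open>\<Phi>\<close>, which by contractivity is the limit for every other
  approximating sequence. The constant \<open>2\<^sup>p 2\<^sup>p\<close> comes from two uses of the quasi-triangle inequality; what
  matters is that it depends on neither measure.\<close>
lemma Lp_extension_bound:
  fixes M N :: "(real^'n::finite) measure" and T :: "(real^'n \<Rightarrow> real) \<Rightarrow> real^'n \<Rightarrow> real"
  assumes M: "prob_space M" "sets M = sets borel" and N: "prob_space N" "sets N = sets borel" and p: "1 \<le> p"
    and T: "\<And>\<phi>. \<phi> \<in> bcontfun \<Longrightarrow> T \<phi> \<in> bcontfun"
    and contr: "\<And>\<phi> \<psi>. \<phi> \<in> bcontfun \<Longrightarrow> \<psi> \<in> bcontfun \<Longrightarrow>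
      pth_moment p N (\<lambda>x. T \<phi> x - T \<psi> x) \<le> pth_moment p M (\<lambda>x. \<phi> x - \<psi> x)"
    and f: "Lp_fun p M f"
  shows "Lp_fun p N (Lp_extension p M N T f)"
    and "\<phi> \<in> bcontfun \<Longrightarrow> pth_moment p N (\<lambda>x. T \<phi> x - Lp_extension p M N T f x)
       \<le> 2 powr p * (2 powr p * pth_moment p M (\<lambda>x. \<phi> x - f x))"
proof -
  define c where "c = (2::real) powr p"
  have c: "0 < c" by (simp add: c_def)
  note MLp = bcontfun_Lp(1)[OF M p] and NLp = bcontfun_Lp(1)[OF N p]
  have "\<exists>\<phi>\<in>bcontfun. pth_moment p M (\<lambda>x. \<phi> x - f x) < 1 / real (Suc n)" for n
    by (rule bcontfun_Lp_dense[OF M p f]) simp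
  then obtain \<Phi> where \<Phi>: "\<And>n. \<Phi> n \<in> bcontfun" "\<And>n. pth_moment p M (\<lambda>x. \<Phi> n x - f x) < 1 / real (Suc n)"
    by metis
  have lim\<Phi>: "(\<lambda>n. pth_moment p M (\<lambda>x. \<Phi> n x - f x)) \<longlonglongrightarrow> 0"
    by (rule tendsto_sandwich[OF _ _ tendsto_const LIMSEQ_inverse_real_of_nat])
      (use \<Phi>(2) in \<open>auto simp: pth_moment_nonneg inverse_eq_divide less_imp_le\<close>)
  have contr2: "pth_moment p N (\<lambda>x. T \<phi> x - T \<psi> x) \<le> c * (pth_moment p M (\<lambda>x. \<phi> x - f x) + pth_moment p M (\<lambda>x. \<psi> x - f x))"
    if "\<phi> \<in> bcontfun" "\<psi> \<in> bcontfun" for \<phi> \<psi>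
    using order_trans[OF contr[OF that] pth_moment_triangle[OF p MLp[OF that(1)] f MLp[OF that(2)]]]
    by (simp add: c_def pth_moment_minus_commute[of p M f \<psi>])
  have est: "pth_moment p N (\<lambda>x. T \<phi> x - g x)
      \<le> c * (c * (pth_moment p M (\<lambda>x. \<phi> x - f x) + pth_moment p M (\<lambda>x. \<Phi> n x - f x)) + pth_moment p N (\<lambda>x. T (\<Phi> n) x - g x))"
    if "\<phi> \<in> bcontfun" "Lp_fun p N g" for \<phi> g n
  proof -
    have "pth_moment p N (\<lambda>x. T \<phi> x - g x)
      \<le> c * (pth_moment p N (\<lambda>x. T \<phi> x - T (\<Phi> n) x) + pth_moment p N (\<lambda>x. T (\<Phi> n) x - g x))"
      unfolding c_def by (rule pth_moment_triangle[OF p NLp[OF T[OF that(1)]] NLp[OF T[OF \<Phi>(1)]] that(2)])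
    also have "\<dots> \<le> c * (c * (pth_moment p M (\<lambda>x. \<phi> x - f x) + pth_moment p M (\<lambda>x. \<Phi> n x - f x)) + pth_moment p N (\<lambda>x. T (\<Phi> n) x - g x))"
      using c contr2[OF that(1) \<Phi>(1)] by (intro mult_left_mono add_right_mono) auto
    finally show ?thesis .
  qed
  have cauchy: "\<exists>n0. \<forall>n\<ge>n0. \<forall>m\<ge>n0. pth_moment p N (\<lambda>x. T (\<Phi> n) x - T (\<Phi> m) x) < e" if e: "0 < e" for e
  proof -
    have "0 < e / (2 * c)" using e c by simp
    from order_tendstoD(2)[OF lim\<Phi> this] obtain n0 where
      n0: "\<And>n. n \<ge> n0 \<Longrightarrow> pth_moment p M (\<lambda>x. \<Phi> n x - f x) < e / (2 * c)"
      unfolding eventually_sequentially by blast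
    have "pth_moment p N (\<lambda>x. T (\<Phi> n) x - T (\<Phi> m) x) < e" if "n \<ge> n0" "m \<ge> n0" for n m
    proof -
      have "pth_moment p N (\<lambda>x. T (\<Phi> n) x - T (\<Phi> m) x)
          \<le> c * (pth_moment p M (\<lambda>x. \<Phi> n x - f x) + pth_moment p M (\<lambda>x. \<Phi> m x - f x))"
        by (rule contr2[OF \<Phi>(1) \<Phi>(1)])
      also have "\<dots> < c * (e / (2 * c) + e / (2 * c))"
        using c n0 that by (intro mult_strict_left_mono add_strict_mono) auto
      also have "\<dots> = e" using c by (simp add: field_simps)
      finally show ?thesis .
    qed
    thus ?thesis by blast
  qed
  obtain g0 where g0: "Lp_fun p N g0" "(\<lambda>n. pth_moment p N (\<lambda>x. T (\<Phi> n) x - g0 x)) \<longlonglongrightarrow> 0"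
    by (rule Lp_complete[OF N(1) p, of "\<lambda>n. T (\<Phi> n)"]) (use NLp T \<Phi>(1) cauchy in auto)
  define P where "P g \<longleftrightarrow> Lp_fun p N g \<and>
     (\<forall>\<phi>. (\<forall>n::nat. \<phi> n \<in> bcontfun) \<and> (\<lambda>n. Lp_norm p M (\<lambda>x. \<phi> n x - f x)) \<longlonglongrightarrow> 0
        \<longrightarrow> (\<lambda>n. Lp_norm p N (\<lambda>x. T (\<phi> n) x - g x)) \<longlonglongrightarrow> 0)" for g
  have "P g0" unfolding P_def Lp_norm_tendsto_0_iff[OF p]
  proof (intro conjI allI impI g0(1))
    fix \<phi> :: "nat \<Rightarrow> real^'n \<Rightarrow> real"
    assume \<phi>: "(\<forall>n. \<phi> n \<in> bcontfun) \<and> (\<lambda>n. pth_moment p M (\<lambda>x. \<phi> n x - f x)) \<longlonglongrightarrow> 0"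
    have "(\<lambda>n. c * (c * (pth_moment p M (\<lambda>x. \<phi> n x - f x) + pth_moment p M (\<lambda>x. \<Phi> n x - f x))
              + pth_moment p N (\<lambda>x. T (\<Phi> n) x - g0 x))) \<longlonglongrightarrow> c * (c * (0 + 0) + 0)"
      using \<phi> by (intro tendsto_intros lim\<Phi> g0(2)) auto
    hence "(\<lambda>n. c * (c * (pth_moment p M (\<lambda>x. \<phi> n x - f x) + pth_moment p M (\<lambda>x. \<Phi> n x - f x))
              + pth_moment p N (\<lambda>x. T (\<Phi> n) x - g0 x))) \<longlonglongrightarrow> 0" by simp
    from tendsto_sandwich[OF _ _ tendsto_const this]
    show "(\<lambda>n. pth_moment p N (\<lambda>x. T (\<phi> n) x - g0 x)) \<longlonglongrightarrow> 0"
      by this (use est[OF _ g0(1)] \<phi> in \<open>auto simp: pth_moment_nonneg\<close>)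
  qed
  hence Pext: "P (Lp_extension p M N T f)"
    unfolding Lp_extension_def P_def[symmetric] by (rule someI[of P g0])
  thus ext: "Lp_fun p N (Lp_extension p M N T f)" unfolding P_def by blast
  have limext: "(\<lambda>n. pth_moment p N (\<lambda>x. T (\<Phi> n) x - Lp_extension p M N T f x)) \<longlonglongrightarrow> 0"
    using Pext \<Phi>(1) lim\<Phi> unfolding P_def Lp_norm_tendsto_0_iff[OF p] by blast
  assume \<phi>: "\<phi> \<in> bcontfun"
  have "(\<lambda>n. c * (c * (pth_moment p M (\<lambda>x. \<phi> x - f x) + pth_moment p M (\<lambda>x. \<Phi> n x - f x))
              + pth_moment p N (\<lambda>x. T (\<Phi> n) x - Lp_extension p M N T f x)))
      \<longlonglongrightarrow> c * (c * (pth_moment p M (\<lambda>x. \<phi> x - f x) + 0) + 0)"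
    by (intro tendsto_intros lim\<Phi> limext)
  from LIMSEQ_le_const[OF this] est[OF \<phi> ext]
  show "pth_moment p N (\<lambda>x. T \<phi> x - Lp_extension p M N T f x)
       \<le> 2 powr p * (2 powr p * pth_moment p M (\<lambda>x. \<phi> x - f x))"
    by (simp add: c_def)
qed

section \<open>Convergence of the evolution operator\<close>

lemma evolution_system_prob:
  assumes "evolution_system_of_measures G \<mu>" "0 \<le> t"
  shows "prob_space (\<mu> t)" "sets (\<mu> t) = sets borel"
  using assms unfolding evolution_system_of_measures_def by blast+

lemma evolution_system_invariance:
  assumes "evolution_system_of_measures G \<mu>" "0 \<le> s" "s \<le> t" "f \<in> bcontfun"
  shows "integral\<^sup>L (\<mu> s) f = integral\<^sup>L (\<mu> t) (G t s f)"
  using assms unfolding evolution_system_of_measures_def by simp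

lemma evolution_operator_solution:
  assumes "evolution_operator Q b G" "0 \<le> s" "f \<in> bcontfun"
  shows "bounded_solution Q b s f (\<lambda>t. G t s f)"
  using assms unfolding evolution_operator_def by blast

lemma evolution_operator_bcontfun:
  assumes "evolution_operator Q b G" "0 \<le> s" "s \<le> t" "f \<in> bcontfun"
  shows "G t s f \<in> bcontfun"
proof -
  note sol = evolution_operator_solution[OF assms(1,2,4)]
  obtain B where "\<And>x. \<bar>G t s f x\<bar> \<le> B" using bounded_solution_bound[OF sol] assms(3) by metis
  thus ?thesis using bounded_solution_continuous(2)[OF sol assms(3)] by (intro bcontfun_realI)
qed

lemma powr_diff_bcontfun:
  fixes \<phi> \<psi> :: "'a::topological_space \<Rightarrow> real"
  assumes "\<phi> \<in> bcontfun" "\<psi> \<in> bcontfun" "1 \<le> p"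
  shows "(\<lambda>x. \<bar>\<phi> x - \<psi> x\<bar> powr p) \<in> bcontfun"
proof -
  obtain B C where B: "\<And>x. \<bar>\<phi> x\<bar> \<le> B" and C: "\<And>x. \<bar>\<psi> x\<bar> \<le> C" using assms(1,2) bcontfun_realD(2) by metis
  have "\<bar>\<phi> x - \<psi> x\<bar> \<le> B + C" for x using B[of x] C[of x] by linarith
  hence bound: "\<bar>\<bar>\<phi> x - \<psi> x\<bar> powr p\<bar> \<le> (B + C) powr p" for x using assms(3) by (simp add: powr_mono2)
  have "continuous_on UNIV (\<lambda>x. \<bar>\<phi> x - \<psi> x\<bar>)" by (intro continuous_intros bcontfun_realD(1) assms)
  hence "continuous_on UNIV (\<lambda>x. \<bar>\<phi> x - \<psi> x\<bar> powr p)"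
    by (rule continuous_on_powr'[OF _ continuous_on_const]) (use assms(3) in auto)
  thus ?thesis using bound by (rule bcontfun_realI)
qed

text \<open>For the line \<open>\<alpha> + \<beta> y\<close> that supports \<open>|y|\<^sup>p\<close> at the value of \<open>G(t,s)\<phi> - G(t,s)\<psi>\<close> at \<open>x\<close>, the combination
  \<open>\<alpha> + \<beta> (G(t,s)\<phi> - G(t,s)\<psi>) - G(t,s)(|\<phi> - \<psi>|\<^sup>p)\<close> is a bounded solution that is nonpositive at time \<open>s\<close>.\<close>
lemma evolution_operator_Jensen:
  assumes st: "standing_assumptions Q b" and G: "evolution_operator Q b G" and s: "0 \<le> s" "s \<le> t" and p: "1 \<le> p"
    and \<phi>: "\<phi> \<in> bcontfun" and \<psi>: "\<psi> \<in> bcontfun"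
  shows "\<bar>G t s \<phi> x - G t s \<psi> x\<bar> powr p \<le> G t s (\<lambda>x. \<bar>\<phi> x - \<psi> x\<bar> powr p) x"
proof -
  obtain V a \<kappa> \<eta>\<^sub>0 c\<^sub>0 r\<^sub>0 where V: "C2 V" "\<And>x. 0 < V x" "filterlim V at_top at_infinity"
    and a: "0 \<le> a" "0 < \<kappa>" and lyap: "\<And>t x. 0 \<le> t \<Longrightarrow> opA Q b t V x \<le> a - \<kappa> * V x"
    and psd: "\<And>t x. 0 \<le> t \<Longrightarrow> psd (Q t x)"
    by (rule standing_assumptions_constants[OF st]; rule that; assumption)
  obtain \<alpha> \<beta> where tan: "\<And>y. \<alpha> + \<beta> * y \<le> \<bar>y\<bar> powr p"
    "\<alpha> + \<beta> * (G t s \<phi> x - G t s \<psi> x) = \<bar>G t s \<phi> x - G t s \<psi> x\<bar> powr p"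
    using powr_abs_tangent[OF p] by metis
  note sol = evolution_operator_solution[OF G s(1)]
  note sol1 = bounded_solution_lincomb[OF sol[OF \<phi>] sol[OF \<psi>], of 1 "-1"]
  note sol2 = bounded_solution_lincomb[OF sol1 sol[OF powr_diff_bcontfun[OF \<phi> \<psi> p]], of \<beta> "-1"]
  note sol3 = bounded_solution_lincomb[OF bounded_solution_const[of Q b s \<alpha>] sol2, of 1 1]
  have init: "1 * \<alpha> + 1 * (\<beta> * (1 * \<phi> y + - 1 * \<psi> y) + - 1 * \<bar>\<phi> y - \<psi> y\<bar> powr p) \<le> 0" for y
    using tan(1)[of "\<phi> y - \<psi> y"] by simp
  have "1 * \<alpha> + 1 * (\<beta> * (1 * G t s \<phi> x + - 1 * G t s \<psi> x) + - 1 * G t s (\<lambda>x. \<bar>\<phi> x - \<psi> x\<bar> powr p) x) \<le> 0"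
    by (rule maximum_principle[OF V a lyap psd s(1) sol3 init s(2)])
  thus ?thesis using tan(2) by simp
qed

lemma evolution_operator_contraction:
  assumes st: "standing_assumptions Q b" and G: "evolution_operator Q b G" and s: "0 \<le> s" "s \<le> t" and p: "1 \<le> p"
    and \<mu>: "evolution_system_of_measures G \<mu>" and \<phi>: "\<phi> \<in> bcontfun" and \<psi>: "\<psi> \<in> bcontfun"
  shows "pth_moment p (\<mu> t) (\<lambda>x. G t s \<phi> x - G t s \<psi> x) \<le> pth_moment p (\<mu> s) (\<lambda>x. \<phi> x - \<psi> x)"
proof -
  have \<mu>t: "prob_space (\<mu> t)" "sets (\<mu> t) = sets borel" using evolution_system_prob[OF \<mu>] s by auto
  let ?h = "\<lambda>x. \<bar>\<phi> x - \<psi> x\<bar> powr p"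
  have h: "?h \<in> bcontfun" by (rule powr_diff_bcontfun[OF \<phi> \<psi> p])
  note bc = evolution_operator_bcontfun[OF G s]
  have "pth_moment p (\<mu> t) (\<lambda>x. G t s \<phi> x - G t s \<psi> x) \<le> (\<integral>x. G t s ?h x \<partial>\<mu> t)"
    unfolding pth_moment_def
  proof (rule integral_mono)
    show "integrable (\<mu> t) (\<lambda>x. \<bar>G t s \<phi> x - G t s \<psi> x\<bar> powr p)"
      by (rule bcontfun_Lp(2)[OF \<mu>t p powr_diff_bcontfun[OF bc[OF \<phi>] bc[OF \<psi>] p]])
    show "integrable (\<mu> t) (G t s ?h)" by (rule bcontfun_Lp(2)[OF \<mu>t p bc[OF h]])
    show "\<bar>G t s \<phi> x - G t s \<psi> x\<bar> powr p \<le> G t s ?h x" for x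
      by (rule evolution_operator_Jensen[OF st G s p \<phi> \<psi>])
  qed
  also have "\<dots> = (\<integral>x. ?h x \<partial>\<mu> s)" by (rule evolution_system_invariance[OF \<mu> s h, symmetric])
  finally show ?thesis by (simp add: pth_moment_def)
qed

text \<open>The value at \<open>x\<close> is compared with the values at the points \<open>y\<close> of a ball that carries almost all of \<open>\<mu>\<^sub>t\<close>,
  simultaneously for all \<open>t\<close>. On the ball and on \<open>K\<close> the decay of oscillations is uniform, since \<open>V\<close> is
  bounded there; the remaining mass is multiplied by the bound of the solution.\<close>
lemma evolution_operator_locally_uniform_convergence:
  fixes G :: "real \<Rightarrow> real \<Rightarrow> (real^'n::finite \<Rightarrow> real) \<Rightarrow> real^'n \<Rightarrow> real"
  assumes st: "standing_assumptions Q b" and G: "evolution_operator Q b G" and s: "0 \<le> s"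
    and \<mu>: "evolution_system_of_measures G \<mu>" and tight: "tight_system \<mu>" and f: "f \<in> bcontfun" and K: "compact K" and e: "0 < e"
  shows "\<forall>\<^sub>F t in at_top. \<forall>x\<in>K. \<bar>G t s f x - integral\<^sup>L (\<mu> s) f\<bar> < e"
proof -
  note sol = evolution_operator_solution[OF G s f]
  obtain C V l where l: "0 < l" and V: "continuous_on UNIV V"
    and osc: "\<And>t x y. s \<le> t \<Longrightarrow> G t s f x - G t s f y \<le> C * exp (- l * (t - s)) * (1 + V x + V y)"
    using oscillation_decay[OF st s sol] by blast
  obtain B where B: "B \<ge> 0" "\<And>t x. s \<le> t \<Longrightarrow> \<bar>G t s f x\<bar> \<le> B" using bounded_solution_bound[OF sol] by metis
  define \<delta> where "\<delta> = e / (4 * (B + 1))"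
  have \<delta>: "0 < \<delta>" "2 * B * \<delta> \<le> e / 2" using B e by (auto simp: \<delta>_def field_simps)
  obtain R where R: "R > 0" "\<And>t. t \<ge> 0 \<Longrightarrow> 1 - \<delta> \<le> measure (\<mu> t) (ball 0 R)"
    using tight \<delta>(1) unfolding tight_system_def by blast
  have "compact (V ` (K \<union> cball 0 R))"
    by (intro compact_continuous_image continuous_on_subset[OF V] compact_Un K compact_cball) auto
  from compact_imp_bounded[OF this] obtain H where "\<forall>v\<in>V ` (K \<union> cball 0 R). norm v \<le> H"
    unfolding bounded_iff by blast
  hence H: "\<bar>V x\<bar> \<le> H" if "x \<in> K \<union> cball 0 R" for x using that by auto
  define \<gamma> where "\<gamma> t = \<bar>C\<bar> * (1 + 2 * H) * exp (- (l * (t - s)))" for t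
  have near: "\<bar>G t s f x - G t s f y\<bar> \<le> \<gamma> t" if "s \<le> t" "x \<in> K \<union> cball 0 R" "y \<in> K \<union> cball 0 R" for t x y
  proof -
    have "C * exp (- l * (t - s)) * (1 + V x + V y) \<le> \<gamma> t" if "x \<in> K \<union> cball 0 R" "y \<in> K \<union> cball 0 R" for x y
    proof -
      have "C * exp (- l * (t - s)) * (1 + V x + V y) \<le> \<bar>C * exp (- l * (t - s)) * (1 + V x + V y)\<bar>" by (rule abs_ge_self)
      also have "\<dots> = \<bar>C\<bar> * exp (- (l * (t - s))) * \<bar>1 + V x + V y\<bar>" by (simp add: abs_mult)
      also have "\<dots> \<le> \<bar>C\<bar> * exp (- (l * (t - s))) * (1 + 2 * H)"
      proof (rule mult_left_mono)
        show "\<bar>1 + V x + V y\<bar> \<le> 1 + 2 * H" using H[OF that(1)] H[OF that(2)] by linarith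
      qed simp
      finally show ?thesis by (simp add: \<gamma>_def mult_ac)
    qed
    thus ?thesis using osc[OF that(1), of x y] osc[OF that(1), of y x] that(2,3) by (smt (verit))
  qed
  have "filterlim (\<lambda>t. l * (- s + t)) at_top at_top"
    by (intro filterlim_tendsto_pos_mult_at_top[OF tendsto_const l]
        filterlim_tendsto_add_at_top[OF tendsto_const filterlim_ident])
  hence "filterlim (\<lambda>t. - (l * (t - s))) at_bot at_top" by (simp add: filterlim_uminus_at_bot)
  from filterlim_compose[OF exp_at_bot this]
  have "(\<gamma> \<longlongrightarrow> \<bar>C\<bar> * (1 + 2 * H) * 0) at_top" unfolding \<gamma>_def by (intro tendsto_mult tendsto_const)
  hence "\<forall>\<^sub>F t in at_top. \<gamma> t < e / 2" by (rule order_tendstoD(2)) (use e in simp)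
  thus ?thesis using eventually_ge_at_top[of s]
  proof eventually_elim
    case (elim t)
    show ?case
    proof
      fix x assume x: "x \<in> K"
      have \<mu>t: "prob_space (\<mu> t)" "sets (\<mu> t) = sets borel"
        using evolution_system_prob[OF \<mu>] elim s by auto
      interpret prob_space "\<mu> t" by (rule \<mu>t)
      note bc = evolution_operator_bcontfun[OF G s elim(2) f]
      note int = bcontfun_Lp(2)[OF \<mu>t order_refl bc]
      have ball: "ball 0 R \<in> sets (\<mu> t)" "- ball 0 R \<in> sets (\<mu> t)" using \<mu>t(2) by auto
      have out: "measure (\<mu> t) (- ball 0 R) \<le> \<delta>"
        using R(2)[of t] elim s prob_compl[OF ball(1)] sets_eq_imp_space_eq[OF \<mu>t(2)]
        by (simp add: Compl_eq_Diff_UNIV)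
      have inv: "integral\<^sup>L (\<mu> s) f = (\<integral>y. G t s f y \<partial>\<mu> t)"
        by (rule evolution_system_invariance[OF \<mu> s elim(2) f])
      have "G t s f x - integral\<^sup>L (\<mu> s) f = (\<integral>y. G t s f x - G t s f y \<partial>\<mu> t)"
        unfolding inv using int by (simp add: prob_space)
      hence "\<bar>G t s f x - integral\<^sup>L (\<mu> s) f\<bar> = \<bar>\<integral>y. G t s f x - G t s f y \<partial>\<mu> t\<bar>" by simp
      also have "\<dots> \<le> (\<integral>y. \<bar>G t s f x - G t s f y\<bar> \<partial>\<mu> t)" by (rule integral_abs_bound)
      also have "\<dots> \<le> (\<integral>y. \<gamma> t + 2 * B * indicator (- ball 0 R) y \<partial>\<mu> t)"
      proof (rule integral_mono)
        show "integrable (\<mu> t) (\<lambda>y. \<bar>G t s f x - G t s f y\<bar>)" using int by simp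
        show "integrable (\<mu> t) (\<lambda>y. \<gamma> t + 2 * B * indicator (- ball 0 R) y)"
          using ball by (auto intro!: integrable_real_indicator simp: less_top[symmetric])
        show "\<bar>G t s f x - G t s f y\<bar> \<le> \<gamma> t + 2 * B * indicator (- ball 0 R) y" for y
        proof (cases "y \<in> ball 0 R")
          case True
          thus ?thesis using near[OF elim(2), of x y] x by (auto simp: indicator_def)
        next
          case False
          have "0 \<le> \<gamma> t" using near[OF elim(2), of x x] x by simp
          thus ?thesis using False B(2)[OF elim(2), of x] B(2)[OF elim(2), of y] by (simp add: indicator_def)
        qed
      qed
      also have "\<dots> = \<gamma> t + 2 * B * measure (\<mu> t) (- ball 0 R)"
        using ball by (subst Bochner_Integration.integral_add)
          (auto intro!: integrable_real_indicator simp: less_top[symmetric] prob_space)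
      also have "\<dots> \<le> \<gamma> t + 2 * B * \<delta>" using out B by (intro add_left_mono mult_left_mono) auto
      also have "\<dots> < e" using elim(1) \<delta>(2) by linarith
      finally show "\<bar>G t s f x - integral\<^sup>L (\<mu> s) f\<bar> < e" .
    qed
  qed
qed

text \<open>Uniform smallness on a ball, boundedness outside of it, and tightness; no domination by a fixed
  measure is available because \<open>\<mu>\<^sub>t\<close> varies with \<open>t\<close>.\<close>
lemma evolution_operator_Lp_convergence:
  fixes G :: "real \<Rightarrow> real \<Rightarrow> (real^'n::finite \<Rightarrow> real) \<Rightarrow> real^'n \<Rightarrow> real"
  assumes st: "standing_assumptions Q b" and G: "evolution_operator Q b G" and s: "0 \<le> s" and p: "1 \<le> p"
    and \<mu>: "evolution_system_of_measures G \<mu>" and tight: "tight_system \<mu>" and f: "f \<in> bcontfun" and e: "0 < e"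
  shows "\<forall>\<^sub>F t in at_top. pth_moment p (\<mu> t) (\<lambda>x. G t s f x - integral\<^sup>L (\<mu> s) f) < e"
proof -
  define m where "m = integral\<^sup>L (\<mu> s) f"
  note sol = evolution_operator_solution[OF G s f]
  obtain B where B: "B \<ge> 0" "\<And>t x. s \<le> t \<Longrightarrow> \<bar>G t s f x\<bar> \<le> B" using bounded_solution_bound[OF sol] by metis
  define D where "D = (B + \<bar>m\<bar>) powr p"
  define \<delta> where "\<delta> = e / (4 * (D + 1))"
  have D: "0 \<le> D" by (simp add: D_def)
  have \<delta>: "0 < \<delta>" "D * \<delta> \<le> e / 4" using D e by (auto simp: \<delta>_def field_simps)
  obtain R where R: "R > 0" "\<And>t. t \<ge> 0 \<Longrightarrow> 1 - \<delta> \<le> measure (\<mu> t) (ball 0 R)"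
    using tight \<delta>(1) unfolding tight_system_def by blast
  define h where "h = (e / 2) powr (1 / p)"
  have h: "0 < h" "h powr p = e / 2" using e p by (auto simp: h_def powr_powr)
  from evolution_operator_locally_uniform_convergence[OF st G s \<mu> tight f compact_cball h(1), of 0 R, folded m_def]
  show ?thesis unfolding m_def[symmetric] using eventually_ge_at_top[of s]
  proof eventually_elim
    case (elim t)
    have \<mu>t: "prob_space (\<mu> t)" "sets (\<mu> t) = sets borel"
      using evolution_system_prob[OF \<mu>] elim s by auto
    interpret prob_space "\<mu> t" by (rule \<mu>t)
    note bc = evolution_operator_bcontfun[OF G s elim(2) f]
    have ball: "ball 0 R \<in> sets (\<mu> t)" "- ball 0 R \<in> sets (\<mu> t)" using \<mu>t(2) by auto
    have out: "measure (\<mu> t) (- ball 0 R) \<le> \<delta>"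
      using R(2)[of t] elim s prob_compl[OF ball(1)] sets_eq_imp_space_eq[OF \<mu>t(2)]
      by (simp add: Compl_eq_Diff_UNIV)
    have mb: "(\<lambda>_. m) \<in> bcontfun" by (intro bcontfun_realI[of _ "\<bar>m\<bar>"]) auto
    have "pth_moment p (\<mu> t) (\<lambda>x. G t s f x - m) \<le> (\<integral>y. e / 2 + D * indicator (- ball 0 R) y \<partial>\<mu> t)"
      unfolding pth_moment_def
    proof (rule integral_mono)
      show "integrable (\<mu> t) (\<lambda>y. \<bar>G t s f y - m\<bar> powr p)"
        by (rule bcontfun_Lp(2)[OF \<mu>t p powr_diff_bcontfun[OF bc mb p]])
      show "integrable (\<mu> t) (\<lambda>y. e / 2 + D * indicator (- ball 0 R) y)"
        using ball by (auto intro!: integrable_real_indicator simp: less_top[symmetric])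
      show "\<bar>G t s f y - m\<bar> powr p \<le> e / 2 + D * indicator (- ball 0 R) y" for y
      proof (cases "y \<in> ball 0 R")
        case True
        hence "\<bar>G t s f y - m\<bar> powr p \<le> h powr p" using elim(1) p by (intro powr_mono2) (auto intro: less_imp_le)
        thus ?thesis using True h by simp
      next
        case False
        have "\<bar>G t s f y - m\<bar> powr p \<le> D" unfolding D_def
          using B(2)[OF elim(2), of y] p by (intro powr_mono2) auto
        thus ?thesis using False e by simp
      qed
    qed
    also have "\<dots> = e / 2 + D * measure (\<mu> t) (- ball 0 R)"
      using ball by (subst Bochner_Integration.integral_add)
        (auto intro!: integrable_real_indicator simp: less_top[symmetric] prob_space)
    also have "\<dots> \<le> e / 2 + D * \<delta>" using out D by (intro add_left_mono mult_left_mono) auto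
    also have "\<dots> < e" using \<delta>(2) e by linarith
    finally show ?case .
  qed
qed

theorem theorem3p2:
  fixes Q :: "real \<Rightarrow> real^'n::finite \<Rightarrow> real^'n^'n"
    and b :: "real \<Rightarrow> real^'n \<Rightarrow> real^'n"
    and G :: "real \<Rightarrow> real \<Rightarrow> (real^'n \<Rightarrow> real) \<Rightarrow> real^'n \<Rightarrow> real"
    and \<mu> :: "real \<Rightarrow> (real^'n) measure"
    and s p :: real
  assumes "standing_assumptions Q b"
    and "evolution_operator Q b G"
    and "0 \<le> s" and "1 \<le> p"
    and "evolution_system_of_measures G \<mu>"
    and "tight_system \<mu>"
  shows "(\<forall>f. Lp_fun p (\<mu> s) f \<longrightarrow>
           ((\<lambda>t. Lp_norm p (\<mu> t) (\<lambda>x. Lp_extension p (\<mu> s) (\<mu> t) (G t s) f x - integral\<^sup>L (\<mu> s) f))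
              \<longlongrightarrow> 0) at_top)
       \<and> (\<forall>f\<in>bcontfun. \<forall>K. compact K \<longrightarrow>
           uniform_limit K (\<lambda>t. G t s f) (\<lambda>_. integral\<^sup>L (\<mu> s) f) at_top)"
proof (intro conjI allI ballI impI)
  fix f :: "real^'n \<Rightarrow> real" and K :: "(real^'n) set"
  assume "f \<in> bcontfun" "compact K"
  note conv = evolution_operator_locally_uniform_convergence[OF assms(1-3,5,6) this]
  show "uniform_limit K (\<lambda>t. G t s f) (\<lambda>_. integral\<^sup>L (\<mu> s) f) at_top"
    using conv by (intro uniform_limitI) (simp add: dist_real_def)
next
  fix f assume f: "Lp_fun p (\<mu> s) f"
  note st = assms(1) and G = assms(2) and s = assms(3) and p = assms(4) and \<mu> = assms(5) and tight = assms(6)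
  define c where "c = (2::real) powr p"
  have c: "0 < c" by (simp add: c_def)
  have \<mu>t: "prob_space (\<mu> t)" "sets (\<mu> t) = sets borel" if "0 \<le> t" for t
    using evolution_system_prob[OF \<mu> that] by auto
  note \<mu>s = \<mu>t[OF s]
  define m where "m = integral\<^sup>L (\<mu> s) f"
  show "((\<lambda>t. Lp_norm p (\<mu> t) (\<lambda>x. Lp_extension p (\<mu> s) (\<mu> t) (G t s) f x - integral\<^sup>L (\<mu> s) f)) \<longlongrightarrow> 0) at_top"
    unfolding Lp_norm_tendsto_0_iff[OF p] m_def[symmetric]
  proof (rule order_tendstoI)
    fix e :: real assume "e < 0"
    thus "\<forall>\<^sub>F t in at_top. e < pth_moment p (\<mu> t) (\<lambda>x. Lp_extension p (\<mu> s) (\<mu> t) (G t s) f x - m)"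
      by (intro always_eventually allI less_le_trans[OF _ pth_moment_nonneg])
  next
    fix e :: real assume e: "0 < e"
    define \<delta> where "\<delta> = e / (2 * (c * (c * c + c)))"
    have \<delta>: "0 < \<delta>" using e c by (simp add: \<delta>_def add_pos_pos)
    obtain \<phi> where \<phi>: "\<phi> \<in> bcontfun" "pth_moment p (\<mu> s) (\<lambda>x. \<phi> x - f x) < \<delta>"
      using bcontfun_Lp_dense[OF \<mu>s p f \<delta>] by blast
    define m' where "m' = integral\<^sup>L (\<mu> s) \<phi>"
    have mm: "\<bar>m' - m\<bar> powr p < \<delta>"
    proof -
      have "m' - m = (\<integral>x. \<phi> x - f x \<partial>\<mu> s)" unfolding m'_def m_def
        using bcontfun_Lp(2)[OF \<mu>s p \<phi>(1)] Lp_fun_integrable[OF \<mu>s(1) p f] by simp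
      thus ?thesis
        using integral_powr_le_pth_moment(1)[OF \<mu>s(1) p Lp_fun_diff[OF p bcontfun_Lp(1)[OF \<mu>s p \<phi>(1)] f]] \<phi>(2) by simp
    qed
    have "0 < e / (2 * (c * c))" using e c by simp
    from evolution_operator_Lp_convergence[OF st G s p \<mu> tight \<phi>(1) this, folded m'_def]
    show "\<forall>\<^sub>F t in at_top. pth_moment p (\<mu> t) (\<lambda>x. Lp_extension p (\<mu> s) (\<mu> t) (G t s) f x - m) < e"
      using eventually_ge_at_top[of s]
    proof eventually_elim
      case (elim t)
      have t: "0 \<le> t" using elim s by simp
      define g where "g = Lp_extension p (\<mu> s) (\<mu> t) (G t s) f"
      note bc = evolution_operator_bcontfun[OF G s elim(2)]
      note contr = evolution_operator_contraction[OF st G s elim(2) p \<mu>]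
      have ext: "Lp_fun p (\<mu> t) g" unfolding g_def
        by (rule Lp_extension_bound(1)[OF \<mu>s \<mu>t[OF t] p bc contr f]; assumption)
      have ext_close: "pth_moment p (\<mu> t) (\<lambda>x. G t s \<phi> x - g x) \<le> c * (c * pth_moment p (\<mu> s) (\<lambda>x. \<phi> x - f x))"
        unfolding g_def c_def
        by (rule Lp_extension_bound(2)[OF \<mu>s \<mu>t[OF t] p bc contr f]; (assumption | rule \<phi>(1)))
      have const: "Lp_fun p (\<mu> t) (\<lambda>_. k)" for k
        by (rule bcontfun_Lp(1)[OF \<mu>t[OF t] p]) (intro bcontfun_realI[of _ "\<bar>k\<bar>"], auto)
      note GLp = bcontfun_Lp(1)[OF \<mu>t[OF t] p bc[OF \<phi>(1)]]
      have "pth_moment p (\<mu> t) (\<lambda>x. g x - m)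
          \<le> c * (pth_moment p (\<mu> t) (\<lambda>x. g x - G t s \<phi> x) + pth_moment p (\<mu> t) (\<lambda>x. G t s \<phi> x - m))"
        unfolding c_def by (rule pth_moment_triangle[OF p ext GLp const])
      also have "pth_moment p (\<mu> t) (\<lambda>x. g x - G t s \<phi> x) \<le> c * (c * \<delta>)"
      proof -
        have "pth_moment p (\<mu> t) (\<lambda>x. g x - G t s \<phi> x) = pth_moment p (\<mu> t) (\<lambda>x. G t s \<phi> x - g x)"
          by (rule pth_moment_minus_commute)
        also have "\<dots> \<le> c * (c * pth_moment p (\<mu> s) (\<lambda>x. \<phi> x - f x))" by (rule ext_close)
        also have "\<dots> \<le> c * (c * \<delta>)" using \<phi>(2) c by (intro mult_left_mono) auto
        finally show ?thesis .
      qed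
      also have "pth_moment p (\<mu> t) (\<lambda>x. G t s \<phi> x - m) \<le> c * (pth_moment p (\<mu> t) (\<lambda>x. G t s \<phi> x - m') + pth_moment p (\<mu> t) (\<lambda>x. m' - m))"
        unfolding c_def by (rule pth_moment_triangle[OF p GLp const const])
      also have "pth_moment p (\<mu> t) (\<lambda>x. m' - m) \<le> \<delta>"
        using mm prob_space.prob_space[OF \<mu>t(1)[OF t]] by (simp add: pth_moment_def)
      finally have "pth_moment p (\<mu> t) (\<lambda>x. g x - m)
          \<le> c * (c * (c * \<delta>) + c * (pth_moment p (\<mu> t) (\<lambda>x. G t s \<phi> x - m') + \<delta>))" using c by simp
      also have "\<dots> < c * (c * (c * \<delta>) + c * (e / (2 * (c * c)) + \<delta>))"
        using elim(1) c by (intro mult_strict_left_mono add_strict_left_mono add_strict_right_mono) auto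
      also have "\<dots> = c * (c * c + c) * \<delta> + e / 2" using c by (simp add: field_simps)
      also have "c * (c * c + c) * \<delta> = e / 2"
      proof -
        have "0 < c * (c * c + c)" by (intro mult_pos_pos add_pos_pos c)
        moreover have "d * (e / (2 * d)) = e / 2" if "0 < d" for d :: real using that by simp
        ultimately show ?thesis unfolding \<delta>_def by blast
      qed
      finally show ?case unfolding g_def by simp
    qed
  qed
qed

end
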